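(* (Positive mass theorem.) Let $n\ge4$, let $\lambda$ be a real constant, and suppose $(M^n,g)$ is the graph of a smooth asymptotically flat map $f:\mathbb{R}^n\to\mathbb{R}^m$ of order $\tau>\frac{n-2}{2}$, with induced metric $g_{ij}=\delta_{ij}+\sum_\alpha f^\alpha_if^\alpha_j$, such that $R+\lambda L_2$ is integrable. Then $$m_{ADM}=m_{EGB}=\frac{1}{2(n-1)\omega_{n-1}}\int_M\big(R+\lambda L_2+R^\perp+\lambda L_2^\perp\big)\frac1{\sqrt G}\,d\mu_M .$$ In particular, when $M$ has flat normal bundle as a submanifold of $\mathbb{R}^{n+m}$ and $R+\lambda L_2\ge0$, we have $m_{ADM}\ge0$.
   Context: Notation: indices $1\le i,j,k,l,s\le n$, $1\le\alpha,\beta,\gamma\le m$, repeated indices summed; $f^\alpha_i,f^\alpha_{ij},f^\alpha_{ijk}$ partial derivatives. $f$ asymptotically flat of order $\tau$: $|f^\alpha_i(x)|+|f^\alpha_{ij}(x)||x|+|f^\alpha_{ijk}(x)||x|^2=O(|x|^{-\tau/2})$ as $|x|\to\infty$. $M$ is parametrized by $x\in\mathbb{R}^n$, $\partial_i=(e_i,f^\alpha_ie_\alpha)$, $G=\det(g_{ij})$, $U_{\alpha\beta}=\delta_{\alpha\beta}+\langle Df^\alpha,Df^\beta\rangle$ with inverse $U^{\alpha\beta}$. Curvature convention: $R_{ijij}$ is the sectional curvature of an orthonormal pair, $R_{jl}=g^{ik}R_{ijkl}$, $R=g^{jl}R_{jl}$, indices raised with $g$. $P_1^{ijkl}=\tfrac12(g^{ik}g^{jl}-g^{il}g^{jk})$,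 $P_2^{ijkl}=R^{ijkl}+R^{jk}g^{il}-R^{jl}g^{ik}-R^{ik}g^{jl}+R^{il}g^{jk}+\tfrac12R(g^{ik}g^{jl}-g^{il}g^{jk})$, $L_2=P_2^{ijkl}R_{ijkl}$. With $S_r=\{|x|=r\}$, Euclidean area element $dS$, $\nu=x/r$, $\omega_{n-1}=|S^{n-1}|$: $m_{ADM}=\frac{1}{(n-1)\omega_{n-1}}\lim_{r\to\infty}\int_{S_r}P_1^{ijkl}\partial_lg_{jk}\nu_i\,dS$ and $m_{EGB}=\frac{1}{(n-1)\omega_{n-1}}\lim_{r\to\infty}\int_{S_r}(P_1^{ijkl}+\lambda P_2^{ijkl})\partial_lg_{jk}\nu_i\,dS$. Shape operators $A^\alpha\partial_i=f^\alpha_{ik}g^{kj}\partial_j$ (w.r.t. normals $\eta^\alpha=(-Df^\alpha,e_\alpha)$), normal curvature operators $R^\perp_{\alpha\beta}=A^\beta A^\alpha-A^\alpha A^\beta$, gradients $\nabla f^\alpha=g^{jk}f^\alpha_k\partial_j$, and $R^\perp=\sum_{\alpha,\gamma}\langle R^\perp_{\alpha\gamma}(\nabla f^\alpha),\nabla f^\gamma\rangle$. $T_{ijkl}=U^{\beta\gamma}f^\beta_sf^\alpha_k(f^\gamma_{js}f^\alpha_{il}-f^\gamma_{il}f^\alpha_{js})$ and $L_2^\perp=2P_2^{ijkl}T_{ijkl}$. Flat normal bundle means $R^\perp_{\alpha\beta}=0$ for all $\alpha,\beta$. *)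

theory Defs
  imports "HOL-Analysis.Analysis"
begin

definition pd :: "'n::finite \<Rightarrow> (real^'n \<Rightarrow> real) \<Rightarrow> real^'n \<Rightarrow> real" where
  "pd i h x = frechet_derivative h (at x) (axis i 1)"

primrec pds :: "'n::finite list \<Rightarrow> (real^'n \<Rightarrow> real) \<Rightarrow> real^'n \<Rightarrow> real" where
  "pds [] h = h"
| "pds (i # is) h = pd i (pds is h)"

definition smooth_fun :: "(real^'n::finite \<Rightarrow> real) \<Rightarrow> bool" where
  "smooth_fun h \<longleftrightarrow> (\<forall>is x. pds is h differentiable (at x))"

definition smooth_map :: "(real^'n::finite \<Rightarrow> real^'m::finite) \<Rightarrow> bool" where
  "smooth_map f \<longleftrightarrow> (\<forall>\<alpha>. smooth_fun (\<lambda>y. f y $ \<alpha>))"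

definition f1 :: "(real^'n::finite \<Rightarrow> real^'m::finite) \<Rightarrow> 'm \<Rightarrow> 'n \<Rightarrow> real^'n \<Rightarrow> real" where
  "f1 f a i x = pd i (\<lambda>y. f y $ a) x"

definition f2 :: "(real^'n::finite \<Rightarrow> real^'m::finite) \<Rightarrow> 'm \<Rightarrow> 'n \<Rightarrow> 'n \<Rightarrow> real^'n \<Rightarrow> real" where
  "f2 f a i j x = pd j (\<lambda>y. f1 f a i y) x"

definition f3 :: "(real^'n::finite \<Rightarrow> real^'m::finite) \<Rightarrow> 'm \<Rightarrow> 'n \<Rightarrow> 'n \<Rightarrow> 'n \<Rightarrow> real^'n \<Rightarrow> real" where
  "f3 f a i j k x = pd k (\<lambda>y. f2 f a i j y) x"

definition asymp_flat :: "(real^'n::finite \<Rightarrow> real^'m::finite) \<Rightarrow> real \<Rightarrow> bool" where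
  "asymp_flat f \<tau> \<longleftrightarrow> (\<exists>C R0. \<forall>x. norm x \<ge> R0 \<longrightarrow>
     (\<forall>a i j k. \<bar>f1 f a i x\<bar> + \<bar>f2 f a i j x\<bar> * norm x + \<bar>f3 f a i j k x\<bar> * (norm x)\<^sup>2
        \<le> C * norm x powr (- \<tau> / 2)))"

definition gm :: "(real^'n::finite \<Rightarrow> real^'m::finite) \<Rightarrow> real^'n \<Rightarrow> real^'n^'n" where
  "gm f x = (\<chi> i j. (if i = j then 1 else 0) + (\<Sum>a\<in>UNIV. f1 f a i x * f1 f a j x))"

definition gi :: "(real^'n::finite \<Rightarrow> real^'m::finite) \<Rightarrow> real^'n \<Rightarrow> real^'n^'n" where
  "gi f x = matrix_inv (gm f x)"

definition Gdet :: "(real^'n::finite \<Rightarrow> real^'m::finite) \<Rightarrow> real^'n \<Rightarrow> real" where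
  "Gdet f x = det (gm f x)"

definition Umat :: "(real^'n::finite \<Rightarrow> real^'m::finite) \<Rightarrow> real^'n \<Rightarrow> real^'m^'m" where
  "Umat f x = (\<chi> a b. (if a = b then 1 else 0) + (\<Sum>i\<in>UNIV. f1 f a i x * f1 f b i x))"

definition Ui :: "(real^'n::finite \<Rightarrow> real^'m::finite) \<Rightarrow> real^'n \<Rightarrow> real^'m^'m" where
  "Ui f x = matrix_inv (Umat f x)"

definition chr :: "(real^'n::finite \<Rightarrow> real^'m::finite) \<Rightarrow> 'n \<Rightarrow> 'n \<Rightarrow> 'n \<Rightarrow> real^'n \<Rightarrow> real" where
  "chr f k i j x = (1/2) * (\<Sum>l\<in>UNIV. gi f x $ k $ l *
     (pd i (\<lambda>y. gm f y $ j $ l) x + pd j (\<lambda>y. gm f y $ i $ l) x - pd l (\<lambda>y. gm f y $ i $ j) x))"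

text \<open>R(d_i,d_j)d_l = Rup^s_{ijl} d_s with R(X,Y)Z = nabla_X nabla_Y Z - nabla_Y nabla_X Z - nabla_[X,Y] Z.\<close>
definition Rup :: "(real^'n::finite \<Rightarrow> real^'m::finite) \<Rightarrow> 'n \<Rightarrow> 'n \<Rightarrow> 'n \<Rightarrow> 'n \<Rightarrow> real^'n \<Rightarrow> real" where
  "Rup f s i j l x = pd i (\<lambda>y. chr f s j l y) x - pd j (\<lambda>y. chr f s i l y) x
     + (\<Sum>p\<in>UNIV. chr f p j l x * chr f s i p x - chr f p i l x * chr f s j p x)"

text \<open>R_ijkl = g(R(d_i,d_j)d_l, d_k), so that R_ijij is the sectional curvature.\<close>
definition Rm :: "(real^'n::finite \<Rightarrow> real^'m::finite) \<Rightarrow> 'n \<Rightarrow> 'n \<Rightarrow> 'n \<Rightarrow> 'n \<Rightarrow> real^'n \<Rightarrow> real" where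
  "Rm f i j k l x = (\<Sum>s\<in>UNIV. gm f x $ k $ s * Rup f s i j l x)"

definition Ric :: "(real^'n::finite \<Rightarrow> real^'m::finite) \<Rightarrow> 'n \<Rightarrow> 'n \<Rightarrow> real^'n \<Rightarrow> real" where
  "Ric f j l x = (\<Sum>i\<in>UNIV. \<Sum>k\<in>UNIV. gi f x $ i $ k * Rm f i j k l x)"

definition Scal :: "(real^'n::finite \<Rightarrow> real^'m::finite) \<Rightarrow> real^'n \<Rightarrow> real" where
  "Scal f x = (\<Sum>j\<in>UNIV. \<Sum>l\<in>UNIV. gi f x $ j $ l * Ric f j l x)"

definition Rm_up :: "(real^'n::finite \<Rightarrow> real^'m::finite) \<Rightarrow> 'n \<Rightarrow> 'n \<Rightarrow> 'n \<Rightarrow> 'n \<Rightarrow> real^'n \<Rightarrow> real" where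
  "Rm_up f i j k l x = (\<Sum>a\<in>UNIV. \<Sum>b\<in>UNIV. \<Sum>c\<in>UNIV. \<Sum>d\<in>UNIV.
     gi f x $ i $ a * gi f x $ j $ b * gi f x $ k $ c * gi f x $ l $ d * Rm f a b c d x)"

definition Ric_up :: "(real^'n::finite \<Rightarrow> real^'m::finite) \<Rightarrow> 'n \<Rightarrow> 'n \<Rightarrow> real^'n \<Rightarrow> real" where
  "Ric_up f j k x = (\<Sum>a\<in>UNIV. \<Sum>b\<in>UNIV. gi f x $ j $ a * gi f x $ k $ b * Ric f a b x)"

definition P1 :: "(real^'n::finite \<Rightarrow> real^'m::finite) \<Rightarrow> 'n \<Rightarrow> 'n \<Rightarrow> 'n \<Rightarrow> 'n \<Rightarrow> real^'n \<Rightarrow> real" where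
  "P1 f i j k l x = (1/2) * (gi f x $ i $ k * gi f x $ j $ l - gi f x $ i $ l * gi f x $ j $ k)"

definition P2 :: "(real^'n::finite \<Rightarrow> real^'m::finite) \<Rightarrow> 'n \<Rightarrow> 'n \<Rightarrow> 'n \<Rightarrow> 'n \<Rightarrow> real^'n \<Rightarrow> real" where
  "P2 f i j k l x = Rm_up f i j k l x
     + Ric_up f j k x * gi f x $ i $ l - Ric_up f j l x * gi f x $ i $ k
     - Ric_up f i k x * gi f x $ j $ l + Ric_up f i l x * gi f x $ j $ k
     + (1/2) * Scal f x * (gi f x $ i $ k * gi f x $ j $ l - gi f x $ i $ l * gi f x $ j $ k)"

definition L2 :: "(real^'n::finite \<Rightarrow> real^'m::finite) \<Rightarrow> real^'n \<Rightarrow> real" where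
  "L2 f x = (\<Sum>i\<in>UNIV. \<Sum>j\<in>UNIV. \<Sum>k\<in>UNIV. \<Sum>l\<in>UNIV. P2 f i j k l x * Rm f i j k l x)"

definition Tt :: "(real^'n::finite \<Rightarrow> real^'m::finite) \<Rightarrow> 'n \<Rightarrow> 'n \<Rightarrow> 'n \<Rightarrow> 'n \<Rightarrow> real^'n \<Rightarrow> real" where
  "Tt f i j k l x = (\<Sum>b\<in>UNIV. \<Sum>c\<in>UNIV. \<Sum>s\<in>UNIV. \<Sum>a\<in>UNIV.
     Ui f x $ b $ c * f1 f b s x * f1 f a k x *
       (f2 f c j s x * f2 f a i l x - f2 f c i l x * f2 f a j s x))"

definition L2perp :: "(real^'n::finite \<Rightarrow> real^'m::finite) \<Rightarrow> real^'n \<Rightarrow> real" where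
  "L2perp f x = 2 * (\<Sum>i\<in>UNIV. \<Sum>j\<in>UNIV. \<Sum>k\<in>UNIV. \<Sum>l\<in>UNIV. P2 f i j k l x * Tt f i j k l x)"

definition Aop :: "(real^'n::finite \<Rightarrow> real^'m::finite) \<Rightarrow> 'm \<Rightarrow> real^'n \<Rightarrow> real^'n^'n" where
  "Aop f a x = gi f x ** (\<chi> k i. f2 f a k i x)"

definition Rperp_op :: "(real^'n::finite \<Rightarrow> real^'m::finite) \<Rightarrow> 'm \<Rightarrow> 'm \<Rightarrow> real^'n \<Rightarrow> real^'n^'n" where
  "Rperp_op f a b x = Aop f b x ** Aop f a x - Aop f a x ** Aop f b x"

definition gradf :: "(real^'n::finite \<Rightarrow> real^'m::finite) \<Rightarrow> 'm \<Rightarrow> real^'n \<Rightarrow> real^'n" where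
  "gradf f a x = gi f x *v (\<chi> k. f1 f a k x)"

definition ginner :: "(real^'n::finite \<Rightarrow> real^'m::finite) \<Rightarrow> real^'n \<Rightarrow> real^'n \<Rightarrow> real^'n \<Rightarrow> real" where
  "ginner f x u v = u \<bullet> (gm f x *v v)"

definition Rperp :: "(real^'n::finite \<Rightarrow> real^'m::finite) \<Rightarrow> real^'n \<Rightarrow> real" where
  "Rperp f x = (\<Sum>a\<in>UNIV. \<Sum>c\<in>UNIV. ginner f x (Rperp_op f a c x *v gradf f a x) (gradf f c x))"

definition flat_normal_bundle :: "(real^'n::finite \<Rightarrow> real^'m::finite) \<Rightarrow> bool" where
  "flat_normal_bundle f \<longleftrightarrow> (\<forall>a b x. Rperp_op f a b x = 0)"

text \<open>Integral over S_r w.r.t. Euclidean area: r^(n-1) times the integral over S^(n-1) of the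
  rescaled function, where the area measure of S^(n-1) is the cone measure
  (integral of phi over S^(n-1) = n * integral over the unit ball of phi(x/|x|)).\<close>
definition sphere_int :: "real \<Rightarrow> (real^'n::finite \<Rightarrow> real) \<Rightarrow> real" where
  "sphere_int r h = r ^ (CARD('n) - 1) * real CARD('n) *
     (\<integral>x\<in>ball 0 1. h (r *\<^sub>R (x /\<^sub>R norm x)) \<partial>lborel)"

definition omega :: "nat \<Rightarrow> real" where
  "omega n = real n * unit_ball_vol (real n)"  \<comment> \<open>omega n = |S^(n-1)|\<close>

definition adm_flux :: "(real^'n::finite \<Rightarrow> real^'m::finite) \<Rightarrow> real \<Rightarrow> real" where
  "adm_flux f r = 1 / ((real CARD('n) - 1) * omega CARD('n)) *
     sphere_int r (\<lambda>x. \<Sum>i\<in>UNIV. \<Sum>j\<in>UNIV. \<Sum>k\<in>UNIV. \<Sum>l\<in>UNIV.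
        P1 f i j k l x * pd l (\<lambda>y. gm f y $ j $ k) x * (x $ i / norm x))"

definition egb_flux :: "real \<Rightarrow> (real^'n::finite \<Rightarrow> real^'m::finite) \<Rightarrow> real \<Rightarrow> real" where
  "egb_flux lam f r = 1 / ((real CARD('n) - 1) * omega CARD('n)) *
     sphere_int r (\<lambda>x. \<Sum>i\<in>UNIV. \<Sum>j\<in>UNIV. \<Sum>k\<in>UNIV. \<Sum>l\<in>UNIV.
        (P1 f i j k l x + lam * P2 f i j k l x) * pd l (\<lambda>y. gm f y $ j $ k) x * (x $ i / norm x))"

end

theory Submission
  imports Defs
begin

text \<open>By the antisymmetry of \<open>P\<close> in its last two indices, the flux density \<open>P\<^bsup>ijkl\<^esup> \<partial>\<^sub>l g\<^sub>j\<^sub>k\<close> is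
  \<open>V\<^sup>i = P\<^bsup>ijkl\<^esup> f\<^sub>j\<^sub>l f\<^sub>k\<close> (summed over the components of \<open>f\<close>). Both \<open>P\<^sub>1\<close> and \<open>P\<^sub>2\<close> are
  divergence-free, and with the Gauss equation this gives the pointwise identity
  \<open>2 \<partial>\<^sub>i V\<^sup>i = R + \<lambda> L\<^sub>2 + R\<^sup>\<bottom> + \<lambda> L\<^sub>2\<^sup>\<bottom>\<close>, in which no third derivatives of \<open>f\<close> survive. The divergence
  theorem on balls, obtained by testing \<open>div V\<close> against radial cutoffs, turns the fluxes into volume
  integrals. Here \<open>R\<^sup>\<bottom>\<close> and \<open>L\<^sub>2\<^sup>\<bottom>\<close> are \<open>O(|x|\<^bsup>-2\<tau>-2\<^esup>)\<close>, hence integrable because \<open>2\<tau> + 2 > n\<close>, while the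
  \<open>P\<^sub>2\<close>-part of the flux is \<open>O(r\<^bsup>n-4-2\<tau>\<^esup>)\<close>, so that both masses agree. For a flat normal bundle the
  shape operators commute, and then \<open>R\<^sup>\<bottom>\<close> and \<open>L\<^sub>2\<^sup>\<bottom>\<close> vanish.\<close>

text \<open>The divergence is computed in mixed components. With two indices of \<open>P\<close>
  lowered the tensor becomes \<open>Qtot\<close>, a polynomial in the matrices \<open>Aop\<close> of
  the shape operators whose only other ingredients are Kronecker deltas and \<open>Ui\<close>.
  Deltas are parallel, and \<open>Ui\<close>, the inverse Gram matrix of the non-orthonormal frame
  of the \<open>\<eta>\<close>, is parallel for the normal connection. Hence the derivative of
  \<open>Qtot\<close> comes from the product rule, with the Codazzi symmetry of \<open>DA\<close> as
  the only geometric input. The divergence is the Euclidean one. The Christoffel trace by which it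
  differs from the Riemannian one yields one half of \<open>T\<close>; the connection form of the
  normal frame yields the other half. Only R + \<lambda> L2 is assumed integrable, so the ADM flux
  has no convergent volume integral of its own to start from; its limit is that of the EGB flux
  minus the vanishing part from \<open>P2\<close>. The hypothesis carries the weight sqrt G, which
  is bounded below because the entries of the inverse metric never exceed 1 in absolute
  value.\<close>

abbreviation (input) sum_UNIV :: "('a \<Rightarrow> 'b::comm_monoid_add) \<Rightarrow> 'b"  (binder \<open>\<Sigma>\<close> 10) where
  "sum_UNIV h \<equiv> sum h UNIV"

subsection \<open>Partial derivatives\<close>

lemma pd_has_real_derivative:
  assumes "h differentiable (at x)"
  shows "((\<lambda>t. h (x + t *\<^sub>R axis i 1)) has_real_derivative pd i h x) (at 0)"
proof -
  from assms have h: "(h has_derivative frechet_derivative h (at x)) (at x)"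
    by (simp add: frechet_derivative_works)
  have "((\<lambda>t::real. h (x + t *\<^sub>R axis i 1)) has_derivative
        (\<lambda>t. frechet_derivative h (at x) (t *\<^sub>R axis i 1))) (at 0)"
    by (rule has_derivative_compose[where g=h and f="\<lambda>t. x + t *\<^sub>R axis i 1"])
       (auto intro!: derivative_eq_intros simp: h)
  moreover have "frechet_derivative h (at x) (t *\<^sub>R axis i 1) = pd i h x * t" for t
    using linear_frechet_derivative[OF assms] by (simp add: pd_def linear_cmul)
  ultimately show ?thesis by (simp add: has_field_derivative_def)
qed

lemma pd_has_real_derivative':
  assumes "h differentiable (at (x + s *\<^sub>R axis i 1))"
  shows "((\<lambda>t. h (x + t *\<^sub>R axis i 1)) has_real_derivative pd i h (x + s *\<^sub>R axis i 1)) (at s)"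
proof -
  have "((\<lambda>t. h ((x + s *\<^sub>R axis i 1) + t *\<^sub>R axis i 1)) has_real_derivative pd i h (x + s *\<^sub>R axis i 1)) (at 0)"
    by (rule pd_has_real_derivative[OF assms])
  then have "((\<lambda>t. h (x + (s + t) *\<^sub>R axis i 1)) has_real_derivative pd i h (x + s *\<^sub>R axis i 1)) (at 0)"
    by (simp add: algebra_simps)
  then show ?thesis
    using DERIV_at_within_shift[of "\<lambda>t. h (x + t *\<^sub>R axis i 1)" "pd i h (x + s *\<^sub>R axis i 1)" s 0 UNIV]
    by simp
qed

lemma pd_eqI:
  assumes "(h has_derivative D) (at x)"
  shows "pd i h x = D (axis i 1)"
  using frechet_derivative_at[OF assms] by (simp add: pd_def)

lemma pd_const [simp]: "pd i (\<lambda>x. c) x = 0"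
  by (rule pd_eqI[OF has_derivative_const, THEN trans]) simp

lemma
  assumes "h differentiable (at x)" "k differentiable (at x)"
  shows pd_add: "pd i (\<lambda>y. h y + k y) x = pd i h x + pd i k x"
    and pd_diff: "pd i (\<lambda>y. h y - k y) x = pd i h x - pd i k x"
    and pd_mult: "pd i (\<lambda>y. h y * k y) x = pd i h x * k x + h x * pd i k x"
proof -
  have D: "(h has_derivative frechet_derivative h (at x)) (at x)"
      "(k has_derivative frechet_derivative k (at x)) (at x)"
    using assms by (simp_all add: frechet_derivative_works)
  show "pd i (\<lambda>y. h y + k y) x = pd i h x + pd i k x"
    by (rule pd_eqI[OF has_derivative_add[OF D], THEN trans]) (simp add: pd_def)
  show "pd i (\<lambda>y. h y - k y) x = pd i h x - pd i k x"
    by (rule pd_eqI[OF has_derivative_diff[OF D], THEN trans]) (simp add: pd_def)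
  show "pd i (\<lambda>y. h y * k y) x = pd i h x * k x + h x * pd i k x"
    by (rule pd_eqI[OF has_derivative_mult[OF D], THEN trans]) (simp add: pd_def)
qed

lemma pd_cmult:
  assumes "h differentiable (at x)"
  shows "pd i (\<lambda>y. c * h y) x = c * pd i h x"
  using pd_mult[OF differentiable_const assms, of i c] by simp

lemma differentiable_sum_fun:
  assumes "\<And>a. a \<in> A \<Longrightarrow> (\<lambda>y. h a y) differentiable (at x)"
  shows "(\<lambda>y. \<Sum>a\<in>A. h a y) differentiable (at x)"
  using assms by (induction A rule: infinite_finite_induct) auto

lemma pd_sum:
  assumes "\<And>a. a \<in> A \<Longrightarrow> h a differentiable (at x)"
  shows "pd i (\<lambda>y. \<Sum>a\<in>A. h a y) x = (\<Sum>a\<in>A. pd i (h a) x)"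
  using assms
proof (induction A rule: infinite_finite_induct)
  case (insert b A)
  then show ?case
    using pd_add[of "h b" x "\<lambda>y. \<Sum>a\<in>A. h a y" i] by (simp add: differentiable_sum_fun)
qed auto

lemma differentiable_prod_fun:
  assumes "\<And>a. a \<in> A \<Longrightarrow> (\<lambda>y. h a y :: real) differentiable (at x)"
  shows "(\<lambda>y. \<Prod>a\<in>A. h a y) differentiable (at x)"
  using assms by (induction A rule: infinite_finite_induct) auto

text \<open>The second difference is symmetric in \<open>i\<close> and \<open>j\<close>, so \<open>t \<rightarrow> 0\<close> shows that mixed derivatives commute.\<close>
lemma second_difference_pd:
  fixes h :: "real^'n::finite \<Rightarrow> real"
  assumes h: "\<And>x. h differentiable (at x)" and h1: "\<And>x. pd i h differentiable (at x)" and t: "t > 0"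
  shows "\<exists>y. norm (y - x) \<le> 2 * t \<and>
     h (x + t *\<^sub>R axis i 1 + t *\<^sub>R axis j 1) - h (x + t *\<^sub>R axis i 1) - h (x + t *\<^sub>R axis j 1) + h x
       = t\<^sup>2 * pd j (pd i h) y"
proof -
  define \<phi> where "\<phi> = (\<lambda>s. h ((x + t *\<^sub>R axis j 1) + s *\<^sub>R axis i 1) - h (x + s *\<^sub>R axis i 1))"
  have "\<exists>s. 0 < s \<and> s < t \<and> \<phi> t - \<phi> 0 = (t - 0) *
      (pd i h ((x + t *\<^sub>R axis j 1) + s *\<^sub>R axis i 1) - pd i h (x + s *\<^sub>R axis i 1))"
    unfolding \<phi>_def
    by (rule MVT2) (use t in \<open>auto intro!: DERIV_diff pd_has_real_derivative' h\<close>)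
  then obtain s where s: "0 < s" "s < t" "\<phi> t - \<phi> 0 = t *
      (pd i h ((x + t *\<^sub>R axis j 1) + s *\<^sub>R axis i 1) - pd i h (x + s *\<^sub>R axis i 1))" by auto
  have "\<exists>r. 0 < r \<and> r < t \<and> pd i h ((x + s *\<^sub>R axis i 1) + t *\<^sub>R axis j 1) - pd i h ((x + s *\<^sub>R axis i 1) + 0 *\<^sub>R axis j 1)
     = (t - 0) * pd j (pd i h) ((x + s *\<^sub>R axis i 1) + r *\<^sub>R axis j 1)"
    by (rule MVT2) (use t in \<open>auto intro!: pd_has_real_derivative' h1\<close>)
  then obtain r where r: "0 < r" "r < t" "pd i h ((x + s *\<^sub>R axis i 1) + t *\<^sub>R axis j 1) - pd i h (x + s *\<^sub>R axis i 1)
     = t * pd j (pd i h) ((x + s *\<^sub>R axis i 1) + r *\<^sub>R axis j 1)" by auto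
  let ?y = "(x + s *\<^sub>R axis i 1) + r *\<^sub>R axis j 1"
  have "norm (?y - x) \<le> norm (s *\<^sub>R (axis i 1 :: real^'n)) + norm (r *\<^sub>R (axis j 1 :: real^'n))"
    by (metis (no_types, lifting) add.assoc add_diff_cancel_left' norm_triangle_ineq)
  also have "\<dots> \<le> 2 * t" using s r by (simp add: norm_axis_1)
  finally have "norm (?y - x) \<le> 2 * t" .
  moreover have "\<phi> t - \<phi> 0 = t\<^sup>2 * pd j (pd i h) ?y"
    using s(3) r(3) by (simp add: add.assoc add.commute add.left_commute power2_eq_square)
  ultimately show ?thesis
    by (intro exI[of _ ?y]) (simp add: \<phi>_def algebra_simps)
qed

lemma pd_commute:
  fixes h :: "real^'n::finite \<Rightarrow> real"
  assumes h: "\<And>x. h differentiable (at x)" and h1: "\<And>i x. pd i h differentiable (at x)"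
    and c: "\<And>i j x. isCont (pd j (pd i h)) x"
  shows "pd j (pd i h) x = pd i (pd j h) x"
proof -
  let ?d = "\<lambda>n. 1 / real (Suc n)"
  have ex: "\<exists>y. norm (y - x) \<le> 2 * ?d n \<and>
     h (x + ?d n *\<^sub>R axis i 1 + ?d n *\<^sub>R axis j 1) - h (x + ?d n *\<^sub>R axis i 1) - h (x + ?d n *\<^sub>R axis j 1) + h x
       = (?d n)\<^sup>2 * pd j (pd i h) y" for n i j
    by (rule second_difference_pd) (auto simp: h h1)
  have lim: "(\<lambda>n. (h (x + ?d n *\<^sub>R axis i 1 + ?d n *\<^sub>R axis j 1) - h (x + ?d n *\<^sub>R axis i 1) - h (x + ?d n *\<^sub>R axis j 1) + h x) / (?d n)\<^sup>2)
      \<longlonglongrightarrow> pd j (pd i h) x" for i j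
  proof -
    obtain y where y: "\<And>n. norm (y n - x) \<le> 2 * ?d n"
      "\<And>n. h (x + ?d n *\<^sub>R axis i 1 + ?d n *\<^sub>R axis j 1) - h (x + ?d n *\<^sub>R axis i 1) - h (x + ?d n *\<^sub>R axis j 1) + h x
       = (?d n)\<^sup>2 * pd j (pd i h) (y n)" using ex[where i=i and j=j] by metis
    have "(\<lambda>n. 2 * ?d n) \<longlonglongrightarrow> 2 * 0"
      by (intro tendsto_intros LIMSEQ_Suc[OF lim_1_over_n])
    then have "(\<lambda>n. y n - x) \<longlonglongrightarrow> 0"
      by (intro Lim_null_comparison[OF always_eventually[OF allI, OF y(1)]]) simp
    then have "y \<longlonglongrightarrow> x" by (simp add: LIM_zero_iff)
    then have "(\<lambda>n. pd j (pd i h) (y n)) \<longlonglongrightarrow> pd j (pd i h) x"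
      using c isCont_tendsto_compose by blast
    moreover have "(?d n)\<^sup>2 \<noteq> 0" for n by simp
    ultimately show ?thesis by (simp add: y(2) del: of_nat_Suc)
  qed
  have "h (x + t *\<^sub>R axis j 1 + t *\<^sub>R axis i 1) - h (x + t *\<^sub>R axis j 1) - h (x + t *\<^sub>R axis i 1) + h x
      = h (x + t *\<^sub>R axis i 1 + t *\<^sub>R axis j 1) - h (x + t *\<^sub>R axis i 1) - h (x + t *\<^sub>R axis j 1) + h x" for t
    by (metis (no_types) add.assoc add.commute diff_diff_eq)
  then have "(\<lambda>n. (h (x + ?d n *\<^sub>R axis i 1 + ?d n *\<^sub>R axis j 1) - h (x + ?d n *\<^sub>R axis i 1) - h (x + ?d n *\<^sub>R axis j 1) + h x) / (?d n)\<^sup>2)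
      \<longlonglongrightarrow> pd i (pd j h) x"
    using lim[of j i] by (simp only:)
  with lim[of i j] show ?thesis by (rule LIMSEQ_unique)
qed

lemma smooth_fun_pd:
  fixes h :: "real^'n::finite \<Rightarrow> real"
  shows "smooth_fun h \<Longrightarrow> smooth_fun (pd i h)"
proof -
  \<comment> \<open>\<open>pds\<close> applies the last list element first, so the additional
    innermost derivative is appended at the end.\<close>
  have "pds js (pd i h) = pds (js @ [i]) h" for js :: "'n list" by (induction js) auto
  then show "smooth_fun h \<Longrightarrow> smooth_fun (pd i h)" by (simp add: smooth_fun_def)
qed

lemma smooth_fun_differentiable:
  fixes h :: "real^'n::finite \<Rightarrow> real"
  assumes "smooth_fun h" shows "h differentiable (at x)"
proof -
  have "pds ([] :: 'n list) h differentiable (at x)"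
    using assms unfolding smooth_fun_def by blast
  then show ?thesis by simp
qed

lemma smooth_fun_isCont: "smooth_fun h \<Longrightarrow> isCont h x"
  using smooth_fun_differentiable differentiable_imp_continuous_within by blast

lemma smooth_fun_pd_commute:
  assumes "smooth_fun h" shows "pd j (pd i h) x = pd i (pd j h) x"
  by (intro pd_commute smooth_fun_differentiable smooth_fun_isCont smooth_fun_pd assms)

lemma smooth_fun_f1: "smooth_map f \<Longrightarrow> smooth_fun (f1 f a i)"
  by (subst f1_def[abs_def]) (auto simp: smooth_map_def intro: smooth_fun_pd)

lemma smooth_fun_f2: "smooth_map f \<Longrightarrow> smooth_fun (f2 f a i j)"
  by (subst f2_def[abs_def]) (auto intro: smooth_fun_pd smooth_fun_f1)

lemma f2_commute:
  assumes "smooth_map f" shows "f2 f a i j x = f2 f a j i x"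
  using smooth_fun_pd_commute[of "\<lambda>y. f y $ a" j i x] assms
  by (simp add: f2_def f1_def[abs_def] smooth_map_def)

lemma f3_commute:
  assumes "smooth_map f"
  shows f3_commute12: "f3 f a i j k x = f3 f a j i k x"
    and f3_commute23: "f3 f a i j k x = f3 f a i k j x"
proof -
  show "f3 f a i j k x = f3 f a j i k x"
    by (simp add: f3_def f2_commute[OF assms, of a i j])
  show "f3 f a i j k x = f3 f a i k j x"
    using smooth_fun_pd_commute[OF smooth_fun_f1[OF assms], of k j a i x]
    by (simp add: f3_def f2_def[abs_def])
qed


subsection \<open>The divergence theorem on balls\<close>

lemma integral_lborel_scaleR:
  fixes h :: "'a::euclidean_space \<Rightarrow> real"
  assumes [measurable]: "h \<in> borel_measurable borel" and c: "c > 0"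
  shows "(\<integral>x. h x \<partial>lborel) = c ^ DIM('a) * (\<integral>x. h (c *\<^sub>R x) \<partial>lborel)"
proof -
  have "(\<integral>x. h x \<partial>lborel)
      = (\<integral>x. h x \<partial>density (distr lborel borel (\<lambda>x. 0 + c *\<^sub>R x)) (\<lambda>_. \<bar>c\<bar> ^ DIM('a)))"
    using lborel_affine[of c "0::'a"] c by auto
  also have "\<dots> = c ^ DIM('a) * (\<integral>x. h (c *\<^sub>R x) \<partial>lborel)"
    using c by (subst integral_density) (auto simp: integral_distr)
  finally show ?thesis .
qed

lemma integral_lborel_translate:
  fixes h :: "'a::euclidean_space \<Rightarrow> real"
  assumes [measurable]: "h \<in> borel_measurable borel"
  shows "(\<integral>x. h (x + a) \<partial>lborel) = (\<integral>x. h x \<partial>lborel)"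
proof -
  have "(\<integral>x. h x \<partial>lborel) = (\<integral>x. h x \<partial>distr lborel borel ((+) a))"
    by (simp add: lborel_distr_plus)
  also have "\<dots> = (\<integral>x. h (x + a) \<partial>lborel)"
    by (subst integral_distr) (auto simp: add.commute)
  finally show ?thesis by simp
qed

lemma integrable_lborel_translate:
  fixes h :: "'a::euclidean_space \<Rightarrow> real"
  assumes "integrable lborel h"
  shows "integrable lborel (\<lambda>x. h (x + a))"
proof -
  have "integrable (distr lborel borel ((+) a)) h"
    using assms by (simp add: lborel_distr_plus)
  then show ?thesis
    using assms by (subst (asm) integrable_distr_eq) (auto simp: add.commute)
qed

lemma integrable_lborel_bounded_support:
  fixes h :: "'a::euclidean_space \<Rightarrow> real"
  assumes "h \<in> borel_measurable borel" "\<And>x. \<bar>h x\<bar> \<le> C" "\<And>x. norm x > R \<Longrightarrow> h x = 0"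
  shows "integrable lborel h"
proof (rule Bochner_Integration.integrable_bound)
  show "integrable lborel (\<lambda>x. C * indicator (cball 0 R) x :: real)"
    by (intro integrable_mult_right integrable_real_indicator emeasure_lborel_cball_finite) auto
  have "C \<ge> 0" using assms(2)[of 0] by linarith
  then show "AE x in lborel. norm (h x) \<le> norm (C * indicator (cball 0 R) x :: real)"
    using assms(2,3) by (intro AE_I2) (auto simp: indicator_def not_le)
qed (use assms in auto)

text \<open>The integral of \<open>\<psi>\<close> is translation invariant; differentiate it along \<open>e\<close>.\<close>
lemma integral_directional_derivative_eq_0:
  fixes \<psi> :: "'a::euclidean_space \<Rightarrow> real"
  assumes \<psi>: "integrable lborel \<psi>" and D [measurable]: "D \<in> borel_measurable borel"
    and deriv: "AE x in lborel. ((\<lambda>t. \<psi> (x + t *\<^sub>R e)) has_real_derivative D x) (at 0)"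
    and w: "integrable lborel w"
    and bound: "\<And>x t. 0 < t \<Longrightarrow> t \<le> 1 \<Longrightarrow> \<bar>\<psi> (x + t *\<^sub>R e) - \<psi> x\<bar> \<le> t * w x"
  shows "integrable lborel D" "(\<integral>x. D x \<partial>lborel) = 0"
proof -
  define t where "t n = 1 / real (Suc n)" for n
  have t: "0 < t n" "t n \<le> 1" for n by (auto simp: t_def)
  have t0: "t \<longlonglongrightarrow> 0" unfolding t_def[abs_def] by (rule LIMSEQ_Suc[OF lim_1_over_n])
  have [measurable]: "\<psi> \<in> borel_measurable borel" using \<psi> by auto
  define s where "s n x = (\<psi> (x + t n *\<^sub>R e) - \<psi> x) / t n" for n x
  have lim: "AE x in lborel. (\<lambda>n. s n x) \<longlonglongrightarrow> D x"
    using deriv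
  proof eventually_elim
    case (elim x)
    then have *: "((\<lambda>h. (\<psi> (x + h *\<^sub>R e) - \<psi> x) / h) \<longlongrightarrow> D x) (at 0)"
      by (simp add: has_field_derivative_iff)
    have "filterlim t (at 0) sequentially"
      using t0 t by (auto simp: filterlim_at intro!: always_eventually) (metis less_irrefl)
    then show ?case using filterlim_compose[OF *] by (simp add: s_def)
  qed
  have bnd: "AE x in lborel. norm (s n x) \<le> w x" for n
    using bound[OF t] t(1)[of n] by (intro AE_I2) (simp add: s_def divide_le_eq mult.commute)
  have m: "s n \<in> borel_measurable lborel" for n unfolding s_def[abs_def] by measurable
  have Dm: "D \<in> borel_measurable lborel" by simp
  show "integrable lborel D" by (rule integrable_dominated_convergence[OF Dm m w lim bnd])
  have "(\<lambda>n. \<integral>x. s n x \<partial>lborel) \<longlonglongrightarrow> (\<integral>x. D x \<partial>lborel)"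
    by (rule integral_dominated_convergence[OF Dm m w lim bnd])
  moreover have "(\<integral>x. s n x \<partial>lborel) = 0" for n
    unfolding s_def
    by (simp add: \<psi> integrable_lborel_translate integral_lborel_translate)
  ultimately have "(\<lambda>n. 0) \<longlonglongrightarrow> (\<integral>x. D x \<partial>lborel)" by simp
  then show "(\<integral>x. D x \<partial>lborel) = 0" by (simp add: LIMSEQ_const_iff)
qed

section \<open>Sphere integrals as limits of means over thin shells\<close>

lemma power_difference_quotient_limit:
  "(\<lambda>k. ((r + 1 / real (Suc k)) ^ n - r ^ n) / (1 / real (Suc k))) \<longlonglongrightarrow> real n * r ^ (n - 1)"
proof -
  have "((\<lambda>s. s ^ n) has_real_derivative real n * r ^ (n - 1)) (at r)"
    by (auto intro!: derivative_eq_intros)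
  then have *: "((\<lambda>h. ((r + h) ^ n - r ^ n) / h) \<longlongrightarrow> real n * r ^ (n - 1)) (at 0)"
    by (simp add: DERIV_def)
  have "filterlim (\<lambda>k. 1 / real (Suc k)) (at 0) sequentially"
    using LIMSEQ_Suc[OF lim_1_over_n] by (auto simp: filterlim_at intro!: always_eventually)
  then show ?thesis by (rule filterlim_compose[OF *])
qed

text \<open>A dilation scales the integral of a 0-homogeneous function over a ball by the n-th power
  of the radius. The half-open shell is exactly the difference of two open balls.\<close>

lemma integral_shell_homogeneous:
  fixes w :: "real^'n::finite \<Rightarrow> real"
  assumes w [measurable]: "w \<in> borel_measurable borel" and bd: "\<And>x. \<bar>w x\<bar> \<le> C"
    and hom: "\<And>c x. c > 0 \<Longrightarrow> w (c *\<^sub>R x) = w x" and r: "0 < r" "r \<le> s"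
  shows "(\<integral>x. indicator {x. r \<le> norm x \<and> norm x < s} x * w x \<partial>lborel)
      = (s ^ CARD('n) - r ^ CARD('n)) * (\<integral>x\<in>ball 0 1. w x \<partial>lborel)"
proof -
  have ball: "(\<integral>x. indicator (ball 0 \<rho>) x * w x \<partial>lborel) = \<rho> ^ CARD('n) * (\<integral>x\<in>ball 0 1. w x \<partial>lborel)"
    if \<rho>: "\<rho> > 0" for \<rho>
  proof -
    have "indicator (ball 0 \<rho>) (\<rho> *\<^sub>R x) = (indicator (ball 0 1) x :: real)" for x :: "real^'n"
      using \<rho> by (auto simp: indicator_def)
    moreover have "(\<lambda>x. indicator (ball 0 \<rho>) x * w x) \<in> borel_measurable borel"
      by (intro borel_measurable_times borel_measurable_indicator w) auto
    ultimately show ?thesis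
      by (simp add: integral_lborel_scaleR[OF _ \<rho>] hom[OF \<rho>] set_lebesgue_integral_def)
  qed
  have int: "integrable lborel (\<lambda>x. indicator (ball 0 \<rho>) x * w x)" for \<rho>
  proof (rule integrable_lborel_bounded_support)
    have "C \<ge> 0" using bd[of 0] by linarith
    then show "\<bar>indicator (ball 0 \<rho>) x * w x\<bar> \<le> C" for x
      using bd[of x] by (auto simp: indicator_def)
    show "indicator (ball 0 \<rho>) x * w x = 0" if "norm x > \<rho>" for x
      using that by (auto simp: indicator_def)
  qed (intro borel_measurable_times borel_measurable_indicator w, auto)
  have "indicator {x. r \<le> norm x \<and> norm x < s} x * w x
      = indicator (ball 0 s) x * w x - indicator (ball 0 r) x * w x" for x
    using r by (auto simp: indicator_def)
  then have "(\<integral>x. indicator {x. r \<le> norm x \<and> norm x < s} x * w x \<partial>lborel)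
      = (\<integral>x. indicator (ball 0 s) x * w x \<partial>lborel) - (\<integral>x. indicator (ball 0 r) x * w x \<partial>lborel)"
    by (simp add: int)
  then show ?thesis using r by (simp add: ball left_diff_distrib)
qed

text \<open>Flux densities contain the unit normal \<open>x / norm x\<close>, which jumps at the
  origin; this is why continuity is asked for away from 0 only, here and in the shell
  argument.\<close>

lemma borel_measurable_continuous_off_0:
  fixes u :: "'a::euclidean_space \<Rightarrow> real"
  assumes "continuous_on (- {0}) u"
  shows "u \<in> borel_measurable borel"
proof -
  have m: "(\<lambda>x. indicator (- {0}) x *\<^sub>R u x) \<in> borel_measurable borel"
    by (rule borel_measurable_continuous_on_indicator[OF _ assms]) auto
  have "(\<lambda>x. indicator {0::'a} x * u 0) \<in> borel_measurable borel"
    by (intro borel_measurable_times borel_measurable_indicator borel_measurable_const borel_closed closed_singleton)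
  with m have "(\<lambda>x. indicator (- {0}) x *\<^sub>R u x + indicator {0} x * u 0) \<in> borel_measurable borel"
    by (rule borel_measurable_add)
  also have "(\<lambda>x. indicator (- {0}) x *\<^sub>R u x + indicator {0} x * u 0) = u"
    by (auto simp: indicator_def)
  finally show ?thesis .
qed

lemma continuous_off_0_bounded_sphere:
  fixes u :: "'a::euclidean_space \<Rightarrow> real"
  assumes u: "continuous_on (- {0}) u" and r: "r > 0"
  obtains C where "\<And>x. \<bar>u (r *\<^sub>R (x /\<^sub>R norm x))\<bar> \<le> C"
proof -
  have "compact (u ` sphere 0 r)"
    using r by (intro compact_continuous_image continuous_on_subset[OF u]) auto
  then obtain C where C: "\<And>y. norm y = r \<Longrightarrow> \<bar>u y\<bar> \<le> C"
    by (fastforce dest!: compact_imp_bounded simp: bounded_iff)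
  \<comment> \<open>Normalising \<open>x = 0\<close> gives 0, so the value \<open>u 0\<close> has to
    enter the bound.\<close>
  have "\<bar>u (r *\<^sub>R (x /\<^sub>R norm x))\<bar> \<le> max C \<bar>u 0\<bar>" for x
    using r by (cases "x = 0") (auto intro!: max.coboundedI1 C)
  then show ?thesis by (rule that)
qed

text \<open>For the radial projection \<open>w\<close> of \<open>u\<close> the shell integral is an
  explicit multiple of the cone integral, and the derivative of the n-th power at \<open>r\<close>
  supplies the factor \<open>n * r^(n-1)\<close> of \<open>sphere_int\<close>. Uniform continuity of
  \<open>u\<close> near the sphere then allows \<open>u\<close> to be replaced by
  \<open>w\<close>.\<close>

lemma shell_limit:
  fixes u :: "real^'n::finite \<Rightarrow> real"
  assumes u: "continuous_on (- {0}) u" and r: "r > 0"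
  shows "(\<lambda>k. (\<integral>x. indicator {x. r \<le> norm x \<and> norm x < r + 1 / real (Suc k)} x * u x \<partial>lborel) / (1 / real (Suc k)))
     \<longlonglongrightarrow> sphere_int r u"
proof -
  define \<delta> where "\<delta> k = 1 / real (Suc k)" for k
  have \<delta>: "\<delta> k > 0" for k by (simp add: \<delta>_def)
  have \<delta>0: "\<delta> \<longlonglongrightarrow> 0" unfolding \<delta>_def[abs_def] by (rule LIMSEQ_Suc[OF lim_1_over_n])
  define S where "S k = {x::real^'n. r \<le> norm x \<and> norm x < r + \<delta> k}" for k
  have [measurable]: "S k \<in> sets borel" for k unfolding S_def by measurable
  define w where "w x = u (r *\<^sub>R (x /\<^sub>R norm x))" for x :: "real^'n"
  have um [measurable]: "u \<in> borel_measurable borel" by (rule borel_measurable_continuous_off_0[OF u])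
  have wm [measurable]: "w \<in> borel_measurable borel" unfolding w_def by measurable
  obtain C where C: "\<And>x. \<bar>w x\<bar> \<le> C"
    using continuous_off_0_bounded_sphere[OF u r] unfolding w_def by blast
  have hom: "w (c *\<^sub>R x) = w x" if "c > 0" for c x
    using that by (cases "x = 0") (auto simp: w_def field_simps)
  define N where "N = CARD('n)"
  define q where "q k = ((r + \<delta> k) ^ N - r ^ N) / \<delta> k" for k
  have q: "q \<longlonglongrightarrow> real N * r ^ (N - 1)"
    unfolding q_def[abs_def] \<delta>_def by (rule power_difference_quotient_limit)
  have le: "r \<le> r + \<delta> k" for k using \<delta>[of k] by simp
  have shell: "(\<integral>x. indicator (S k) x * w x \<partial>lborel) / \<delta> k = q k * (\<integral>x\<in>ball 0 1. w x \<partial>lborel)" for k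
    unfolding S_def q_def N_def
    by (subst integral_shell_homogeneous[OF wm C hom r le]) simp_all
  have shell1: "(\<integral>x. indicator (S k) x * 1 \<partial>lborel) / \<delta> k = q k * (\<integral>x\<in>ball (0::real^'n) 1. 1 \<partial>lborel :: real)" for k
    unfolding S_def q_def N_def
    by (subst integral_shell_homogeneous[of "\<lambda>x::real^'n. 1" 1, OF _ _ _ r le]) simp_all
  have main: "(\<lambda>k. (\<integral>x. indicator (S k) x * w x \<partial>lborel) / \<delta> k) \<longlonglongrightarrow> sphere_int r u"
    unfolding shell using tendsto_mult_right[OF q, of "\<integral>x\<in>ball 0 1. w x \<partial>lborel"]
    by (simp add: sphere_int_def w_def[abs_def] N_def mult_ac)
  have C0: "C \<ge> 0" using C[of 0] by linarith
  have Sint: "integrable lborel (\<lambda>x. indicator (S k) x * w x)" for k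
  proof (rule integrable_lborel_bounded_support)
    show "\<bar>indicator (S k) x * w x\<bar> \<le> C" for x using C[of x] C0 by (simp add: indicator_def)
    show "indicator (S k) x * w x = 0" if "norm x > r + \<delta> k" for x
      using that by (simp add: indicator_def S_def)
  qed measurable
  have "compact (u ` (cball 0 (r + 1) - ball 0 r))"
    using r by (intro compact_continuous_image continuous_on_subset[OF u]) (auto intro: compact_diff)
  then obtain C' where C': "\<And>x. r \<le> norm x \<Longrightarrow> norm x \<le> r + 1 \<Longrightarrow> \<bar>u x\<bar> \<le> C'"
    by (auto dest!: compact_imp_bounded simp: bounded_iff) fastforce
  have \<delta>1: "\<delta> k \<le> 1" for k by (simp add: \<delta>_def)
  have uint: "integrable lborel (\<lambda>x. indicator (S k) x * u x)" for k
  proof (rule integrable_lborel_bounded_support)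
    show "\<bar>indicator (S k) x * u x\<bar> \<le> \<bar>C'\<bar>" for x
    proof (cases "x \<in> S k")
      case True
      then have "r \<le> norm x" "norm x \<le> r + 1" using \<delta>1[of k] by (auto simp: S_def)
      from C'[OF this] True show ?thesis by (simp add: indicator_def)
    qed (simp add: indicator_def)
    show "indicator (S k) x * u x = 0" if "norm x > r + \<delta> k" for x
      using that by (simp add: indicator_def S_def)
  qed measurable
  have Sint1: "integrable lborel (\<lambda>x. indicator (S k) x :: real)" for k
  proof (rule integrable_lborel_bounded_support)
    show "\<bar>indicator (S k) x :: real\<bar> \<le> 1" for x by (simp add: indicator_def)
    show "indicator (S k) x = (0::real)" if "norm x > r + \<delta> k" for x
      using that by (simp add: indicator_def S_def)
  qed measurable
  have "(\<lambda>k. (\<integral>x. indicator (S k) x * u x \<partial>lborel) / \<delta> k - (\<integral>x. indicator (S k) x * w x \<partial>lborel) / \<delta> k) \<longlonglongrightarrow> 0"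
  proof (rule LIMSEQ_I)
    fix e :: real assume e: "e > 0"
    define A where "A = (\<integral>x\<in>ball (0::real^'n) 1. 1 \<partial>lborel :: real)"
    have A: "A \<ge> 0" unfolding A_def set_lebesgue_integral_def by (rule integral_nonneg_AE) auto
    obtain B where B: "B > 0" "\<And>k. \<bar>q k\<bar> \<le> B"
      using q by (metis Bseq_def convergentI convergent_imp_Bseq real_norm_def)
    \<comment> \<open>The volume of the shell divided by its thickness is \<open>q k * A\<close>, at
      most \<open>B * A\<close>. The summand 1 keeps the denominator positive, and the factor 2
      makes the final estimate strict.\<close>
    define \<epsilon> where "\<epsilon> = e / (2 * (B * (A + 1)))"
    have \<epsilon>: "\<epsilon> > 0" using e B A by (simp add: \<epsilon>_def)
    have "uniformly_continuous_on (cball 0 (r + 1) - ball 0 r) u"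
      using r by (intro compact_uniformly_continuous continuous_on_subset[OF u]) (auto intro: compact_diff)
    then obtain d where d: "d > 0" "\<And>x y. x \<in> cball 0 (r + 1) - ball 0 r \<Longrightarrow> y \<in> cball 0 (r + 1) - ball 0 r
         \<Longrightarrow> dist y x < d \<Longrightarrow> dist (u y) (u x) < \<epsilon>"
      unfolding uniformly_continuous_on_def using \<epsilon> by metis
    obtain K where K: "\<And>k. k \<ge> K \<Longrightarrow> \<delta> k < d"
      using order_tendstoD(2)[OF \<delta>0 d(1)] by (auto simp: eventually_sequentially)
    have est: "\<bar>(\<integral>x. indicator (S k) x * u x \<partial>lborel) / \<delta> k - (\<integral>x. indicator (S k) x * w x \<partial>lborel) / \<delta> k\<bar> < e"
      if k: "k \<ge> K" for k
    proof -
      have pt: "\<bar>u x - w x\<bar> \<le> \<epsilon>" if x: "x \<in> S k" for x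
      proof -
        have nx: "r \<le> norm x" "norm x < r + \<delta> k" using x by (auto simp: S_def)
        then have "x \<noteq> 0" using r by auto
        have "dist x (r *\<^sub>R (x /\<^sub>R norm x)) = norm ((1 - r / norm x) *\<^sub>R x)"
          by (simp add: dist_norm scaleR_diff_left divide_inverse)
        also have "\<dots> = norm x - r"
          using nx \<open>x \<noteq> 0\<close> by (simp add: abs_if field_simps)
        finally have "dist x (r *\<^sub>R (x /\<^sub>R norm x)) < d" using nx K[OF k] by simp
        moreover have "norm (r *\<^sub>R (x /\<^sub>R norm x)) = r" using r \<open>x \<noteq> 0\<close> by simp
        ultimately have "dist (u x) (w x) < \<epsilon>"
          unfolding w_def using nx \<delta>1[of k] by (intro d(2)) auto
        then show ?thesis by (simp add: dist_real_def)
      qed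
      define I where "I = (\<integral>x. indicator (S k) x * u x \<partial>lborel)"
      define J where "J = (\<integral>x. indicator (S k) x * w x \<partial>lborel)"
      define L where "L = (\<integral>x. indicator (S k) x * 1 \<partial>lborel :: real)"
      have "\<bar>I - J\<bar> = \<bar>\<integral>x. indicator (S k) x * u x - indicator (S k) x * w x \<partial>lborel\<bar>"
        unfolding I_def J_def by (subst Bochner_Integration.integral_diff[OF uint Sint]) simp
      also have "\<dots> \<le> (\<integral>x. \<epsilon> * indicator (S k) x \<partial>lborel)"
      proof (rule integral_abs_bound_integral)
        show "integrable lborel (\<lambda>x. indicator (S k) x * u x - indicator (S k) x * w x)"
          by (rule Bochner_Integration.integrable_diff[OF uint Sint])
        show "integrable lborel (\<lambda>x. \<epsilon> * indicator (S k) x)"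
          by (rule integrable_mult_right[OF Sint1])
        show "\<bar>indicator (S k) x * u x - indicator (S k) x * w x\<bar> \<le> \<epsilon> * indicator (S k) x" for x
          using pt[of x] by (cases "x \<in> S k") auto
      qed
      also have "\<dots> = \<epsilon> * L" unfolding L_def mult_1_right by (rule integral_mult_right_zero)
      finally have "\<bar>I - J\<bar> / \<delta> k \<le> \<epsilon> * L / \<delta> k"
        by (rule divide_right_mono) (rule less_imp_le[OF \<delta>])
      also have "\<dots> = \<epsilon> * (q k * A)"
        using shell1[of k] by (simp only: L_def A_def times_divide_eq_right[symmetric])
      also have "\<dots> \<le> \<epsilon> * (B * A)"
        using \<epsilon> A B(2)[of k] by (intro mult_left_mono mult_right_mono) auto
      also have "\<dots> \<le> \<epsilon> * (B * (A + 1))" using \<epsilon> B(1) by simp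
      also have "\<dots> < e" using e B(1) A by (simp add: \<epsilon>_def)
      finally have "\<bar>I - J\<bar> / \<delta> k < e" .
      moreover have "\<bar>I / \<delta> k - J / \<delta> k\<bar> = \<bar>I - J\<bar> / \<delta> k"
        using \<delta>[of k] by (simp flip: diff_divide_distrib)
      ultimately show ?thesis by (simp only: I_def J_def)
    qed
    with est show "\<exists>no. \<forall>k\<ge>no. norm ((\<integral>x. indicator (S k) x * u x \<partial>lborel) / \<delta> k
        - (\<integral>x. indicator (S k) x * w x \<partial>lborel) / \<delta> k - 0) < e"
      unfolding diff_zero real_norm_def by blast
  qed
  from tendsto_add[OF this main]
  have "(\<lambda>k. (\<integral>x. indicator (S k) x * u x \<partial>lborel) / \<delta> k) \<longlonglongrightarrow> sphere_int r u"
    by (simp only: diff_add_cancel add_0)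
  then show ?thesis by (simp only: S_def \<delta>_def)
qed


section \<open>Radial cutoffs and Gauss's theorem\<close>

definition cutoff :: "real \<Rightarrow> real \<Rightarrow> 'a::real_normed_vector \<Rightarrow> real" where
  "cutoff r \<delta> x = min 1 (max 0 ((r + \<delta> - norm x) / \<delta>))"

lemma cutoff_bounds: "0 \<le> cutoff r \<delta> x" "cutoff r \<delta> x \<le> 1"
  by (auto simp: cutoff_def)

lemma cutoff_eq_0: "\<delta> > 0 \<Longrightarrow> norm x \<ge> r + \<delta> \<Longrightarrow> cutoff r \<delta> x = 0"
  by (simp add: cutoff_def divide_le_0_iff)

lemma cutoff_eq_1: "\<delta> > 0 \<Longrightarrow> norm x \<le> r \<Longrightarrow> cutoff r \<delta> x = 1"
  by (simp add: cutoff_def min_def max_def field_simps)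

lemma cutoff_between: "\<delta> > 0 \<Longrightarrow> r \<le> norm x \<Longrightarrow> norm x \<le> r + \<delta> \<Longrightarrow> cutoff r \<delta> x = (r + \<delta> - norm x) / \<delta>"
  by (simp add: cutoff_def min_def max_def field_simps)

text \<open>The constant \<open>1 / \<delta>\<close> supplies the majorant for the difference
  quotients along a coordinate axis.\<close>

lemma cutoff_lipschitz:
  assumes "\<delta> > 0"
  shows "\<bar>cutoff r \<delta> x - cutoff r \<delta> y\<bar> \<le> norm (x - y) / \<delta>"
proof -
  have 1: "\<bar>cutoff r \<delta> x - cutoff r \<delta> y\<bar> \<le> \<bar>(r + \<delta> - norm x) / \<delta> - (r + \<delta> - norm y) / \<delta>\<bar>"
  proof -
    have "\<bar>min 1 (max 0 a) - min 1 (max 0 b)\<bar> \<le> \<bar>a - b\<bar>" for a b :: real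
      by (simp add: min_def max_def)
    then show ?thesis unfolding cutoff_def .
  qed
  have "\<bar>(r + \<delta> - norm x) / \<delta> - (r + \<delta> - norm y) / \<delta>\<bar> = \<bar>norm y - norm x\<bar> / \<delta>"
    using assms by (simp flip: diff_divide_distrib)
  also have "\<dots> \<le> norm (x - y) / \<delta>"
    using assms norm_triangle_ineq3[of y x] by (intro divide_right_mono) (auto simp: norm_minus_commute)
  finally show ?thesis using 1 by linarith
qed

lemma continuous_cutoff: "continuous_on UNIV (cutoff r \<delta>)"
  unfolding cutoff_def[abs_def] divide_inverse by (intro continuous_intros)

lemma norm_directional_derivative:
  fixes x :: "real^'n::finite"
  assumes "x \<noteq> 0"
  shows "((\<lambda>t. norm (x + t *\<^sub>R axis i 1)) has_real_derivative x $ i / norm x) (at 0)"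
proof -
  have "((\<lambda>t. norm (x + t *\<^sub>R axis i 1)) has_derivative (\<lambda>t. sgn x \<bullet> (t *\<^sub>R axis i 1))) (at (0::real))"
    by (rule has_derivative_compose[where f="\<lambda>t. x + t *\<^sub>R axis i 1" and g=norm])
       (use assms GDERIV_norm[OF assms] in \<open>auto intro!: derivative_eq_intros simp: gderiv_def inner_commute\<close>)
  moreover have "(\<lambda>t. sgn x \<bullet> (t *\<^sub>R axis i 1)) = (*) (x $ i / norm x)"
    by (auto simp: fun_eq_iff sgn_div_norm inner_axis divide_inverse mult_ac)
  ultimately show ?thesis by (simp only: has_field_derivative_def)
qed

text \<open>Near a point off the origin and off both boundary spheres the cutoff is locally 1, an
  affine function of the norm, or 0. The excluded points form a null set, so the formula holds
  almost everywhere.\<close>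

lemma cutoff_mult_directional_derivative:
  fixes x :: "real^'n::finite"
  assumes h: "h differentiable (at x)" and r: "r > 0" and \<delta>: "\<delta> > 0"
    and x: "x \<noteq> 0" "norm x \<noteq> r" "norm x \<noteq> r + \<delta>"
  shows "((\<lambda>t. cutoff r \<delta> (x + t *\<^sub>R axis i 1) * h (x + t *\<^sub>R axis i 1)) has_real_derivative
     (cutoff r \<delta> x * pd i h x - indicator {x. r \<le> norm x \<and> norm x < r + \<delta>} x * (h x * (x $ i / norm x)) / \<delta>)) (at 0)"
proof -
  have ct: "continuous_on UNIV (\<lambda>t::real. norm (x + t *\<^sub>R (axis i 1 :: real^'n)))" by (intro continuous_intros)
  have hd: "((\<lambda>t. h (x + t *\<^sub>R axis i 1)) has_real_derivative pd i h x) (at 0)"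
    by (rule pd_has_real_derivative[OF h])
  consider "norm x < r" | "r < norm x" "norm x < r + \<delta>" | "norm x > r + \<delta>" using x by linarith
  then show ?thesis
  proof cases
    case 1
    have o: "open {t. norm (x + t *\<^sub>R axis i 1) < r}" by (intro open_Collect_less ct continuous_on_const)
    have "((\<lambda>t. cutoff r \<delta> (x + t *\<^sub>R axis i 1) * h (x + t *\<^sub>R axis i 1)) has_real_derivative pd i h x) (at 0)"
      by (rule has_field_derivative_transform_within_open[OF hd o]) (use 1 \<delta> in \<open>auto simp: cutoff_eq_1\<close>)
    then show ?thesis using 1 \<delta> by (simp add: cutoff_eq_1)
  next
    case 2
    have o: "open {t. r < norm (x + t *\<^sub>R axis i 1) \<and> norm (x + t *\<^sub>R axis i 1) < r + \<delta>}"
      by (intro open_Collect_conj open_Collect_less ct continuous_on_const)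
    have "((\<lambda>t. ((r + \<delta> - norm (x + t *\<^sub>R axis i 1)) / \<delta>) * h (x + t *\<^sub>R axis i 1)) has_real_derivative
       (((0 - x $ i / norm x) / \<delta>) * h (x + 0 *\<^sub>R axis i 1) + pd i h x * ((r + \<delta> - norm (x + 0 *\<^sub>R axis i 1)) / \<delta>))) (at 0)"
      by (intro DERIV_mult DERIV_cdivide DERIV_diff DERIV_const norm_directional_derivative x hd)
    then have "((\<lambda>t. cutoff r \<delta> (x + t *\<^sub>R axis i 1) * h (x + t *\<^sub>R axis i 1)) has_real_derivative
       (((0 - x $ i / norm x) / \<delta>) * h (x + 0 *\<^sub>R axis i 1) + pd i h x * ((r + \<delta> - norm (x + 0 *\<^sub>R axis i 1)) / \<delta>))) (at 0)"
      by (rule has_field_derivative_transform_within_open[OF _ o]) (use 2 \<delta> in \<open>auto simp: cutoff_between\<close>)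
    then show ?thesis
      by (rule back_subst[where P="\<lambda>d. (_ has_field_derivative d) (at 0)"])
         (use 2 \<delta> in \<open>simp add: cutoff_between field_simps\<close>)
  next
    case 3
    have o: "open {t. r + \<delta> < norm (x + t *\<^sub>R axis i 1)}" by (intro open_Collect_less ct continuous_on_const)
    have "((\<lambda>t. cutoff r \<delta> (x + t *\<^sub>R axis i 1) * h (x + t *\<^sub>R axis i 1)) has_real_derivative 0) (at 0)"
      by (rule has_field_derivative_transform_within_open[OF DERIV_const[of 0] o]) (use 3 \<delta> in \<open>auto simp: cutoff_eq_0\<close>)
    then show ?thesis using 3 \<delta> by (simp add: cutoff_eq_0)
  qed
qed

lemma AE_norm_neq: "AE x in lborel. norm (x::'a::euclidean_space) \<noteq> r"
proof -
  from negligible_sphere[of "0::'a" r] have "sphere (0::'a) r \<in> null_sets lborel"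
    by (auto simp: null_sets_completion_iff negligible_iff_null_sets negligible_convex_frontier)
  then show ?thesis by (rule AE_I') auto
qed

lemma continuous_bounded_on_cball:
  fixes h :: "'a::euclidean_space \<Rightarrow> real"
  assumes "continuous_on UNIV h"
  obtains C where "C \<ge> 0" "\<And>x. norm x \<le> R \<Longrightarrow> \<bar>h x\<bar> \<le> C"
proof -
  have "compact (h ` cball 0 R)"
    by (intro compact_continuous_image continuous_on_subset[OF assms]) auto
  then obtain C where "\<And>x. norm x \<le> R \<Longrightarrow> \<bar>h x\<bar> \<le> C"
    by (fastforce dest!: compact_imp_bounded simp: bounded_iff)
  then have "\<bar>C\<bar> \<ge> 0" "\<And>x. norm x \<le> R \<Longrightarrow> \<bar>h x\<bar> \<le> \<bar>C\<bar>" by force+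
  then show ?thesis by (rule that)
qed

lemma integral_cutoff_mult_derivative:
  fixes h :: "real^'n::finite \<Rightarrow> real"
  assumes h: "\<And>x. h differentiable (at x)" and hc: "continuous_on UNIV (pd i h)"
    and r: "r > 0" and \<delta>: "\<delta> > 0" "\<delta> \<le> 1"
  defines "D \<equiv> \<lambda>x. cutoff r \<delta> x * pd i h x - indicator {x. r \<le> norm x \<and> norm x < r + \<delta>} x * (h x * (x $ i / norm x)) / \<delta>"
  shows "integrable lborel D" "(\<integral>x. D x \<partial>lborel) = 0"
proof -
  have hcont: "continuous_on UNIV h"
    using h by (simp add: continuous_on_eq_continuous_at differentiable_imp_continuous_within)
  have [measurable]: "h \<in> borel_measurable borel" "pd i h \<in> borel_measurable borel"
      "(cutoff r \<delta> :: real^'n \<Rightarrow> real) \<in> borel_measurable borel"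
    by (intro borel_measurable_continuous_onI hcont hc continuous_cutoff)+
  \<comment> \<open>The product \<open>\<psi>\<close> vanishes beyond radius \<open>r + 1\<close>. A
    shift by at most 1 can thus change it only at points of radius at most \<open>r + 2\<close>, and
    the segments starting there stay within radius \<open>r + 3\<close>.\<close>
  obtain C where C: "C \<ge> 0" "\<And>x. norm x \<le> r + 3 \<Longrightarrow> \<bar>h x\<bar> \<le> C"
    using continuous_bounded_on_cball[OF hcont] by blast
  obtain C' where C': "C' \<ge> 0" "\<And>x. norm x \<le> r + 3 \<Longrightarrow> \<bar>pd i h x\<bar> \<le> C'"
    using continuous_bounded_on_cball[OF hc] by blast
  define \<psi> where "\<psi> = (\<lambda>x. cutoff r \<delta> x * h x)"
  \<comment> \<open>\<open>C / \<delta>\<close> bounds the variation of the cutoff times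
    \<open>h\<close>, and \<open>C'\<close> bounds the variation of \<open>h\<close> by the mean
    value theorem.\<close>
  define w where "w x = (C / \<delta> + C') * indicator (cball 0 (r + 2)) x" for x :: "real^'n"
  have \<psi>0: "\<psi> x = 0" if "norm x > r + 1" for x using that \<delta> by (simp add: \<psi>_def cutoff_eq_0)
  have \<psi>: "integrable lborel \<psi>"
  proof (rule integrable_lborel_bounded_support[OF _ _ \<psi>0])
    show "\<psi> \<in> borel_measurable borel" unfolding \<psi>_def by measurable
    show "\<bar>\<psi> x\<bar> \<le> C" for x
    proof (cases "norm x \<le> r + 3")
      case True
      have "\<bar>\<psi> x\<bar> = cutoff r \<delta> x * \<bar>h x\<bar>" by (simp add: \<psi>_def abs_mult cutoff_bounds)
      also have "\<dots> \<le> 1 * C" using C True by (intro mult_mono cutoff_bounds) auto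
      finally show ?thesis by simp
    qed (use \<psi>0[of x] C(1) in simp)
  qed
  have Dm: "D \<in> borel_measurable borel" unfolding D_def by measurable
  have deriv: "AE x in lborel. ((\<lambda>t. \<psi> (x + t *\<^sub>R axis i 1)) has_real_derivative D x) (at 0)"
    using AE_norm_neq[of 0] AE_norm_neq[of r] AE_norm_neq[of "r + \<delta>"]
  proof eventually_elim
    case (elim x)
    then show ?case unfolding \<psi>_def D_def
      by (intro cutoff_mult_directional_derivative h r \<delta>) auto
  qed
  have w: "integrable lborel w" unfolding w_def
    by (intro integrable_mult_right integrable_real_indicator emeasure_lborel_cball_finite) auto
  have bound: "\<bar>\<psi> (x + t *\<^sub>R axis i 1) - \<psi> x\<bar> \<le> t * w x" if t: "0 < t" "t \<le> 1" for x t
  proof (cases "norm x \<le> r + 2")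
    case True
    let ?y = "x + t *\<^sub>R axis i 1"
    have ny: "norm (x + s *\<^sub>R axis i 1) \<le> r + 3" if "0 \<le> s" "s \<le> 1" for s
      using norm_triangle_ineq[of x "s *\<^sub>R axis i 1"] that True by simp
    have "\<exists>s. 0 < s \<and> s < t \<and> h (x + t *\<^sub>R axis i 1) - h (x + 0 *\<^sub>R axis i 1) = (t - 0) * pd i h (x + s *\<^sub>R axis i 1)"
      by (rule MVT2) (use t in \<open>auto intro!: pd_has_real_derivative' h\<close>)
    then obtain s where s: "0 < s" "s < t" "h ?y - h x = t * pd i h (x + s *\<^sub>R axis i 1)" by auto
    have "\<bar>h ?y - h x\<bar> \<le> t * C'"
      unfolding s(3) using s t C'(2)[OF ny[of s]] by (simp add: abs_mult)
    then have a: "cutoff r \<delta> x * \<bar>h ?y - h x\<bar> \<le> 1 * (t * C')"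
      using C'(1) t by (intro mult_mono cutoff_bounds) auto
    have "\<bar>cutoff r \<delta> ?y - cutoff r \<delta> x\<bar> \<le> t / \<delta>"
      using cutoff_lipschitz[OF \<delta>(1), of r ?y x] t by simp
    then have b: "\<bar>cutoff r \<delta> ?y - cutoff r \<delta> x\<bar> * \<bar>h ?y\<bar> \<le> t / \<delta> * C"
      using C(2)[OF ny[of t]] t \<delta> by (intro mult_mono) auto
    have "\<psi> ?y - \<psi> x = (cutoff r \<delta> ?y - cutoff r \<delta> x) * h ?y + cutoff r \<delta> x * (h ?y - h x)"
      by (simp add: \<psi>_def algebra_simps)
    then have "\<bar>\<psi> ?y - \<psi> x\<bar> \<le> \<bar>cutoff r \<delta> ?y - cutoff r \<delta> x\<bar> * \<bar>h ?y\<bar> + cutoff r \<delta> x * \<bar>h ?y - h x\<bar>"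
      using abs_triangle_ineq[of "(cutoff r \<delta> ?y - cutoff r \<delta> x) * h ?y" "cutoff r \<delta> x * (h ?y - h x)"]
      by (simp add: abs_mult cutoff_bounds)
    also have "\<dots> \<le> t / \<delta> * C + 1 * (t * C')" by (rule add_mono[OF b a])
    also have "\<dots> = t * w x" using True by (simp add: w_def algebra_simps)
    finally show ?thesis .
  next
    case False
    have "norm x \<le> norm (x + t *\<^sub>R axis i 1) + norm (t *\<^sub>R (axis i 1 :: real^'n))"
      using norm_triangle_ineq4[of "x + t *\<^sub>R axis i 1" "t *\<^sub>R axis i 1"] by simp
    then have "norm (x + t *\<^sub>R axis i 1) > r + 1" using False t by simp
    then show ?thesis using False \<psi>0 by (simp add: w_def)
  qed
  show "integrable lborel D" "(\<integral>x. D x \<partial>lborel) = 0"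
    using integral_directional_derivative_eq_0[OF \<psi> Dm deriv w bound] by auto
qed

text \<open>The derivatives of cutoff times \<open>V i\<close> integrate to 0, so the sequence
  \<open>I\<close> has two readings: as the integral of the divergence weighted by the cutoff, and
  as the mean over a shell of the normal component of \<open>V\<close>. Letting the thickness tend
  to 0 in both readings gives the two sides.\<close>

theorem divergence_theorem_ball:
  fixes V :: "'n::finite \<Rightarrow> real^'n \<Rightarrow> real"
  assumes V: "\<And>i x. V i differentiable (at x)" and Vc: "\<And>i. continuous_on UNIV (pd i (V i))" and r: "r > 0"
  shows "sphere_int r (\<lambda>x. \<Sigma> i. V i x * (x $ i / norm x))
       = (\<integral>x. indicator (cball 0 r) x * (\<Sigma> i. pd i (V i) x) \<partial>lborel)"
proof -
  define \<delta> where "\<delta> k = 1 / real (Suc k)" for k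
  have \<delta>: "\<delta> k > 0" "\<delta> k \<le> 1" for k by (auto simp: \<delta>_def)
  have \<delta>0: "\<delta> \<longlonglongrightarrow> 0" unfolding \<delta>_def[abs_def] by (rule LIMSEQ_Suc[OF lim_1_over_n])
  define u where "u = (\<lambda>x. \<Sigma> i. V i x * (x $ i / norm x))"
  define d where "d = (\<lambda>x. \<Sigma> i. pd i (V i) x)"
  define S where "S k = {x::real^'n. r \<le> norm x \<and> norm x < r + \<delta> k}" for k
  have Vcont: "continuous_on UNIV (V i)" for i
    using V by (simp add: continuous_on_eq_continuous_at differentiable_imp_continuous_within)
  have uc: "continuous_on (- {0}) u" unfolding u_def
    by (intro continuous_intros continuous_on_subset[OF Vcont]) auto
  have dc: "continuous_on UNIV d" unfolding d_def by (intro continuous_intros Vc)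
  have [measurable]: "S k \<in> sets borel" for k unfolding S_def by measurable
  have meas [measurable]: "d \<in> borel_measurable borel" "(cutoff r s :: real^'n \<Rightarrow> real) \<in> borel_measurable borel" for s
    by (intro borel_measurable_continuous_onI dc continuous_cutoff)+
  have [measurable]: "u \<in> borel_measurable borel" by (rule borel_measurable_continuous_off_0[OF uc])
  define I where "I k = (\<integral>x. cutoff r (\<delta> k) x * d x \<partial>lborel)" for k
  obtain C where C: "C \<ge> 0" "\<And>x. norm x \<le> r + 1 \<Longrightarrow> \<bar>d x\<bar> \<le> C"
    using continuous_bounded_on_cball[OF dc] by blast
  define w where "w x = C * indicator (cball 0 (r + 1)) x" for x :: "real^'n"
  have w: "integrable lborel w" unfolding w_def
    by (intro integrable_mult_right integrable_real_indicator emeasure_lborel_cball_finite) auto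
  have wb: "\<bar>cutoff r (\<delta> k) x * d x\<bar> \<le> w x" for k x
  proof (cases "norm x \<le> r + 1")
    case True
    have "\<bar>cutoff r (\<delta> k) x * d x\<bar> = cutoff r (\<delta> k) x * \<bar>d x\<bar>" by (simp add: abs_mult cutoff_bounds)
    also have "\<dots> \<le> 1 * C" using C True by (intro mult_mono cutoff_bounds) auto
    finally show ?thesis using True by (simp add: w_def)
  qed (use \<delta>(2)[of k] cutoff_eq_0[OF \<delta>(1)[of k], of r x] in \<open>simp add: w_def\<close>)
  have int: "integrable lborel (\<lambda>x. cutoff r (\<delta> k) x * d x)" for k
    by (rule Bochner_Integration.integrable_bound[OF w]) (use wb in \<open>auto intro!: AE_I2 order_trans[OF _ abs_ge_self]\<close>)
  have eq: "I k = (\<integral>x. indicator (S k) x * u x \<partial>lborel) / \<delta> k" for k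
  proof -
    let ?D = "\<lambda>i x. cutoff r (\<delta> k) x * pd i (V i) x - indicator (S k) x * (V i x * (x $ i / norm x)) / \<delta> k"
    have D: "integrable lborel (?D i)" "(\<integral>x. ?D i x \<partial>lborel) = 0" for i
      using integral_cutoff_mult_derivative[where h="V i" and i=i, OF V Vc r \<delta>[of k]] unfolding S_def by auto
    have D_sum: "(\<Sigma> i. ?D i x) = cutoff r (\<delta> k) x * d x - indicator (S k) x * u x / \<delta> k" for x
      by (simp add: u_def d_def sum_subtractf sum_distrib_left sum_divide_distrib)
    have "integrable lborel (\<lambda>x. \<Sigma> i. ?D i x)" by (intro Bochner_Integration.integrable_sum D)
    then have iD: "integrable lborel (\<lambda>x. cutoff r (\<delta> k) x * d x - indicator (S k) x * u x / \<delta> k)"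
      unfolding D_sum .
    have "integrable lborel (\<lambda>x. cutoff r (\<delta> k) x * d x - (cutoff r (\<delta> k) x * d x - indicator (S k) x * u x / \<delta> k))"
      by (rule Bochner_Integration.integrable_diff[OF int iD])
    then have iu: "integrable lborel (\<lambda>x. indicator (S k) x * u x / \<delta> k)" by simp
    have "0 = (\<integral>x. (\<Sigma> i. ?D i x) \<partial>lborel)"
      by (subst Bochner_Integration.integral_sum) (simp_all only: D sum.neutral_const)
    also have "\<dots> = I k - (\<integral>x. indicator (S k) x * u x / \<delta> k \<partial>lborel)"
      unfolding D_sum I_def by (rule Bochner_Integration.integral_diff[OF int iu])
    finally show ?thesis by (simp only: integral_divide_zero)
  qed
  have lim1: "I \<longlonglongrightarrow> sphere_int r u"
    unfolding eq[abs_def] S_def \<delta>_def by (rule shell_limit[OF uc r])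
  have lim2: "I \<longlonglongrightarrow> (\<integral>x. indicator (cball 0 r) x * d x \<partial>lborel)"
    unfolding I_def[abs_def]
  proof (rule integral_dominated_convergence[OF _ _ w])
    show "AE x in lborel. norm (cutoff r (\<delta> k) x * d x) \<le> w x" for k using wb by simp
    show "AE x in lborel. (\<lambda>k. cutoff r (\<delta> k) x * d x) \<longlonglongrightarrow> indicator (cball 0 r) x * d x"
    proof (intro AE_I2 tendsto_mult tendsto_const)
      fix x :: "real^'n"
      show "(\<lambda>k. cutoff r (\<delta> k) x) \<longlonglongrightarrow> indicator (cball 0 r) x"
      proof (cases "norm x \<le> r")
        case True
        then show ?thesis by (simp add: cutoff_eq_1 \<delta>)
      next
        case False
        then have "\<forall>\<^sub>F k in sequentially. \<delta> k < norm x - r"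
          by (intro order_tendstoD(2)[OF \<delta>0]) simp
        then have "\<forall>\<^sub>F k in sequentially. cutoff r (\<delta> k) x = indicator (cball 0 r) x"
          by eventually_elim (use False \<delta> in \<open>simp add: cutoff_eq_0\<close>)
        then show ?thesis by (rule tendsto_eventually)
      qed
    qed
  qed (auto intro!: borel_measurable_times borel_measurable_indicator meas)
  show ?thesis using LIMSEQ_unique[OF lim1 lim2] by (simp only: u_def d_def)
qed

section \<open>Integrability from power decay, and exhaustion by balls\<close>

lemma integrable_lborel_power_decay:
  fixes u :: "'a::euclidean_space \<Rightarrow> real"
  assumes u: "continuous_on UNIV u" and p: "p > real DIM('a)"
    and bound: "\<And>x. norm x \<ge> R \<Longrightarrow> \<bar>u x\<bar> \<le> C * norm x powr (- p)"
  shows "integrable lborel u"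
proof -
  define R1 where "R1 = max R 1"
  have R1: "R1 \<ge> R" "R1 \<ge> 1" by (auto simp: R1_def)
  have [measurable]: "u \<in> borel_measurable borel" by (rule borel_measurable_continuous_onI[OF u])
  obtain C0 where C0: "C0 \<ge> 0" "\<And>x. norm x \<le> R1 \<Longrightarrow> \<bar>u x\<bar> \<le> C0"
    using continuous_bounded_on_cball[OF u] by blast
  define n where "n = DIM('a)"
  \<comment> \<open>\<open>a k\<close> is the majorant at radius \<open>R1 * 2^k\<close>, hence a
    bound on the k-th dyadic annulus. Enlarging the annulus to a ball costs only a constant factor,
    and since ball volumes grow like \<open>2^(k n)\<close> the resulting series is geometric with
    ratio \<open>2^(n - p) < 1\<close>.\<close>
  define a where "a k = \<bar>C\<bar> * R1 powr (- p) * (2 powr (- p)) ^ k" for k :: nat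
  have a0: "a k \<ge> 0" for k by (simp add: a_def)
  have pt: "ennreal \<bar>u x\<bar> \<le> ennreal C0 * indicator (ball 0 (2 * R1)) x
      + (\<Sum>k. ennreal (a k) * indicator (ball 0 (R1 * 2 ^ Suc k)) x)" for x
  proof (cases "norm x < R1")
    case True
    then have "ennreal \<bar>u x\<bar> \<le> ennreal C0 * indicator (ball 0 (2 * R1)) x"
      using C0 R1 by (simp add: ennreal_leI)
    then show ?thesis by (rule order_trans) simp
  next
    case False
    obtain m :: nat where m: "norm x < R1 * 2 ^ m"
      using real_arch_pow[of 2 "norm x / R1"] R1 by (auto simp: field_simps)
    define k where "k = (LEAST m. norm x < R1 * 2 ^ m)"
    have k: "norm x < R1 * 2 ^ k" unfolding k_def using LeastI[of "\<lambda>m. norm x < R1 * 2 ^ m", OF m] by simp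
    have "k \<noteq> 0" using k False by (cases k) auto
    then obtain j where j: "k = Suc j" by (cases k) auto
    have "\<not> norm x < R1 * 2 ^ j" using not_less_Least[of j "\<lambda>m. norm x < R1 * 2 ^ m"] j by (simp add: k_def)
    then have xj: "R1 * 2 ^ j \<le> norm x" by simp
    have p0: "p > 0" using p by (meson less_le_trans of_nat_0_le_iff order_le_less_trans)
    have "\<bar>u x\<bar> \<le> C * norm x powr (- p)" using bound False R1 by simp
    also have "\<dots> \<le> \<bar>C\<bar> * norm x powr (- p)" by (intro mult_right_mono) auto
    also have "\<dots> \<le> \<bar>C\<bar> * (R1 * 2 ^ j) powr (- p)"
      using R1 p0 xj by (intro mult_left_mono powr_mono2') auto
    also have "\<dots> = a j"
      using R1 by (simp add: a_def powr_mult powr_powr powr_realpow[symmetric] mult.commute)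
    finally have "ennreal \<bar>u x\<bar> \<le> ennreal (a j) * indicator (ball 0 (R1 * 2 ^ Suc j)) x"
      using k j by (simp add: ennreal_leI)
    also have "\<dots> = (\<Sum>k\<in>{j}. ennreal (a k) * indicator (ball 0 (R1 * 2 ^ Suc k)) x)"
      by (simp only: sum.insert finite.emptyI empty_iff not_False_eq_True sum.empty add_0_right)
    also have "\<dots> \<le> (\<Sum>k. ennreal (a k) * indicator (ball 0 (R1 * 2 ^ Suc k)) x)"
      by (rule sum_le_suminf) auto
    finally show ?thesis by (rule order_trans) simp
  qed
  have geo: "summable (\<lambda>k. a k * (unit_ball_vol (real n) * (R1 * 2 ^ Suc k) ^ n))"
  proof -
    have "2 powr (- p) * 2 ^ n < (1::real)"
    proof -
      have "2 powr (- p) * 2 ^ n = (2::real) powr (real n - p)" by (simp add: powr_realpow[symmetric] powr_add[symmetric])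
      also have "\<dots> < 2 powr 0" using p by (intro powr_less_mono) (auto simp: n_def)
      finally show ?thesis by simp
    qed
    then have "summable (\<lambda>k. (2 powr (- p) * 2 ^ n) ^ k :: real)" by (intro summable_geometric) simp
    then have "summable (\<lambda>k. (\<bar>C\<bar> * R1 powr (- p) * unit_ball_vol (real n) * (R1 * 2) ^ n) * (2 powr (- p) * 2 ^ n) ^ k)"
      by (rule summable_mult)
    then show ?thesis
      by (simp add: a_def power_mult_distrib mult_ac flip: power_mult)
  qed
  have "(\<integral>\<^sup>+x. ennreal \<bar>u x\<bar> \<partial>lborel) \<le> (\<integral>\<^sup>+x. ennreal C0 * indicator (ball 0 (2 * R1)) x
      + (\<Sum>k. ennreal (a k) * indicator (ball 0 (R1 * 2 ^ Suc k)) x) \<partial>(lborel :: 'a measure))"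
    by (intro nn_integral_mono pt)
  also have "\<dots> = ennreal C0 * emeasure lborel (ball (0::'a) (2 * R1))
      + (\<Sum>k. ennreal (a k) * emeasure lborel (ball (0::'a) (R1 * 2 ^ Suc k)))"
  proof (subst nn_integral_add)
    have ind: "(\<lambda>x. ennreal c * indicator (ball 0 s) x) \<in> borel_measurable (lborel :: 'a measure)" for c s
      by (intro borel_measurable_times_ennreal borel_measurable_indicator borel_measurable_const) auto
    then show "(\<lambda>x. ennreal C0 * indicator (ball 0 (2 * R1)) x) \<in> borel_measurable (lborel :: 'a measure)"
      "(\<lambda>x. \<Sum>k. ennreal (a k) * indicator (ball 0 (R1 * 2 ^ Suc k)) x) \<in> borel_measurable (lborel :: 'a measure)"
      by (auto intro!: borel_measurable_suminf_order simp del: measurable_lborel1)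
    show "(\<integral>\<^sup>+x. ennreal C0 * indicator (ball 0 (2 * R1)) x \<partial>(lborel :: 'a measure))
        + (\<integral>\<^sup>+x. (\<Sum>k. ennreal (a k) * indicator (ball 0 (R1 * 2 ^ Suc k)) x) \<partial>(lborel :: 'a measure))
      = ennreal C0 * emeasure lborel (ball (0::'a) (2 * R1))
        + (\<Sum>k. ennreal (a k) * emeasure lborel (ball (0::'a) (R1 * 2 ^ Suc k)))"
      by (subst nn_integral_suminf[OF ind]) (simp add: nn_integral_cmult_indicator)
  qed
  also have "(\<Sum>k. ennreal (a k) * emeasure lborel (ball (0::'a) (R1 * 2 ^ Suc k)))
      = (\<Sum>k. ennreal (a k * (unit_ball_vol (real n) * (R1 * 2 ^ Suc k) ^ n)))"
    using R1 a0 by (intro suminf_cong) (simp add: emeasure_ball n_def ennreal_mult)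
  also have "\<dots> = ennreal (\<Sum>k. a k * (unit_ball_vol (real n) * (R1 * 2 ^ Suc k) ^ n))"
    using geo a0 R1 by (intro suminf_ennreal2) auto
  also have "ennreal C0 * emeasure lborel (ball (0::'a) (2 * R1)) + \<dots> < \<infinity>"
    using emeasure_lborel_ball_finite[of "0::'a" "2 * R1"] by (simp add: ennreal_mult_less_top)
  finally show ?thesis by (intro integrableI_bounded) simp_all
qed

lemma integral_cball_tendsto:
  fixes u :: "'a::euclidean_space \<Rightarrow> real"
  assumes u: "integrable lborel u"
  shows "((\<lambda>r. \<integral>x. indicator (cball 0 r) x * u x \<partial>lborel) \<longlongrightarrow> (\<integral>x. u x \<partial>lborel)) at_top"
proof (rule integral_dominated_convergence_at_top)
  have [measurable]: "u \<in> borel_measurable borel" using u by auto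
  show "u \<in> borel_measurable lborel" using u by auto
  show "(\<lambda>x. indicator (cball 0 r) x * u x) \<in> borel_measurable lborel" for r
    by (intro borel_measurable_times borel_measurable_indicator) auto
  show "integrable lborel (\<lambda>x. \<bar>u x\<bar>)" using u by auto
  show "\<forall>\<^sub>F r in at_top. AE x in lborel. norm (indicator (cball 0 r) x * u x) \<le> \<bar>u x\<bar>"
    by (intro always_eventually allI AE_I2) (simp add: indicator_def)
  show "AE x in lborel. ((\<lambda>r. indicator (cball 0 r) x * u x) \<longlongrightarrow> u x) at_top"
  proof (intro AE_I2 tendsto_eventually)
    show "\<forall>\<^sub>F r in at_top. indicator (cball 0 r) x * u x = u x" for x
      using eventually_ge_at_top[of "norm x"] by eventually_elim (simp add: indicator_def)
  qed
qed

lemma sphere_int_bound: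
  fixes u :: "real^'n::finite \<Rightarrow> real"
  assumes r: "r > 0" and u: "\<And>x. norm x = r \<Longrightarrow> \<bar>u x\<bar> \<le> B"
  shows "\<bar>sphere_int r u\<bar> \<le> r ^ (CARD('n) - 1) * real CARD('n) * (B * measure lborel (ball (0::real^'n) 1))"
proof -
  have B: "B \<ge> 0" using u[of "r *\<^sub>R axis undefined 1"] r by (auto intro: order_trans[OF abs_ge_zero])
  have "\<bar>\<integral>x\<in>ball 0 1. u (r *\<^sub>R (x /\<^sub>R norm x)) \<partial>lborel\<bar> \<le> B * measure lborel (ball (0::real^'n) 1)"
  \<comment> \<open>A non-integrable function has Bochner integral 0, so the bound holds in that
    case as well and no regularity of \<open>u\<close> enters.\<close>
  proof (cases "integrable lborel (\<lambda>x. indicator (ball 0 1) x *\<^sub>R u (r *\<^sub>R (x /\<^sub>R norm x)))")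
    case True
    have "AE x in lborel. \<bar>indicator (ball 0 1) x *\<^sub>R u (r *\<^sub>R (x /\<^sub>R norm x))\<bar> \<le> B * indicator (ball (0::real^'n) 1) x"
      using AE_norm_neq[of 0]
    proof eventually_elim
      case (elim x)
      then have "norm (r *\<^sub>R (x /\<^sub>R norm x)) = r" using r by simp
      from u[OF this] show ?case by (simp add: indicator_def)
    qed
    moreover have "integrable lborel (\<lambda>x. B * indicator (ball (0::real^'n) 1) x)"
      by (intro integrable_mult_right integrable_real_indicator emeasure_lborel_ball_finite) auto
    ultimately have "\<bar>\<integral>x\<in>ball 0 1. u (r *\<^sub>R (x /\<^sub>R norm x)) \<partial>lborel\<bar> \<le> (\<integral>x. B * indicator (ball (0::real^'n) 1) x \<partial>lborel)"
      unfolding set_lebesgue_integral_def using True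
      by (intro order_trans[OF integral_abs_bound] integral_mono_AE) auto
    also have "\<dots> = B * measure lborel (ball (0::real^'n) 1)" by simp
    finally show ?thesis .
  qed (use B in \<open>simp add: set_lebesgue_integral_def not_integrable_integral_eq\<close>)
  then show ?thesis unfolding sphere_int_def using r
    by (simp add: abs_mult mult_left_mono)
qed


subsection \<open>Continuously differentiable functions and the induced metric\<close>

text \<open>One continuous derivative is what the divergence theorem asks of \<open>V\<close>. This
  class is easily closed under sums and products, and the inverse metric belongs to it because
  \<open>pd_gi\<close> expresses its derivative through continuous functions.\<close>

definition C1_fun :: "(real^'n::finite \<Rightarrow> real) \<Rightarrow> bool" where
  "C1_fun h \<longleftrightarrow> (\<forall>x. h differentiable (at x)) \<and> (\<forall>i. continuous_on UNIV (pd i h))"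

named_theorems C1_intros

lemma C1_funD:
  assumes "C1_fun h"
  shows C1_fun_differentiable: "h differentiable (at x)"
    and C1_fun_continuous_pd: "continuous_on UNIV (pd i h)"
    and C1_fun_continuous: "continuous_on UNIV h"
  using assms by (auto simp: C1_fun_def continuous_on_eq_continuous_at differentiable_imp_continuous_within)

lemma C1_const [C1_intros]: "C1_fun (\<lambda>x. c)"
proof -
  have "pd i (\<lambda>x. c) = (\<lambda>x. 0)" for i by (simp add: fun_eq_iff)
  then show ?thesis by (simp add: C1_fun_def)
qed

lemma C1_add [C1_intros]:
  assumes "C1_fun h" "C1_fun k" shows "C1_fun (\<lambda>x. h x + k x)"
proof -
  have "pd i (\<lambda>x. h x + k x) = (\<lambda>x. pd i h x + pd i k x)" for i
    using assms by (simp add: fun_eq_iff pd_add C1_fun_def)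
  then show ?thesis using assms by (auto simp: C1_fun_def intro!: continuous_intros)
qed

lemma C1_mult [C1_intros]:
  assumes "C1_fun h" "C1_fun k" shows "C1_fun (\<lambda>x. h x * k x)"
proof -
  have "pd i (\<lambda>x. h x * k x) = (\<lambda>x. pd i h x * k x + h x * pd i k x)" for i
    using assms by (simp add: fun_eq_iff pd_mult C1_fun_def)
  then show ?thesis using C1_fun_continuous[OF assms(1)] C1_fun_continuous[OF assms(2)] assms
    by (auto simp: C1_fun_def intro!: continuous_intros)
qed

lemma C1_minus [C1_intros]: "C1_fun h \<Longrightarrow> C1_fun (\<lambda>x. - h x)"
  using C1_mult[OF C1_const[of "-1"], of h] by simp

lemma C1_diff [C1_intros]: "C1_fun h \<Longrightarrow> C1_fun k \<Longrightarrow> C1_fun (\<lambda>x. h x - k x)"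
  using C1_add[OF _ C1_minus, of h k] by simp

lemma C1_sum [C1_intros]: "(\<And>a. a \<in> A \<Longrightarrow> C1_fun (h a)) \<Longrightarrow> C1_fun (\<lambda>x. \<Sum>a\<in>A. h a x)"
  by (induction A rule: infinite_finite_induct) (auto intro: C1_const C1_add)

lemma smooth_fun_C1:
  fixes h :: "real^'n::finite \<Rightarrow> real"
  assumes "smooth_fun h" shows "C1_fun h"
  using assms by (simp add: C1_fun_def smooth_fun_differentiable smooth_fun_isCont smooth_fun_pd continuous_on_eq_continuous_at)

lemma C1_f1 [C1_intros]: "smooth_map f \<Longrightarrow> C1_fun (\<lambda>x. f1 f a i x)"
  and C1_f2 [C1_intros]: "smooth_map f \<Longrightarrow> C1_fun (\<lambda>x. f2 f a i j x)"
  by (auto intro!: smooth_fun_C1 smooth_fun_f1 smooth_fun_f2)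

section \<open>Matrix algebra of the induced metric and of the Gram matrix of the normal
  frame\<close>

lemma matrix_diff_ldistrib:
  fixes A :: "real^'b::finite^'a::finite"
  shows "A ** (B - C) = A ** B - A ** C"
  by (simp add: vec_eq_iff matrix_matrix_mult_def right_diff_distrib sum_subtractf)

lemma matrix_diff_rdistrib:
  fixes A :: "real^'b::finite^'a::finite"
  shows "(A - B) ** C = A ** C - B ** C"
  by (simp add: vec_eq_iff matrix_matrix_mult_def left_diff_distrib sum_subtractf)

lemma matrix_add_rdistrib':
  fixes A :: "real^'b::finite^'a::finite"
  shows "(A + B) ** C = A ** C + B ** C"
  by (simp add: vec_eq_iff matrix_matrix_mult_def distrib_right sum.distrib)

lemma matrix_minus_mult:
  fixes A :: "real^'b::finite^'a::finite"
  shows "(- A) ** C = - (A ** C)"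
  by (simp add: vec_eq_iff matrix_matrix_mult_def sum_negf)

definition Df :: "(real^'n::finite \<Rightarrow> real^'m::finite) \<Rightarrow> real^'n \<Rightarrow> real^'n^'m" where
  "Df f x = (\<chi> a i. f1 f a i x)"

lemma gm_eq: "gm f x = mat 1 + transpose (Df f x) ** Df f x"
  by (simp add: vec_eq_iff gm_def mat_def matrix_matrix_mult_def transpose_def Df_def)

lemma Umat_eq: "Umat f x = mat 1 + Df f x ** transpose (Df f x)"
  by (simp add: vec_eq_iff Umat_def mat_def matrix_matrix_mult_def transpose_def Df_def)

text \<open>All three claims rest on \<open>pos\<close>: the quadratic form of
  \<open>1 + F^T F\<close> is at least the squared norm. This gives a trivial kernel, and with
  Cauchy-Schwarz it makes the inverse a contraction. The matrix \<open>F\<close> is kept general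
  because both \<open>Df\<close> (for the metric) and its transpose (for \<open>Umat\<close>) are
  inserted.\<close>

lemma matrix_inv_one_plus_gram:
  fixes F :: "real^'n::finite^'m::finite"
  shows "matrix_inv (mat 1 + transpose F ** F) ** (mat 1 + transpose F ** F) = mat 1"
    "(mat 1 + transpose F ** F) ** matrix_inv (mat 1 + transpose F ** F) = mat 1"
    "norm (matrix_inv (mat 1 + transpose F ** F) *v u) \<le> norm u"
proof -
  let ?g = "mat 1 + transpose F ** F"
  have pos: "u \<bullet> (?g *v u) = u \<bullet> u + (F *v u) \<bullet> (F *v u)" for u
    by (simp add: matrix_vector_mult_add_rdistrib inner_add_right matrix_vector_mul_assoc[symmetric]
        dot_lmul_matrix[symmetric] vector_transpose_matrix inner_commute)
  have "u = 0" if "?g *v u = 0" for u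
  proof -
    have "u \<bullet> u + (F *v u) \<bullet> (F *v u) = 0" using pos[of u] that by simp
    then show ?thesis by (smt (verit) inner_ge_zero inner_eq_zero_iff)
  qed
  then have "invertible ?g"
    by (metis invertible_left_inverse matrix_left_invertible_ker)
  then have "\<exists>B. ?g ** B = mat 1 \<and> B ** ?g = mat 1" by (auto simp: invertible_def)
  then have "?g ** matrix_inv ?g = mat 1 \<and> matrix_inv ?g ** ?g = mat 1"
    unfolding matrix_inv_def by (rule someI_ex)
  then show inv: "matrix_inv ?g ** ?g = mat 1" "?g ** matrix_inv ?g = mat 1" by auto
  let ?v = "matrix_inv ?g *v u"
  have gv: "?g *v ?v = u" by (simp add: matrix_vector_mul_assoc inv)
  have "norm ?v * norm ?v = ?v \<bullet> ?v" by (simp add: power2_norm_eq_inner flip: power2_eq_square)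
  also have "\<dots> \<le> ?v \<bullet> (?g *v ?v)" unfolding pos by simp
  also have "\<dots> \<le> norm ?v * norm u" unfolding gv by (rule norm_cauchy_schwarz)
  finally have "norm ?v * norm ?v \<le> norm ?v * norm u" .
  then show "norm ?v \<le> norm u"
    by (cases "norm ?v = 0") (auto simp: mult_le_cancel_left)
qed

lemma gi_gm: "gi f x ** gm f x = mat 1" and gm_gi: "gm f x ** gi f x = mat 1"
  unfolding gi_def gm_eq by (rule matrix_inv_one_plus_gram)+

lemma transpose_gm: "transpose (gm f x) = gm f x"
  by (simp add: gm_def vec_eq_iff transpose_def mult.commute eq_commute)

lemma transpose_gi: "transpose (gi f x) = gi f x"
proof -
  have "transpose (gi f x) ** gm f x = mat 1"
    using arg_cong[OF gm_gi[of f x], of transpose] by (simp add: matrix_transpose_mul transpose_gm)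
  then have "transpose (gi f x) ** gm f x ** gi f x = gi f x" by simp
  then show ?thesis by (simp add: gm_gi flip: matrix_mul_assoc)
qed

lemma gi_sym: "gi f x $ i $ j = gi f x $ j $ i"
  using arg_cong[OF transpose_gi[of f x], of "\<lambda>M. M $ i $ j"] by (simp add: transpose_def)

text \<open>A bound valid at every point: raising an index therefore preserves any decay rate, and
  the determinant of the inverse metric is bounded.\<close>

lemma gi_bound: "\<bar>gi f x $ i $ j\<bar> \<le> 1"
proof -
  have "gi f x $ i $ j = (gi f x *v axis j 1) $ i" by (simp add: matrix_vector_mul_component inner_axis)
  also have "\<bar>\<dots>\<bar> \<le> norm (gi f x *v axis j 1)" by (rule component_le_norm_cart)
  also have "\<dots> \<le> 1" using matrix_inv_one_plus_gram(3)[of "Df f x" "axis j 1"] by (simp add: gi_def gm_eq)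
  finally show ?thesis .
qed

lemma Gdet_gi: "Gdet f x * det (gi f x) = 1"
  using arg_cong[OF gm_gi[of f x], of det] by (simp only: det_mul Gdet_def det_I)

lemma inverse_Gdet: "inverse (Gdet f x) = det (gi f x)"
  by (rule inverse_unique[OF Gdet_gi])

lemma Gdet_nonzero: "Gdet f x \<noteq> 0"
  using Gdet_gi[of f x] by auto

lemma gradf_nth: "gradf f a x $ k = (\<Sigma> l. gi f x $ k $ l * f1 f a l x)"
  by (simp add: gradf_def matrix_vector_mult_def)

lemma Aop_nth: "Aop f a x $ i $ j = (\<Sigma> k. gi f x $ i $ k * f2 f a k j x)"
  by (simp add: Aop_def matrix_matrix_mult_def)

text \<open>This is the Woodbury identity for \<open>1 + F F^T\<close>. It expresses the inverse on
  the normal side through the inverse metric, so that \<open>gi\<close> is the only inverse matrix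
  to be differentiated directly.\<close>

lemma Ui_eq_matrix: "Ui f x = mat 1 - Df f x ** gi f x ** transpose (Df f x)"
proof -
  let ?F = "Df f x" and ?G = "gi f x"
  let ?M = "mat 1 - ?F ** ?G ** transpose ?F"
  have FF: "transpose ?F ** ?F = gm f x - mat 1" by (simp add: gm_eq)
  have "?F ** transpose ?F ** (?F ** ?G ** transpose ?F) = ?F ** (transpose ?F ** ?F) ** ?G ** transpose ?F"
    by (simp add: matrix_mul_assoc)
  also have "\<dots> = ?F ** transpose ?F - ?F ** ?G ** transpose ?F"
    unfolding FF by (simp add: matrix_diff_rdistrib gm_gi flip: matrix_mul_assoc)
       (simp add: matrix_diff_ldistrib matrix_mul_assoc)
  finally have "Umat f x ** ?M = mat 1"
    by (simp add: Umat_eq matrix_diff_ldistrib matrix_add_rdistrib')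
  moreover have "matrix_inv (Umat f x) ** Umat f x = mat 1"
    using matrix_inv_one_plus_gram(1)[of "transpose (Df f x)"] by (simp add: Umat_eq)
  ultimately show ?thesis unfolding Ui_def by (metis matrix_mul_assoc matrix_mul_lid matrix_mul_rid)
qed

lemma Ui_nth: "Ui f x $ a $ b = (if a = b then 1 else 0) - (\<Sigma> k. gradf f a x $ k * f1 f b k x)"
proof -
  have "(Df f x ** gi f x) $ a $ k = gradf f a x $ k" for k
    by (simp add: matrix_matrix_mult_def gradf_nth Df_def mult.commute gi_sym[of f x k])
  then have "(Df f x ** gi f x ** transpose (Df f x)) $ a $ b = (\<Sigma> k. gradf f a x $ k * f1 f b k x)"
    by (subst matrix_matrix_mult_def) (simp add: transpose_def Df_def)
  then show ?thesis by (simp add: Ui_eq_matrix mat_def)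
qed

lemma gradf_dot_commute:
  "(\<Sigma> k. gradf f a x $ k * f1 f b k x) = (\<Sigma> k. gradf f b x $ k * f1 f a k x)"
proof -
  have "(\<Sigma> k. gradf f a x $ k * f1 f b k x) = (\<Sigma> k l. gi f x $ k $ l * f1 f a l x * f1 f b k x)"
    by (simp add: gradf_nth sum_distrib_right)
  also have "\<dots> = (\<Sigma> l k. gi f x $ k $ l * f1 f a l x * f1 f b k x)" by (rule sum.swap)
  also have "\<dots> = (\<Sigma> k. gradf f b x $ k * f1 f a k x)"
    unfolding gradf_nth sum_distrib_right
    by (intro sum.cong refl) (use gi_sym[of f x] in \<open>simp add: mult_ac\<close>)
  finally show ?thesis .
qed

lemma Ui_sym: "Ui f x $ a $ b = Ui f x $ b $ a"
  by (simp add: Ui_nth gradf_dot_commute[of f a x b])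

text \<open>An instance of the push-through identity
  \<open>(1 + F F^T)^-1 F = F (1 + F^T F)^-1\<close>.\<close>

lemma gradf_Ui: "gradf f a x $ k = (\<Sigma> b. Ui f x $ a $ b * f1 f b k x)"
proof -
  let ?F = "Df f x" and ?G = "gi f x"
  have FF: "transpose ?F ** ?F = gm f x - mat 1" by (simp add: gm_eq)
  have "Ui f x ** ?F = ?F - ?F ** ?G ** (transpose ?F ** ?F)"
    by (simp add: Ui_eq_matrix matrix_diff_rdistrib matrix_mul_assoc)
  also have "\<dots> = ?F ** ?G"
    unfolding FF by (simp add: matrix_diff_ldistrib gi_gm flip: matrix_mul_assoc)
  finally have "(Ui f x ** ?F) $ a $ k = (?F ** ?G) $ a $ k" by simp
  then show ?thesis
    by (simp add: matrix_matrix_mult_def gradf_nth Df_def mult.commute gi_sym[of f x k])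
qed

section \<open>Regularity and derivative of the inverse metric\<close>

lemma differentiable_det:
  fixes M :: "real^'n::finite \<Rightarrow> real^'k::finite^'k"
  assumes "\<And>i j. (\<lambda>y. M y $ i $ j) differentiable (at x)"
  shows "(\<lambda>y. det (M y)) differentiable (at x)"
  unfolding det_def
  by (intro differentiable_sum_fun differentiable_mult differentiable_const differentiable_prod_fun assms)

lemma differentiable_gm: "smooth_map f \<Longrightarrow> (\<lambda>y. gm f y $ i $ j) differentiable (at x)"
  unfolding gm_def vec_lambda_beta
  by (intro differentiable_add differentiable_const differentiable_sum_fun differentiable_mult
       C1_fun_differentiable C1_f1)

text \<open>By Cramer's rule the entries of the inverse are quotients of determinants.\<close>
lemma differentiable_gi:
  assumes "smooth_map f"
  shows "(\<lambda>y. gi f y $ i $ j) differentiable (at x)"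
proof -
  have eq: "gi f y $ i $ j = det (\<chi> p q. if q = i then (axis j 1 :: real^'a) $ p else gm f y $ p $ q) / Gdet f y" for y
  proof -
    have "gm f y *v (gi f y *v axis j 1) = axis j 1" by (simp add: matrix_vector_mul_assoc gm_gi)
    then have "gi f y *v axis j 1 = (\<chi> k. det (\<chi> p q. if q = k then (axis j 1 :: real^'a) $ p else gm f y $ p $ q) / det (gm f y))"
      by (subst (asm) cramer) (use Gdet_nonzero[of f y] in \<open>auto simp: Gdet_def\<close>)
    moreover have "gi f y $ i $ j = (gi f y *v axis j 1) $ i" by (simp add: matrix_vector_mul_component inner_axis)
    ultimately show ?thesis by (simp add: Gdet_def)
  qed
  have "(\<lambda>y. Gdet f y) differentiable (at x)"
    unfolding Gdet_def by (intro differentiable_det differentiable_gm assms)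
  moreover have "(\<lambda>y. det (\<chi> p q. if q = i then (axis j 1 :: real^'a) $ p else gm f y $ p $ q)) differentiable (at x)"
  proof (rule differentiable_det)
    fix p q
    show "(\<lambda>y. (\<chi> p q. if q = i then (axis j 1 :: real^'a) $ p else gm f y $ p $ q) $ p $ q) differentiable (at x)"
      by (cases "q = i") (auto intro: differentiable_gm assms)
  qed
  ultimately show ?thesis
    unfolding eq by (intro differentiable_divide) (auto simp: Gdet_nonzero)
qed

lemma pd_gm:
  assumes "smooth_map f"
  shows "pd s (\<lambda>y. gm f y $ i $ j) x = (\<Sigma> a. f2 f a i s x * f1 f a j x + f1 f a i x * f2 f a j s x)"
proof -
  have d: "(\<lambda>y. f1 f a i y) differentiable (at x)" for a i
    using assms by (intro C1_fun_differentiable C1_f1)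
  show ?thesis
    unfolding gm_def vec_lambda_beta
    by (subst pd_add, simp, intro differentiable_sum_fun differentiable_mult d,
        subst pd_sum, intro differentiable_mult d) (simp add: pd_mult d f2_def)
qed

text \<open>Differentiating \<open>gi ** gm = mat 1\<close> gives \<open>G' = - G g' G\<close>. In
  each product of \<open>pd_gm\<close> the outer factors then raise \<open>f1\<close> to a gradient
  and \<open>f2\<close> to a shape operator.\<close>

lemma pd_gi:
  assumes f: "smooth_map f"
  shows "pd s (\<lambda>y. gi f y $ k $ j) x
     = - (\<Sigma> a. Aop f a x $ k $ s * gradf f a x $ j + gradf f a x $ k * Aop f a x $ j $ s)"
proof -
  let ?G = "gi f x"
  define G' where "G' = (\<chi> k j. pd s (\<lambda>y. gi f y $ k $ j) x)"
  define g' where "g' = (\<chi> k j. pd s (\<lambda>y. gm f y $ k $ j) x)"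
  have "(\<Sigma> l. gi f y $ k $ l * gm f y $ l $ j) = mat 1 $ k $ j" for y k j
    using arg_cong[OF gi_gm[of f y], of "\<lambda>M. M $ k $ j"] by (simp add: matrix_matrix_mult_def)
  then have "pd s (\<lambda>y. \<Sigma> l. gi f y $ k $ l * gm f y $ l $ j) x = 0" for k j by simp
  then have "G' ** gm f x + ?G ** g' = 0"
    by (simp add: vec_eq_iff matrix_matrix_mult_def pd_sum pd_mult differentiable_gi differentiable_gm f
        G'_def g'_def sum.distrib)
  then have "G' ** gm f x = - (?G ** g')" by (simp add: add_eq_0_iff)
  then have "G' ** gm f x ** ?G = - (?G ** g' ** ?G)" by (simp add: matrix_minus_mult)
  moreover have "G' ** gm f x ** ?G = G'" by (simp add: gm_gi flip: matrix_mul_assoc)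
  ultimately have *: "G' = - (?G ** g' ** ?G)" by simp
  have "(?G ** g') $ k $ q = (\<Sigma> a. Aop f a x $ k $ s * f1 f a q x + gradf f a x $ k * f2 f a q s x)" for q
  proof -
    have "(?G ** g') $ k $ q = (\<Sigma> p a. ?G $ k $ p * f2 f a p s x * f1 f a q x + ?G $ k $ p * f1 f a p x * f2 f a q s x)"
      by (simp add: matrix_matrix_mult_def g'_def pd_gm[OF f] sum_distrib_left algebra_simps)
    also have "\<dots> = (\<Sigma> a p. ?G $ k $ p * f2 f a p s x * f1 f a q x + ?G $ k $ p * f1 f a p x * f2 f a q s x)"
      by (rule sum.swap)
    finally show ?thesis by (simp add: Aop_nth gradf_nth sum.distrib sum_distrib_right)
  qed
  then have "(?G ** g' ** ?G) $ k $ j = (\<Sigma> q a. Aop f a x $ k $ s * (?G $ j $ q * f1 f a q x) + gradf f a x $ k * (?G $ j $ q * f2 f a q s x))"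
    by (subst matrix_matrix_mult_def) (simp add: sum_distrib_left sum_distrib_right algebra_simps gi_sym[of f x _ j])
  also have "\<dots> = (\<Sigma> a q. Aop f a x $ k $ s * (?G $ j $ q * f1 f a q x) + gradf f a x $ k * (?G $ j $ q * f2 f a q s x))"
    by (rule sum.swap)
  also have "\<dots> = (\<Sigma> a. Aop f a x $ k $ s * gradf f a x $ j + gradf f a x $ k * Aop f a x $ j $ s)"
    by (simp add: sum.distrib Aop_nth gradf_nth sum_distrib_left)
  finally show ?thesis using arg_cong[OF *, of "\<lambda>M. M $ k $ j"] by (simp add: G'_def)
qed

lemma C1_gi [C1_intros]:
  assumes f: "smooth_map f" shows "C1_fun (\<lambda>x. gi f x $ i $ j)"
proof -
  have c: "continuous_on UNIV (\<lambda>x. gi f x $ i $ j)" for i j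
    using differentiable_gi[OF f] by (simp add: continuous_on_eq_continuous_at differentiable_imp_continuous_within)
  have c': "continuous_on UNIV (\<lambda>x. f1 f a i x)" "continuous_on UNIV (\<lambda>x. f2 f a i j x)" for a i j
    by (intro C1_fun_continuous C1_intros f)+
  have "continuous_on UNIV (pd s (\<lambda>x. gi f x $ i $ j))" for s
    unfolding pd_gi[OF f, abs_def] Aop_nth gradf_nth by (intro continuous_intros c c')
  then show ?thesis by (simp add: C1_fun_def differentiable_gi[OF f])
qed

lemma C1_gradf [C1_intros]: "smooth_map f \<Longrightarrow> C1_fun (\<lambda>x. gradf f a x $ k)"
  unfolding gradf_nth by (intro C1_intros)

lemma C1_Aop [C1_intros]: "smooth_map f \<Longrightarrow> C1_fun (\<lambda>x. Aop f a x $ i $ j)"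
  unfolding Aop_nth by (intro C1_intros)

lemma C1_Ui [C1_intros]: "smooth_map f \<Longrightarrow> C1_fun (\<lambda>x. Ui f x $ a $ b)"
  unfolding Ui_nth by (intro C1_intros)


subsection \<open>Gauss equation\<close>

text \<open>The form \<open>h\<^sup>a(\<nabla>f\<^sup>b, \<cdot>)\<close>, where \<open>h\<^sup>a\<close> is the Hessian of the component \<open>f\<^sup>a\<close>. It is the connection form
  of the normal bundle in the frame of the \<open>\<eta>\<^sup>a\<close>.\<close>
definition shape_grad :: "(real^'n::finite \<Rightarrow> real^'m::finite) \<Rightarrow> 'm \<Rightarrow> 'm \<Rightarrow> real^'n \<Rightarrow> 'n \<Rightarrow> real" where
  "shape_grad f a b x j = (\<Sigma> p. f2 f a j p x * gradf f b x $ p)"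

context
  fixes f :: "real^'n::finite \<Rightarrow> real^'m::finite"
  assumes f: "smooth_map f"
begin

lemma gm_Aop: "(\<Sigma> s. gm f x $ k $ s * Aop f a x $ s $ i) = f2 f a k i x"
proof -
  have "gm f x ** Aop f a x = (\<chi> k i. f2 f a k i x)"
    by (simp add: Aop_def matrix_mul_assoc gm_gi)
  from arg_cong[OF this, of "\<lambda>M. M $ k $ i"] show ?thesis by (simp add: matrix_matrix_mult_def)
qed

lemma Aop_f1: "(\<Sigma> l. Aop f c x $ l $ s * f1 f a l x) = shape_grad f c a x s"
proof -
  have "(\<Sigma> l. Aop f c x $ l $ s * f1 f a l x)
      = (\<Sigma> l p. f2 f c s p x * (gi f x $ p $ l * f1 f a l x))"
    unfolding Aop_nth sum_distrib_right
    by (intro sum.cong refl) (use gi_sym[of f x] f2_commute[OF f] in \<open>simp add: mult_ac\<close>)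
  also have "\<dots> = (\<Sigma> p l. f2 f c s p x * (gi f x $ p $ l * f1 f a l x))" by (rule sum.swap)
  finally show ?thesis by (simp add: shape_grad_def gradf_nth sum_distrib_left)
qed

text \<open>The covariant Hessian of \<open>f a\<close> is the contraction of \<open>f2\<close> with
  \<open>Ui\<close>, since its Christoffel correction replaces the delta by \<open>Ui\<close> as in
  \<open>Ui_nth\<close>. With an index raised this is the first term; the second is the Christoffel
  term of a vector field.\<close>

lemma pd_gradf:
  "pd s (\<lambda>y. gradf f a y $ k) x
    = (\<Sigma> c. Ui f x $ c $ a * Aop f c x $ k $ s - gradf f c x $ k * shape_grad f c a x s)"
proof -
  let ?F = "\<lambda>l c. Aop f c x $ k $ s * (gradf f c x $ l * f1 f a l x) + gradf f c x $ k * (Aop f c x $ l $ s * f1 f a l x)"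
  have "pd s (\<lambda>y. gradf f a y $ k) x
      = (\<Sigma> l. - (\<Sigma> c. Aop f c x $ k $ s * gradf f c x $ l + gradf f c x $ k * Aop f c x $ l $ s) * f1 f a l x
          + gi f x $ k $ l * f2 f a l s x)"
    unfolding gradf_nth
    by (subst pd_sum, intro C1_fun_differentiable C1_intros f)
       (simp add: pd_mult pd_gi C1_fun_differentiable C1_intros f f2_def gradf_nth)
  also have "\<dots> = Aop f a x $ k $ s
      - (\<Sigma> l c. ?F l c)"
    unfolding sum.distrib Aop_nth[of f a x k s, symmetric]
    by (simp add: sum_distrib_right sum_distrib_left sum_negf sum_subtractf algebra_simps sum.distrib)
  also have "(\<Sigma> l c. ?F l c)
     = (\<Sigma> c l. ?F l c)"
    by (rule sum.swap)
  also have "\<dots> = (\<Sigma> c. Aop f c x $ k $ s * (\<Sigma> l. gradf f c x $ l * f1 f a l x) + gradf f c x $ k * shape_grad f c a x s)"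
    by (simp add: sum.distrib Aop_f1 flip: sum_distrib_left)
  also have "Aop f a x $ k $ s = (\<Sigma> c. (if c = a then 1 else 0) * Aop f c x $ k $ s)"
    by (simp add: if_distrib[of "\<lambda>z. z * _"] cong: if_cong)
  finally show ?thesis by (simp add: Ui_nth sum_subtractf algebra_simps sum.distrib)
qed

text \<open>The right-hand side is the connection form of the normal bundle acting on each of the
  two normal indices, which is the content of \<open>Ui\<close> being parallel.\<close>

lemma pd_Ui:
  "pd s (\<lambda>y. Ui f y $ a $ b) x
    = - (\<Sigma> c. Ui f x $ c $ a * shape_grad f c b x s + Ui f x $ c $ b * shape_grad f c a x s)"
proof -
  let ?F = "\<lambda>k c. Ui f x $ c $ a * (Aop f c x $ k $ s * f1 f b k x) - shape_grad f c a x s * (gradf f c x $ k * f1 f b k x)"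
  have "pd s (\<lambda>y. Ui f y $ a $ b) x
     = - (\<Sigma> k. (\<Sigma> c. Ui f x $ c $ a * Aop f c x $ k $ s - gradf f c x $ k * shape_grad f c a x s) * f1 f b k x
           + gradf f a x $ k * f2 f b k s x)"
    unfolding Ui_nth
    by (subst pd_diff, (intro C1_fun_differentiable C1_intros f)+, subst pd_sum, intro C1_fun_differentiable C1_intros f)
       (simp add: pd_mult pd_gradf C1_fun_differentiable C1_intros f f2_def Ui_nth)
  also have "\<dots> = - (\<Sigma> k c. ?F k c) - shape_grad f b a x s"
  proof -
    have "(\<Sigma> k. gradf f a x $ k * f2 f b k s x) = shape_grad f b a x s"
      by (simp add: shape_grad_def f2_commute[OF f, of b s] mult.commute)
    then show ?thesis
      unfolding sum.distrib by (simp add: sum_distrib_right sum_distrib_left algebra_simps)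
  qed
  also have "(\<Sigma> k c. ?F k c)
     = (\<Sigma> c k. ?F k c)" by (rule sum.swap)
  also have "\<dots> = (\<Sigma> c. Ui f x $ c $ a * shape_grad f c b x s - shape_grad f c a x s * (\<Sigma> k. gradf f c x $ k * f1 f b k x))"
    by (simp add: sum_subtractf Aop_f1 flip: sum_distrib_left)
  also have "shape_grad f b a x s = (\<Sigma> c. (if c = b then 1 else 0) * shape_grad f c a x s)"
    by (simp add: if_distrib[of "\<lambda>z. z * _"] cong: if_cong)
  finally show ?thesis by (simp add: Ui_nth[of f x _ b] sum_subtractf algebra_simps sum.distrib)
qed

text \<open>Of the six products in the three metric derivatives four cancel by the symmetry of
  \<open>f2\<close>, and the remaining two are equal.\<close>

lemma chr_eq: "chr f k i j x = (\<Sigma> a. gradf f a x $ k * f2 f a i j x)"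
proof -
  have "pd i (\<lambda>y. gm f y $ j $ l) x + pd j (\<lambda>y. gm f y $ i $ l) x - pd l (\<lambda>y. gm f y $ i $ j) x
      = 2 * (\<Sigma> a. f2 f a i j x * f1 f a l x)" for l
    by (simp add: pd_gm[OF f] sum_distrib_left flip: sum.distrib sum_subtractf)
       (intro sum.cong refl, simp add: f2_commute[OF f, of _ j i] f2_commute[OF f, of _ l] algebra_simps)
  then have "chr f k i j x = (\<Sigma> l a. gi f x $ k $ l * f1 f a l x * f2 f a i j x)"
    by (simp add: chr_def sum_distrib_left algebra_simps)
  also have "\<dots> = (\<Sigma> a l. gi f x $ k $ l * f1 f a l x * f2 f a i j x)" by (rule sum.swap)
  finally show ?thesis by (simp add: gradf_nth sum_distrib_right)
qed

lemma pd_chr: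
  "pd i (\<lambda>y. chr f s j l y) x = (\<Sigma> a. gradf f a x $ s * f3 f a j l i x
     + (\<Sigma> c. Ui f x $ c $ a * Aop f c x $ s $ i * f2 f a j l x))
     - (\<Sigma> a c. gradf f c x $ s * shape_grad f c a x i * f2 f a j l x)"
  unfolding chr_eq
  by (subst pd_sum, intro C1_fun_differentiable C1_intros f)
     (simp add: pd_mult pd_gradf C1_fun_differentiable C1_intros f f3_def sum_subtractf
        sum_distrib_right sum_distrib_left algebra_simps sum.distrib)

text \<open>The quadratic Christoffel terms reproduce the double sum that \<open>pd_chr\<close>
  subtracts, so the two cancel in the curvature.\<close>

lemma chr_chr:
  "(\<Sigma> p. chr f p j l x * chr f s i p x)
     = (\<Sigma> a c. gradf f c x $ s * shape_grad f c a x i * f2 f a j l x)"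
proof -
  have "(\<Sigma> p. chr f p j l x * chr f s i p x)
      = (\<Sigma> p a c. gradf f c x $ s * (f2 f c i p x * gradf f a x $ p) * f2 f a j l x)"
    unfolding chr_eq sum_product by (simp add: mult_ac)
  also have "\<dots> = (\<Sigma> a p c. gradf f c x $ s * (f2 f c i p x * gradf f a x $ p) * f2 f a j l x)"
    by (rule sum.swap)
  also have "\<dots> = (\<Sigma> a c p. gradf f c x $ s * (f2 f c i p x * gradf f a x $ p) * f2 f a j l x)"
    by (intro sum.cong refl, rule sum.swap)
  finally show ?thesis by (simp add: shape_grad_def flip: sum_distrib_left sum_distrib_right)
qed

lemma Rup_eq:
  "Rup f s i j l x = (\<Sigma> a c. Ui f x $ c $ a *
     (Aop f c x $ s $ i * f2 f a j l x - Aop f c x $ s $ j * f2 f a i l x))"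
proof -
  \<comment> \<open>Because of this symmetry the third derivatives drop out when the expression is
    antisymmetrised in \<open>i\<close> and \<open>j\<close>.\<close>
  have f3: "f3 f a j l i x = f3 f a i l j x" for a
    by (metis f3_commute12[OF f] f3_commute23[OF f])
  show ?thesis
    unfolding Rup_def pd_chr sum_subtractf chr_chr f3
    by (simp add: sum.distrib sum_subtractf right_diff_distrib mult_ac)
qed

text \<open>The normal frame has Gram matrix \<open>Umat\<close>, so the products of second
  fundamental forms in the Gauss equation are contracted with its inverse.\<close>

lemma Rm_eq:
  "Rm f i j k l x = (\<Sigma> a c. Ui f x $ a $ c *
     (f2 f a i k x * f2 f c j l x - f2 f a i l x * f2 f c j k x))"
proof -
  let ?F = "\<lambda>a c s. Ui f x $ c $ a * ((gm f x $ k $ s * Aop f c x $ s $ i) * f2 f a j l x - (gm f x $ k $ s * Aop f c x $ s $ j) * f2 f a i l x)"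
  have "Rm f i j k l x = (\<Sigma> s a c. ?F a c s)"
    by (simp add: Rm_def Rup_eq sum_distrib_left algebra_simps)
  also have "\<dots> = (\<Sigma> a s c. ?F a c s)"
    by (rule sum.swap)
  also have "\<dots> = (\<Sigma> a c s. ?F a c s)"
    by (intro sum.cong refl, rule sum.swap)
  also have "\<dots> = (\<Sigma> a c. Ui f x $ c $ a * (f2 f c k i x * f2 f a j l x - f2 f c k j x * f2 f a i l x))"
    by (simp add: sum_subtractf gm_Aop flip: sum_distrib_left sum_distrib_right)
  also have "\<dots> = (\<Sigma> a c. Ui f x $ c $ a * (f2 f c k i x * f2 f a j l x))
      - (\<Sigma> a c. Ui f x $ c $ a * (f2 f c k j x * f2 f a i l x))"
    by (simp add: right_diff_distrib sum_subtractf)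
  also have "(\<Sigma> a c. Ui f x $ c $ a * (f2 f c k i x * f2 f a j l x))
     = (\<Sigma> a c. Ui f x $ a $ c * (f2 f a i k x * f2 f c j l x))"
    by (subst sum.swap) (simp add: f2_commute[OF f, of _ k])
  also have "(\<Sigma> a c. Ui f x $ c $ a * (f2 f c k j x * f2 f a i l x))
     = (\<Sigma> a c. Ui f x $ a $ c * (f2 f a i l x * f2 f c j k x))"
    by (simp add: f2_commute[OF f, of _ k] Ui_sym[of f x] mult_ac)
  finally show ?thesis by (simp add: right_diff_distrib sum_subtractf)
qed

end


subsection \<open>The Gauss-Bonnet tensor as a polynomial in the shape operators\<close>

abbreviation kd :: "'a \<Rightarrow> 'a \<Rightarrow> real" where
  "kd i j \<equiv> (if i = j then 1 else 0)"

lemma sum_kd [simp]: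
  fixes h :: "'a::finite \<Rightarrow> real"
  shows "(\<Sigma> p. kd i p * h p) = h i" "(\<Sigma> p. kd p i * h p) = h i"
    "(\<Sigma> p. h p * kd i p) = h i" "(\<Sigma> p. h p * kd p i) = h i"
  by (simp_all add: if_distrib[of "\<lambda>z. z * _"] if_distrib[of "\<lambda>z. _ * z"] cong: if_cong)

text \<open>With the indices \<open>k\<close>, \<open>l\<close> lowered, \<open>P\<^sub>2\<close> is \<open>U\<^bsup>ab\<^esup> Qm A\<^sup>a A\<^sup>b\<close> by the Gauss equation, where \<open>A\<^sup>a\<close> are the shape
  operators and \<open>Qm\<close> is bilinear. The part \<open>Sm\<close> gives the Ricci tensor with one index raised.\<close>
definition Sm :: "real^'n^'n \<Rightarrow> real^'n^'n \<Rightarrow> 'n::finite \<Rightarrow> 'n \<Rightarrow> real" where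
  "Sm A B i j = trace A * B $ i $ j - (\<Sigma> p. A $ i $ p * B $ p $ j)"

definition Em :: "real^'n^'n \<Rightarrow> real^'n^'n \<Rightarrow> 'n::finite \<Rightarrow> 'n \<Rightarrow> 'n \<Rightarrow> 'n \<Rightarrow> real" where
  "Em A B i j k l = A $ i $ k * B $ j $ l - kd i k * Sm A B j l - Sm A B i k * kd j l
     + (1/2) * (\<Sigma> p. Sm A B p p) * (kd i k * kd j l)"

definition Qm :: "real^'n^'n \<Rightarrow> real^'n^'n \<Rightarrow> 'n::finite \<Rightarrow> 'n \<Rightarrow> 'n \<Rightarrow> 'n \<Rightarrow> real" where
  "Qm A B i j k l = Em A B i j k l - Em A B i j l k"

lemma Sm_linear:
  "Sm (A + A') B i j = Sm A B i j + Sm A' B i j" "Sm A (B + B') i j = Sm A B i j + Sm A B' i j"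
  "Sm (c *\<^sub>R A) B i j = c * Sm A B i j" "Sm A (c *\<^sub>R B) i j = c * Sm A B i j"
  "Sm 0 B i j = 0" "Sm A 0 i j = 0"
  by (simp_all add: Sm_def trace_def algebra_simps sum.distrib sum_distrib_left)

lemma Qm_linear:
  "Qm (A + A') B i j k l = Qm A B i j k l + Qm A' B i j k l"
  "Qm A (B + B') i j k l = Qm A B i j k l + Qm A B' i j k l"
  "Qm (c *\<^sub>R A) B i j k l = c * Qm A B i j k l"
  "Qm A (c *\<^sub>R B) i j k l = c * Qm A B i j k l"
  "Qm 0 B i j k l = 0" "Qm A 0 i j k l = 0"
  by (simp_all add: Qm_def Em_def Sm_linear algebra_simps sum.distrib flip: sum_distrib_left)

lemma Qm_sum:
  "Qm (\<Sum>b\<in>I. c b *\<^sub>R A b) B i j k l = (\<Sum>b\<in>I. c b * Qm (A b) B i j k l)"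
  "Qm B (\<Sum>b\<in>I. c b *\<^sub>R A b) i j k l = (\<Sum>b\<in>I. c b * Qm B (A b) i j k l)"
  by (induction I rule: infinite_finite_induct) (simp_all add: Qm_linear)

lemma Sm_trace_commute: "(\<Sigma> p. Sm A B p p) = (\<Sigma> p. Sm B A p p)"
proof -
  have "(\<Sigma> p. Sm A B p p) = trace A * trace B - trace (A ** B)" for A B :: "real^'a^'a"
    by (simp add: Sm_def sum_subtractf trace_def matrix_matrix_mult_def flip: sum_distrib_left)
  then show ?thesis by (simp add: trace_mul_sym[of A B])
qed

text \<open>Exchanging \<open>i\<close> and \<open>j\<close> in the leading product also exchanges
  \<open>A\<close> and \<open>B\<close>, hence the antisymmetry holds only after symmetrising in the
  two matrices. Contraction with the symmetric \<open>Ui\<close> performs exactly this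
  symmetrisation.\<close>

lemma Qm_antisym: "Qm A B i j k l + Qm B A i j k l = - (Qm A B j i k l + Qm B A j i k l)"
  by (simp add: Qm_def Em_def Sm_trace_commute[of B A] algebra_simps)

text \<open>The contracted second Bianchi identity for the Gauss-Bonnet tensor; \<open>D i\<close> plays the role of
  \<open>\<nabla>\<^sub>i A\<close>, and its symmetry is the Codazzi equation.\<close>
lemma Qm_divergence_free:
  fixes D :: "'n::finite \<Rightarrow> real^'n^'n"
  assumes D: "\<And>i p q. D i $ p $ q = D q $ p $ i"
  shows "(\<Sigma> i. Qm (D i) A i j k l + Qm A (D i) i j k l) = 0"
proof -
  \<comment> \<open>\<open>S i\<close> is the derivative of the Ricci part \<open>Sm A A\<close> in
    direction \<open>i\<close> when \<open>A\<close> has the derivative \<open>D i\<close>.\<close>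
  define S where "S i j k = Sm (D i) A j k + Sm A (D i) j k" for i j k
  define t where "t k = trace (D k)" for k
  have t: "(\<Sigma> i. D i $ i $ k) = t k" for k
    by (simp add: D[of _ _ k] t_def trace_def)
  have DA: "(\<Sigma> i. A $ i $ k * D i $ j $ l) = (\<Sigma> i. D l $ j $ i * A $ i $ k)" for j k l
    by (simp add: D[of _ _ l] mult.commute)
  have S: "S i j k = t i * A $ j $ k + trace A * D i $ j $ k
      - (\<Sigma> p. D i $ j $ p * A $ p $ k) - (\<Sigma> p. A $ j $ p * D i $ p $ k)" for i j k
    by (simp add: S_def Sm_def t_def)
  have "(\<Sigma> i p. D i $ i $ p * A $ p $ k) = (\<Sigma> p. t p * A $ p $ k)" for k
    by (subst sum.swap) (simp add: t flip: sum_distrib_right)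
  moreover have AD: "(\<Sigma> i p. A $ i $ p * D i $ p $ k) = trace (A ** D k)" for k
    by (simp add: D[of _ _ k] trace_def matrix_matrix_mult_def)
  ultimately have S1: "(\<Sigma> i. S i i k) = trace A * t k - trace (A ** D k)" for k
    by (simp add: S sum.distrib sum_subtractf t flip: sum_distrib_left)
  \<comment> \<open>Compared with \<open>S1\<close> this is twice the divergence: the twice
    contracted Bianchi identity, div Ric = dR / 2. It makes the terms with \<open>kd j l\<close>
    cancel in \<open>E\<close>.\<close>
  have S2: "(\<Sigma> p. S k p p) = 2 * (trace A * t k - trace (A ** D k))" for k
  proof -
    have "(\<Sigma> p. S k p p) = t k * trace A + trace A * t k - trace (D k ** A) - trace (A ** D k)"
      by (simp add: S sum.distrib sum_subtractf trace_def matrix_matrix_mult_def t_def flip: sum_distrib_left)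
    then show ?thesis by (simp add: trace_mul_sym[of "D k" A])
  qed
  have E: "(\<Sigma> i. Em (D i) A i j k l + Em A (D i) i j k l)
      = t k * A $ j $ l + (\<Sigma> i. D l $ j $ i * A $ i $ k) - S k j l" for k l
  proof -
    have "Em (D i) A i j k l + Em A (D i) i j k l = D i $ i $ k * A $ j $ l + A $ i $ k * D i $ j $ l
        - kd i k * S i j l - S i i k * kd j l + kd i k * ((1/2) * (\<Sigma> p. S i p p) * kd j l)" for i
      by (simp add: Em_def S_def algebra_simps sum.distrib)
    then have "(\<Sigma> i. Em (D i) A i j k l + Em A (D i) i j k l)
       = (\<Sigma> i. D i $ i $ k * A $ j $ l + A $ i $ k * D i $ j $ l
        - kd i k * S i j l - S i i k * kd j l + kd i k * ((1/2) * (\<Sigma> p. S i p p) * kd j l))"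
      by (rule sum.cong[OF refl])
    also have "\<dots> = t k * A $ j $ l + (\<Sigma> i. D l $ j $ i * A $ i $ k) - S k j l
        - (\<Sigma> i. S i i k) * kd j l + (1/2) * (\<Sigma> p. S k p p) * kd j l"
      unfolding sum.distrib sum_subtractf sum_kd DA sum_distrib_right[symmetric] t by simp
    finally show ?thesis unfolding S1 S2 by simp
  qed
  have "(\<Sigma> i. Qm (D i) A i j k l + Qm A (D i) i j k l)
     = (\<Sigma> i. Em (D i) A i j k l + Em A (D i) i j k l) - (\<Sigma> i. Em (D i) A i j l k + Em A (D i) i j l k)"
    by (simp add: Qm_def sum.distrib sum_subtractf)
  \<comment> \<open>After inserting \<open>S\<close>, what remains of \<open>E\<close> is symmetric
    in \<open>k\<close> and \<open>l\<close> by the symmetry of \<open>D\<close>, and the difference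
    vanishes.\<close>
  also have "\<dots> = 0"
    unfolding E S by (simp add: D[of k _ l])
  finally show ?thesis .
qed

subsection \<open>Covariant derivatives\<close>

definition Bm :: "(real^'n::finite \<Rightarrow> real^'m::finite) \<Rightarrow> 'n \<Rightarrow> real^'n \<Rightarrow> real^'n^'n" where
  "Bm f s x = (\<chi> i j. \<Sigma> c. gradf f c x $ i * f2 f c j s x)"

text \<open>The covariant derivative of \<open>A\<^sup>a\<close> in direction \<open>s\<close>, for the tangential and the normal connection.\<close>
definition DA :: "(real^'n::finite \<Rightarrow> real^'m::finite) \<Rightarrow> 'm \<Rightarrow> 'n \<Rightarrow> real^'n \<Rightarrow> real^'n^'n" where
  "DA f a s x = (\<chi> i j. (\<Sigma> p. gi f x $ i $ p * f3 f a p j s x)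
     - (\<Sigma> c. Aop f c x $ i $ s * shape_grad f a c x j)
     - (\<Sigma> c. (\<Sigma> p. Aop f a x $ i $ p * gradf f c x $ p) * f2 f c j s x)
     - (\<Sigma> c. shape_grad f a c x s * Aop f c x $ i $ j))"

text \<open>\<open>Bm s\<close> is the matrix of Christoffel symbols in direction \<open>s\<close>, so \<open>X'\<close> and \<open>T'\<close> below are
  covariant derivatives of the mixed tensors \<open>X\<close> and \<open>T\<close>.\<close>
definition cov2 :: "(real^'n::finite \<Rightarrow> real^'m::finite) \<Rightarrow> 'n \<Rightarrow> real^'n \<Rightarrow> (real^'n \<Rightarrow> 'n \<Rightarrow> 'n \<Rightarrow> real) \<Rightarrow> ('n \<Rightarrow> 'n \<Rightarrow> real) \<Rightarrow> bool" where
  "cov2 f s x X X' \<longleftrightarrow> (\<forall>i j. (\<lambda>y. X y i j) differentiable (at x) \<and> pd s (\<lambda>y. X y i j) x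
     = X' i j + (\<Sigma> p. X x i p * Bm f s x $ p $ j) - (\<Sigma> p. Bm f s x $ i $ p * X x p j))"

definition cov4 :: "(real^'n::finite \<Rightarrow> real^'m::finite) \<Rightarrow> 'n \<Rightarrow> real^'n \<Rightarrow> (real^'n \<Rightarrow> 'n \<Rightarrow> 'n \<Rightarrow> 'n \<Rightarrow> 'n \<Rightarrow> real) \<Rightarrow> ('n \<Rightarrow> 'n \<Rightarrow> 'n \<Rightarrow> 'n \<Rightarrow> real) \<Rightarrow> bool" where
  "cov4 f s x T T' \<longleftrightarrow> (\<forall>i j k l. (\<lambda>y. T y i j k l) differentiable (at x) \<and> pd s (\<lambda>y. T y i j k l) x
     = T' i j k l + (\<Sigma> p. T x i j p l * Bm f s x $ p $ k) + (\<Sigma> p. T x i j k p * Bm f s x $ p $ l)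
       - (\<Sigma> p. Bm f s x $ i $ p * T x p j k l) - (\<Sigma> p. Bm f s x $ j $ p * T x i p k l))"

definition Q2 :: "(real^'n::finite \<Rightarrow> real^'m::finite) \<Rightarrow> real^'n \<Rightarrow> 'n \<Rightarrow> 'n \<Rightarrow> 'n \<Rightarrow> 'n \<Rightarrow> real" where
  "Q2 f x i j k l = (\<Sigma> a b. Ui f x $ a $ b * Qm (Aop f a x) (Aop f b x) i j k l)"

definition Qtot :: "(real^'n::finite \<Rightarrow> real^'m::finite) \<Rightarrow> real \<Rightarrow> real^'n \<Rightarrow> 'n \<Rightarrow> 'n \<Rightarrow> 'n \<Rightarrow> 'n \<Rightarrow> real" where
  "Qtot f lam x i j k l = (1/2) * (kd i k * kd j l - kd i l * kd j k) + lam * Q2 f x i j k l"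

text \<open>Only the part symmetric in \<open>a\<close> and \<open>b\<close> survives the
  contraction. Thus the order of two shape operators in a product does not matter under
  \<open>Ui\<close>, even where they do not commute.\<close>

lemma sum_Ui_cong_sym:
  assumes "\<And>a b. F a b + F b a = G a b + G b a"
  shows "(\<Sigma> a b. Ui f x $ a $ b * F a b) = (\<Sigma> a b. Ui f x $ a $ b * G a b)"
proof -
  have *: "(\<Sigma> a b. Ui f x $ a $ b * (F a b + F b a)) = 2 * (\<Sigma> a b. Ui f x $ a $ b * F a b)" for F
  proof -
    have "(\<Sigma> a b. Ui f x $ a $ b * F b a) = (\<Sigma> b a. Ui f x $ a $ b * F b a)"
      by (rule sum.swap)
    also have "\<dots> = (\<Sigma> a b. Ui f x $ a $ b * F a b)"
      by (intro sum.cong refl arg_cong2[where f="(*)"] Ui_sym)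
    finally show ?thesis by (simp add: distrib_left sum.distrib)
  qed
  show ?thesis using *[of F] *[of G] assms by simp
qed

section \<open>Product rules for covariant derivatives of mixed tensors\<close>

lemma cov2_kd: "cov2 f s x (\<lambda>y. kd) (\<lambda>i j. 0)"
  by (simp add: cov2_def mult.commute[of _ "kd _ _"] cong: if_cong)

lemma cov2D:
  assumes "cov2 f s x X X'"
  shows "(\<lambda>y. X y i j) differentiable (at x)"
    "pd s (\<lambda>y. X y i j) x = X' i j + (\<Sigma> p. X x i p * Bm f s x $ p $ j) - (\<Sigma> p. Bm f s x $ i $ p * X x p j)"
  using assms by (auto simp: cov2_def)

lemma cov4D:
  assumes "cov4 f s x T T'"
  shows "(\<lambda>y. T y i j k l) differentiable (at x)"
    "pd s (\<lambda>y. T y i j k l) x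
     = T' i j k l + (\<Sigma> p. T x i j p l * Bm f s x $ p $ k) + (\<Sigma> p. T x i j k p * Bm f s x $ p $ l)
       - (\<Sigma> p. Bm f s x $ i $ p * T x p j k l) - (\<Sigma> p. Bm f s x $ j $ p * T x i p k l)"
  using assms by (auto simp: cov4_def)

lemma cov2_diff:
  assumes "cov2 f s x X X'" "cov2 f s x Y Y'"
  shows "cov2 f s x (\<lambda>y i j. X y i j - Y y i j) (\<lambda>i j. X' i j - Y' i j)"
  by (simp add: cov2_def pd_diff cov2D[OF assms(1)] cov2D[OF assms(2)] algebra_simps sum_subtractf)

lemma cov2_scalar:
  assumes "c differentiable (at x)" "cov2 f s x X X'"
  shows "cov2 f s x (\<lambda>y i j. c y * X y i j) (\<lambda>i j. pd s c x * X x i j + c x * X' i j)"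
  by (simp add: cov2_def pd_mult assms(1) cov2D[OF assms(2)] algebra_simps sum_distrib_left)

text \<open>The contracted index occurs once as a lower and once as an upper index, and its two
  connection terms cancel.\<close>

lemma cov2_mult:
  assumes X: "cov2 f s x X X'" and Y: "cov2 f s x Y Y'"
  shows "cov2 f s x (\<lambda>y i j. \<Sigma> p. X y i p * Y y p j) (\<lambda>i j. (\<Sigma> p. X' i p * Y x p j) + (\<Sigma> p. X x i p * Y' p j))"
proof -
  note d = cov2D(1)[OF X] cov2D(1)[OF Y]
  note p = cov2D(2)[OF X] cov2D(2)[OF Y]
  have "pd s (\<lambda>y. \<Sigma> p. X y i p * Y y p j) x =
     (\<Sigma> p. X' i p * Y x p j) + (\<Sigma> p. X x i p * Y' p j)
     + (\<Sigma> p. (\<Sigma> q. X x i q * Y x q p) * Bm f s x $ p $ j)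
     - (\<Sigma> p. Bm f s x $ i $ p * (\<Sigma> q. X x p q * Y x q j))" for i j
  proof -
    have "pd s (\<lambda>y. \<Sigma> p. X y i p * Y y p j) x =
      (\<Sigma> p. X' i p * Y x p j) + (\<Sigma> p. X x i p * Y' p j)
       + (\<Sigma> p q. X x i q * Bm f s x $ q $ p * Y x p j) - (\<Sigma> p q. Bm f s x $ i $ q * X x q p * Y x p j)
       + (\<Sigma> p q. X x i p * Y x p q * Bm f s x $ q $ j) - (\<Sigma> p q. X x i p * Bm f s x $ p $ q * Y x q j)"
      by (subst pd_sum, intro differentiable_mult d)
         (simp add: pd_mult d p sum.distrib sum_subtractf sum_distrib_left sum_distrib_right algebra_simps)
    also have "(\<Sigma> p q. X x i q * Bm f s x $ q $ p * Y x p j) = (\<Sigma> p q. X x i p * Bm f s x $ p $ q * Y x q j)"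
      by (rule sum.swap)
    also have "(\<Sigma> p q. Bm f s x $ i $ q * X x q p * Y x p j) = (\<Sigma> p. Bm f s x $ i $ p * (\<Sigma> q. X x p q * Y x q j))"
      by (subst sum.swap) (simp add: sum_distrib_left mult.assoc)
    also have "(\<Sigma> p q. X x i p * Y x p q * Bm f s x $ q $ j) = (\<Sigma> p. (\<Sigma> q. X x i q * Y x q p) * Bm f s x $ p $ j)"
      by (subst sum.swap) (simp add: sum_distrib_right)
    finally show ?thesis by simp
  qed
  then show ?thesis
    unfolding cov2_def by (auto intro!: differentiable_sum_fun differentiable_mult d)
qed

lemma cov2_trace:
  assumes X: "cov2 f s x X X'"
  shows "(\<lambda>y. \<Sigma> p. X y p p) differentiable (at x)" "pd s (\<lambda>y. \<Sigma> p. X y p p) x = (\<Sigma> p. X' p p)"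
proof -
  note d = cov2D(1)[OF X]
  note p = cov2D(2)[OF X]
  show "(\<lambda>y. \<Sigma> p. X y p p) differentiable (at x)" by (intro differentiable_sum_fun d)
  have "(\<Sigma> i p. X x i p * Bm f s x $ p $ i) = (\<Sigma> i p. Bm f s x $ i $ p * X x p i)"
    by (subst sum.swap) (simp add: mult.commute)
  then show "pd s (\<lambda>y. \<Sigma> p. X y p p) x = (\<Sigma> p. X' p p)"
    by (subst pd_sum, intro d) (simp add: p sum.distrib sum_subtractf)
qed

lemma cov4_mult:
  assumes X: "cov2 f s x X X'" and Y: "cov2 f s x Y Y'"
  shows "cov4 f s x (\<lambda>y i j k l. X y i k * Y y j l) (\<lambda>i j k l. X' i k * Y x j l + X x i k * Y' j l)"
proof -
  note d = cov2D(1)[OF X] cov2D(1)[OF Y]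
  note p = cov2D(2)[OF X] cov2D(2)[OF Y]
  show ?thesis
    unfolding cov4_def
    by (auto intro!: d simp: pd_mult d p algebra_simps sum_distrib_left)
qed

lemma cov4_add:
  assumes "cov4 f s x T T'" "cov4 f s x W W'"
  shows "cov4 f s x (\<lambda>y i j k l. T y i j k l + W y i j k l) (\<lambda>i j k l. T' i j k l + W' i j k l)"
  by (simp add: cov4_def pd_add cov4D[OF assms(1)] cov4D[OF assms(2)] algebra_simps sum.distrib)

lemma cov4_diff:
  assumes "cov4 f s x T T'" "cov4 f s x W W'"
  shows "cov4 f s x (\<lambda>y i j k l. T y i j k l - W y i j k l) (\<lambda>i j k l. T' i j k l - W' i j k l)"
  by (simp add: cov4_def pd_diff cov4D[OF assms(1)] cov4D[OF assms(2)] algebra_simps sum_subtractf)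

lemma cov4_scalar:
  assumes "c differentiable (at x)" "cov4 f s x T T'"
  shows "cov4 f s x (\<lambda>y i j k l. c y * T y i j k l) (\<lambda>i j k l. pd s c x * T x i j k l + c x * T' i j k l)"
  by (simp add: cov4_def pd_mult assms(1) cov4D[OF assms(2)] algebra_simps sum_distrib_left)

lemma cov4_swap: "cov4 f s x T T' \<Longrightarrow> cov4 f s x (\<lambda>y i j k l. T y i j l k) (\<lambda>i j k l. T' i j l k)"
  by (simp add: cov4_def algebra_simps)

lemma cov4_zero: "cov4 f s x (\<lambda>y i j k l. 0) (\<lambda>i j k l. 0)"
  by (simp add: cov4_def)

lemma cov4_sum:
  assumes "\<And>a. a \<in> I \<Longrightarrow> cov4 f s x (T a) (T' a)"
  shows "cov4 f s x (\<lambda>y i j k l. \<Sum>a\<in>I. T a y i j k l) (\<lambda>i j k l. \<Sum>a\<in>I. T' a i j k l)"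
  using assms
proof (induction I rule: infinite_finite_induct)
  case (insert b I)
  then show ?case using cov4_add[of f s x "T b" "T' b"] by simp
qed (simp_all add: cov4_zero)

lemma cov4_cong: "cov4 f s x T T' \<Longrightarrow> (\<And>i j k l. T' i j k l = W' i j k l) \<Longrightarrow> cov4 f s x T W'"
  by (simp add: cov4_def)

lemma cov4_Qm:
  assumes A: "cov2 f s x (\<lambda>y i j. A y $ i $ j) (\<lambda>i j. A' $ i $ j)" and B: "cov2 f s x (\<lambda>y i j. B y $ i $ j) (\<lambda>i j. B' $ i $ j)"
  shows "cov4 f s x (\<lambda>y. Qm (A y) (B y)) (\<lambda>i j k l. Qm A' (B x) i j k l + Qm (A x) B' i j k l)"
proof -
  note S0 = cov2_diff[OF cov2_scalar[OF cov2_trace(1)[OF A] B] cov2_mult[OF A B]]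
  have S: "cov2 f s x (\<lambda>y. Sm (A y) (B y)) (\<lambda>i j. Sm A' (B x) i j + Sm (A x) B' i j)"
    unfolding Sm_def trace_def using S0 by (simp add: cov2_trace(2)[OF A] cov2_def algebra_simps)
  note t = cov2_trace[OF S]
  note E0 = cov4_add[OF cov4_diff[OF cov4_diff[OF cov4_mult[OF A B] cov4_mult[OF cov2_kd S]] cov4_mult[OF S cov2_kd]]
     cov4_scalar[OF _ cov4_mult[OF cov2_kd cov2_kd], of "\<lambda>y. (1/2) * (\<Sigma> p. Sm (A y) (B y) p p)"]]
  have d: "(\<lambda>y. (1/2) * (\<Sigma> p. Sm (A y) (B y) p p)) differentiable (at x)"
    using t(1) by (intro differentiable_mult) auto
  have E: "cov4 f s x (\<lambda>y. Em (A y) (B y)) (\<lambda>i j k l. Em A' (B x) i j k l + Em (A x) B' i j k l)"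
    unfolding Em_def
    by (rule cov4_cong[OF E0[OF d]])
       (use pd_cmult[OF t(1), of s "1/2"] in \<open>simp add: t(2) sum.distrib algebra_simps\<close>)
  show ?thesis
    unfolding Qm_def by (rule cov4_cong[OF cov4_diff[OF E cov4_swap[OF E]]]) simp
qed

section \<open>The Codazzi equation and the divergence of the Gauss-Bonnet tensor\<close>

context
  fixes f :: "real^'n::finite \<Rightarrow> real^'m::finite"
  assumes f: "smooth_map f"
begin

text \<open>This is the Codazzi equation. Exchanging \<open>s\<close> and \<open>j\<close>
  interchanges the second and the last sum of \<open>DA\<close> and fixes the other two, by the
  symmetry of partial derivatives.\<close>

lemma DA_sym: "DA f a s x $ i $ j = DA f a j x $ i $ s"
  by (simp add: DA_def f3_commute23[OF f, of a _ j s] f2_commute[OF f, of _ j s] mult.commute)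

lemma pd_Aop:
  "pd s (\<lambda>y. Aop f a y $ i $ j) x = DA f a s x $ i $ j + (\<Sigma> c. shape_grad f a c x s * Aop f c x $ i $ j)
     + (\<Sigma> p. Aop f a x $ i $ p * Bm f s x $ p $ j) - (\<Sigma> p. Bm f s x $ i $ p * Aop f a x $ p $ j)"
proof -
  let ?F = "\<lambda>c p. Aop f c x $ i $ s * (f2 f a j p x * gradf f c x $ p) + gradf f c x $ i * (Aop f c x $ p $ s * f2 f a p j x)"
  have 1: "pd s (\<lambda>y. Aop f a y $ i $ j) x
     = (\<Sigma> p. gi f x $ i $ p * f3 f a p j s x)
       - (\<Sigma> p c. ?F c p)"
    unfolding Aop_nth[of f a]
    by (subst pd_sum, intro C1_fun_differentiable C1_intros f)
       (simp add: pd_mult pd_gi C1_fun_differentiable C1_intros f f3_def sum.distrib sum_distrib_right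
         sum_distrib_left sum_negf sum_subtractf algebra_simps f2_commute[OF f, of a j])
  have P: "(\<Sigma> p. Aop f c x $ p $ s * f2 f a p j x) = (\<Sigma> q. f2 f c q s x * Aop f a x $ q $ j)" for c
  proof -
    have "(\<Sigma> p. Aop f c x $ p $ s * f2 f a p j x) = (\<Sigma> p q. f2 f c q s x * (gi f x $ q $ p * f2 f a p j x))"
      unfolding Aop_nth sum_distrib_right
      by (intro sum.cong refl) (use gi_sym[of f x] in \<open>simp add: mult_ac\<close>)
    also have "\<dots> = (\<Sigma> q p. f2 f c q s x * (gi f x $ q $ p * f2 f a p j x))" by (rule sum.swap)
    finally show ?thesis by (simp add: Aop_nth sum_distrib_left)
  qed
  have "(\<Sigma> p c. ?F c p)
     = (\<Sigma> c p. ?F c p)"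
    by (rule sum.swap)
  also have "\<dots> = (\<Sigma> c. Aop f c x $ i $ s * shape_grad f a c x j)
      + (\<Sigma> c. gradf f c x $ i * (\<Sigma> q. f2 f c q s x * Aop f a x $ q $ j))"
    unfolding P[symmetric] by (simp add: sum.distrib shape_grad_def sum_distrib_left)
  also have "(\<Sigma> c. gradf f c x $ i * (\<Sigma> q. f2 f c q s x * Aop f a x $ q $ j))
     = (\<Sigma> q. Bm f s x $ i $ q * Aop f a x $ q $ j)"
    unfolding Bm_def vec_lambda_beta sum_distrib_left sum_distrib_right
    by (subst sum.swap) (simp add: mult_ac)
  finally have 2: "(\<Sigma> p c. ?F c p)
     = (\<Sigma> c. Aop f c x $ i $ s * shape_grad f a c x j) + (\<Sigma> q. Bm f s x $ i $ q * Aop f a x $ q $ j)" .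
  have 3: "(\<Sigma> c. (\<Sigma> p. Aop f a x $ i $ p * gradf f c x $ p) * f2 f c j s x) = (\<Sigma> p. Aop f a x $ i $ p * Bm f s x $ p $ j)"
    unfolding Bm_def vec_lambda_beta sum_distrib_left sum_distrib_right
    by (subst sum.swap) (simp add: mult_ac)
  show ?thesis unfolding 1 2 by (simp add: DA_def 3)
qed

text \<open>\<open>cov2\<close> accounts for the tangential connection only, so the normal
  connection appears as an additional summand. In \<open>cov4_Q2\<close> it cancels against the
  derivative of \<open>Ui\<close>.\<close>

lemma cov2_Aop:
  "cov2 f s x (\<lambda>y i j. Aop f a y $ i $ j) (\<lambda>i j. (DA f a s x + (\<Sigma> c. shape_grad f a c x s *\<^sub>R Aop f c x)) $ i $ j)"
  by (simp add: cov2_def pd_Aop C1_fun_differentiable C1_intros f)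

lemma Qtot_antisym12: "Qtot f lam x j i k l = - Qtot f lam x i j k l"
proof -
  have "Q2 f x i j k l = (\<Sigma> a b. Ui f x $ a $ b * (- Qm (Aop f a x) (Aop f b x) j i k l))"
    unfolding Q2_def by (rule sum_Ui_cong_sym) (use Qm_antisym in auto)
  then show ?thesis by (simp add: Qtot_def Q2_def sum_negf)
qed

lemma Qtot_antisym34: "Qtot f lam x i j l k = - Qtot f lam x i j k l"
  by (simp add: Qtot_def Q2_def Qm_def right_diff_distrib sum_subtractf)

text \<open>The inverse \<open>U\<^bsup>ab\<^esup>\<close> is parallel for the normal connection.\<close>
lemma pd_Ui_parallel:
  fixes X :: "'m \<Rightarrow> 'm \<Rightarrow> real"
  shows "(\<Sigma> a b. pd s (\<lambda>y. Ui f y $ a $ b) x * X a b + Ui f x $ a $ b *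
     ((\<Sigma> c. shape_grad f a c x s * X c b) + (\<Sigma> c. shape_grad f b c x s * X a c))) = 0"
proof -
  have 1: "(\<Sigma> a b c. Ui f x $ c $ a * shape_grad f c b x s * X a b)
      = (\<Sigma> a b c. Ui f x $ a $ b * (shape_grad f b c x s * X a c))"
  proof (rule sum.cong[OF refl])
    fix a
    show "(\<Sigma> b c. Ui f x $ c $ a * shape_grad f c b x s * X a b)
      = (\<Sigma> b c. Ui f x $ a $ b * (shape_grad f b c x s * X a c))"
      by (subst sum.swap) (simp add: Ui_sym[of f x _ a] mult.assoc)
  qed
  have 2: "(\<Sigma> a b c. Ui f x $ c $ b * shape_grad f c a x s * X a b)
      = (\<Sigma> a b c. Ui f x $ a $ b * (shape_grad f a c x s * X c b))"
  proof -
    have "(\<Sigma> a b c. Ui f x $ c $ b * shape_grad f c a x s * X a b)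
      = (\<Sigma> b a c. Ui f x $ c $ b * shape_grad f c a x s * X a b)" by (rule sum.swap)
    also have "\<dots> = (\<Sigma> b c a. Ui f x $ c $ b * shape_grad f c a x s * X a b)"
      by (rule sum.cong[OF refl], rule sum.swap)
    also have "\<dots> = (\<Sigma> c b a. Ui f x $ c $ b * shape_grad f c a x s * X a b)" by (rule sum.swap)
    finally show ?thesis by (simp add: mult.assoc)
  qed
  have "(\<Sigma> a b. pd s (\<lambda>y. Ui f y $ a $ b) x * X a b)
     = - (\<Sigma> a b c. Ui f x $ c $ a * shape_grad f c b x s * X a b)
       - (\<Sigma> a b c. Ui f x $ c $ b * shape_grad f c a x s * X a b)"
    by (simp add: pd_Ui[OF f] sum_distrib_right distrib_right left_diff_distrib sum.distrib sum_negf sum_subtractf)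
  then show ?thesis unfolding 1 2
    by (simp add: sum.distrib distrib_left sum_distrib_left)
qed

text \<open>The product rule also produces derivatives of \<open>Ui\<close> and connection forms
  from \<open>cov2_Aop\<close>; together they vanish by \<open>pd_Ui_parallel\<close>, which leaves
  \<open>DA\<close> alone.\<close>

lemma cov4_Q2:
  "cov4 f s x (Q2 f) (\<lambda>i j k l. \<Sigma> a b. Ui f x $ a $ b *
     (Qm (DA f a s x) (Aop f b x) i j k l + Qm (Aop f a x) (DA f b s x) i j k l))"
proof -
  let ?A' = "\<lambda>a. DA f a s x + (\<Sigma> c. shape_grad f a c x s *\<^sub>R Aop f c x)"
  have dU: "(\<lambda>y. Ui f y $ a $ b) differentiable (at x)" for a b
    by (intro C1_fun_differentiable C1_intros f)
  have *: "cov4 f s x (Q2 f) (\<lambda>i j k l. \<Sigma> a b. pd s (\<lambda>y. Ui f y $ a $ b) x * Qm (Aop f a x) (Aop f b x) i j k l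
      + Ui f x $ a $ b * (Qm (?A' a) (Aop f b x) i j k l + Qm (Aop f a x) (?A' b) i j k l))"
    unfolding Q2_def[abs_def] by (intro cov4_sum cov4_scalar[OF dU] cov4_Qm cov2_Aop)
  show ?thesis
  proof (rule cov4_cong[OF *])
    fix i j k l
    show "(\<Sigma> a b. pd s (\<lambda>y. Ui f y $ a $ b) x * Qm (Aop f a x) (Aop f b x) i j k l
      + Ui f x $ a $ b * (Qm (?A' a) (Aop f b x) i j k l + Qm (Aop f a x) (?A' b) i j k l))
      = (\<Sigma> a b. Ui f x $ a $ b * (Qm (DA f a s x) (Aop f b x) i j k l + Qm (Aop f a x) (DA f b s x) i j k l))"
      using pd_Ui_parallel[of s x "\<lambda>a b. Qm (Aop f a x) (Aop f b x) i j k l"]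
      by (simp add: Qm_linear Qm_sum sum.distrib distrib_left)
  qed
qed

text \<open>The symmetry of \<open>Ui\<close> allows \<open>a\<close> and \<open>b\<close> to be
  exchanged in the second summand. Then each pair \<open>a\<close>, \<open>b\<close> vanishes on its
  own by \<open>Qm_divergence_free\<close>, applied with the derivative of one shape operator and
  the other as \<open>A\<close>.\<close>

lemma Q2_divergence_free:
  "(\<Sigma> i a b. Ui f x $ a $ b *
     (Qm (DA f a i x) (Aop f b x) i j k l + Qm (Aop f a x) (DA f b i x) i j k l)) = 0"
proof -
  let ?G = "\<lambda>i a b. Ui f x $ a $ b * (Qm (DA f a i x) (Aop f b x) i j k l + Qm (Aop f a x) (DA f b i x) i j k l)"
  let ?F = "\<lambda>i a b. Ui f x $ a $ b * (Qm (DA f a i x) (Aop f b x) i j k l + Qm (Aop f b x) (DA f a i x) i j k l)"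
  have "(\<Sigma> a b. ?G i a b)
    = (\<Sigma> a b. ?F i a b)" for i
    by (rule sum_Ui_cong_sym) simp
  then have "(\<Sigma> i a b. ?G i a b)
    = (\<Sigma> i a b. ?F i a b)"
    by simp
  also have "\<dots> = (\<Sigma> a i b. ?F i a b)"
    by (rule sum.swap)
  also have "\<dots> = (\<Sigma> a b i. ?F i a b)"
    by (rule sum.cong[OF refl], rule sum.swap)
  also have "\<dots> = 0"
  proof -
    have "(\<Sigma> i. Qm (DA f a i x) (Aop f b x) i j k l + Qm (Aop f b x) (DA f a i x) i j k l) = 0" for a b
      by (rule Qm_divergence_free[of "\<lambda>i. DA f a i x"]) (rule DA_sym)
    then show ?thesis by (simp only: sum_distrib_left[symmetric] mult_zero_right sum.neutral_const)
  qed
  finally show ?thesis .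
qed

lemma cov4_Qtot:
  obtains N where "\<And>s. cov4 f s x (Qtot f lam) (N s)" "\<And>j k l. (\<Sigma> i. N i i j k l) = 0"
proof
  let ?N = "\<lambda>s i j k l. \<Sigma> a b. Ui f x $ a $ b *
     (Qm (DA f a s x) (Aop f b x) i j k l + Qm (Aop f a x) (DA f b s x) i j k l)"
  note kk = cov4_mult[OF cov2_kd cov2_kd]
  have d: "(\<lambda>y. c) differentiable (at x)" for c :: real by simp
  show "cov4 f s x (Qtot f lam) (\<lambda>i j k l. lam * ?N s i j k l)" for s
    unfolding Qtot_def[abs_def]
    by (rule cov4_cong[OF cov4_add[OF cov4_scalar[OF d cov4_diff[OF kk cov4_swap[OF kk]]] cov4_scalar[OF d cov4_Q2]]])
       simp
  show "(\<Sigma> i. lam * ?N i i j k l) = 0" for j k l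
    using Q2_divergence_free[of x j k l] by (simp only: sum_distrib_left[symmetric] mult_zero_right)
qed

lemma C1_Qtot [C1_intros]: "C1_fun (\<lambda>x. Qtot f lam x i j k l)"
  unfolding Qtot_def Q2_def Qm_def Em_def Sm_def trace_def by (intro C1_intros f)

end


subsection \<open>The divergence of the flux density\<close>

lemma sum3_swap13:
  fixes F :: "'a \<Rightarrow> 'b \<Rightarrow> 'a \<Rightarrow> real"
  shows "(\<Sum>p\<in>A. \<Sum>q\<in>B. \<Sum>r\<in>A. F p q r) = (\<Sum>p\<in>A. \<Sum>q\<in>B. \<Sum>r\<in>A. F r q p)"
proof -
  have "(\<Sum>p\<in>A. \<Sum>q\<in>B. \<Sum>r\<in>A. F p q r) = (\<Sum>q\<in>B. \<Sum>p\<in>A. \<Sum>r\<in>A. F p q r)" by (rule sum.swap)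
  also have "\<dots> = (\<Sum>q\<in>B. \<Sum>r\<in>A. \<Sum>p\<in>A. F p q r)" by (rule sum.cong[OF refl], rule sum.swap)
  also have "\<dots> = (\<Sum>r\<in>A. \<Sum>q\<in>B. \<Sum>p\<in>A. F p q r)" by (rule sum.swap)
  finally show ?thesis .
qed

lemma sum4_swap14:
  fixes F :: "'a \<Rightarrow> 'b \<Rightarrow> 'c \<Rightarrow> 'a \<Rightarrow> real"
  shows "(\<Sum>j\<in>A. \<Sum>p\<in>B. \<Sum>q\<in>C. \<Sum>r\<in>A. F j p q r) = (\<Sum>j\<in>A. \<Sum>p\<in>B. \<Sum>q\<in>C. \<Sum>r\<in>A. F r p q j)"
proof -
  have "(\<Sum>j\<in>A. \<Sum>p\<in>B. \<Sum>q\<in>C. \<Sum>r\<in>A. F j p q r) = (\<Sum>p\<in>B. \<Sum>j\<in>A. \<Sum>q\<in>C. \<Sum>r\<in>A. F j p q r)" by (rule sum.swap)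
  also have "\<dots> = (\<Sum>p\<in>B. \<Sum>j\<in>A. \<Sum>q\<in>C. \<Sum>r\<in>A. F r p q j)" by (rule sum.cong[OF refl], rule sum3_swap13)
  also have "\<dots> = (\<Sum>j\<in>A. \<Sum>p\<in>B. \<Sum>q\<in>C. \<Sum>r\<in>A. F r p q j)" by (rule sum.swap)
  finally show ?thesis .
qed

lemma sum4_first_last:
  fixes F :: "'a \<Rightarrow> 'b \<Rightarrow> 'c \<Rightarrow> 'd \<Rightarrow> real"
  shows "(\<Sum>i\<in>A. \<Sum>j\<in>B. \<Sum>p\<in>C. \<Sum>q\<in>D. F i j p q) = (\<Sum>j\<in>B. \<Sum>p\<in>C. \<Sum>q\<in>D. \<Sum>i\<in>A. F i j p q)"
proof -
  have "(\<Sum>i\<in>A. \<Sum>j\<in>B. \<Sum>p\<in>C. \<Sum>q\<in>D. F i j p q) = (\<Sum>j\<in>B. \<Sum>i\<in>A. \<Sum>p\<in>C. \<Sum>q\<in>D. F i j p q)" by (rule sum.swap)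
  also have "\<dots> = (\<Sum>j\<in>B. \<Sum>p\<in>C. \<Sum>i\<in>A. \<Sum>q\<in>D. F i j p q)" by (rule sum.cong[OF refl], rule sum.swap)
  also have "\<dots> = (\<Sum>j\<in>B. \<Sum>p\<in>C. \<Sum>q\<in>D. \<Sum>i\<in>A. F i j p q)"
    by (rule sum.cong[OF refl], rule sum.cong[OF refl], rule sum.swap)
  finally show ?thesis .
qed

lemma sum3_rotate:
  fixes F :: "_ \<Rightarrow> _ \<Rightarrow> _ \<Rightarrow> real"
  shows "(\<Sum>k\<in>K. \<Sum>l\<in>L. \<Sum>a\<in>A. F k l a) = (\<Sum>a\<in>A. \<Sum>k\<in>K. \<Sum>l\<in>L. F k l a)"
  by (subst (2) sum.swap) (rule sum.cong[OF refl], rule sum.swap)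

text \<open>The connection terms at the three contracted indices cancel in pairs after renaming
  summation indices. Only the term at the free index \<open>i\<close> survives.\<close>

lemma contraction_Leibniz:
  fixes Q :: "'n::finite \<Rightarrow> 'n \<Rightarrow> 'n \<Rightarrow> 'n \<Rightarrow> real" and B :: "'n \<Rightarrow> 'n \<Rightarrow> real" and K M :: "'n \<Rightarrow> 'n \<Rightarrow> 'n \<Rightarrow> real"
  shows "(\<Sigma> j p q. (N i j p q + (\<Sigma> r. Q i j r q * B r p) + (\<Sigma> r. Q i j p r * B r q)
         - (\<Sigma> r. B i r * Q r j p q) - (\<Sigma> r. B j r * Q i r p q)) * K p q j
      + Q i j p q * (M p q j - (\<Sigma> r. B p r * K r q j) - (\<Sigma> r. B q r * K p r j) + (\<Sigma> r. K p q r * B r j)))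
    = (\<Sigma> j p q. N i j p q * K p q j) + (\<Sigma> j p q. Q i j p q * M p q j)
      - (\<Sigma> r. B i r * (\<Sigma> j p q. Q r j p q * K p q j))"
proof -
  have 1: "(\<Sigma> j p q r. Q i j r q * B r p * K p q j)
     = (\<Sigma> j p q r. Q i j p q * (B p r * K r q j))"
    by (rule sum.cong[OF refl], subst sum3_swap13) (simp add: mult.assoc)
  have 2: "(\<Sigma> j p q r. Q i j p r * B r q * K p q j)
     = (\<Sigma> j p q r. Q i j p q * (B q r * K p r j))"
    by (rule sum.cong[OF refl], rule sum.cong[OF refl], subst sum.swap) (simp add: mult.assoc)
  have 3: "(\<Sigma> j p q r. B j r * Q i r p q * K p q j)
     = (\<Sigma> j p q r. Q i j p q * (K p q r * B r j))"
    by (subst sum4_swap14) (simp add: mult_ac)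
  have 4: "(\<Sigma> j p q r. B i r * Q r j p q * K p q j)
      = (\<Sigma> r. B i r * (\<Sigma> j p q. Q r j p q * K p q j))"
    by (subst sum4_first_last[symmetric]) (simp add: sum_distrib_left mult.assoc)
  show ?thesis
    unfolding 4[symmetric]
    unfolding distrib_right distrib_left left_diff_distrib right_diff_distrib sum.distrib sum_subtractf
      sum_distrib_right sum_distrib_left 1 2 3
    by simp
qed

lemma sum_antisym_eq_0:
  fixes F :: "'a \<Rightarrow> 'a \<Rightarrow> real"
  assumes "\<And>i j. F j i = - F i j"
  shows "(\<Sum>i\<in>A. \<Sum>j\<in>A. F i j) = 0"
proof -
  have "(\<Sum>i\<in>A. \<Sum>j\<in>A. F i j) = (\<Sum>j\<in>A. \<Sum>i\<in>A. F i j)" by (rule sum.swap)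
  also have "\<dots> = - (\<Sum>j\<in>A. \<Sum>i\<in>A. F j i)" by (simp add: assms[symmetric] flip: sum_negf)
  finally show ?thesis by simp
qed

definition Kt :: "(real^'n::finite \<Rightarrow> real^'m::finite) \<Rightarrow> real^'n \<Rightarrow> 'n \<Rightarrow> 'n \<Rightarrow> 'n \<Rightarrow> real" where
  "Kt f x p q j = (\<Sigma> a. gradf f a x $ p * Aop f a x $ q $ j)"

text \<open>The flux density in mixed components: upper indices of \<open>Kt\<close> meet lower ones
  of \<open>Qtot\<close> and conversely, so no metric factor intervenes. The identification with the
  original density is \<open>flux_eq_Vfield\<close>.\<close>

definition Vfield :: "(real^'n::finite \<Rightarrow> real^'m::finite) \<Rightarrow> real \<Rightarrow> 'n \<Rightarrow> real^'n \<Rightarrow> real" where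
  "Vfield f lam i x = (\<Sigma> j p q. Qtot f lam x i j p q * Kt f x p q j)"

context
  fixes f :: "real^'n::finite \<Rightarrow> real^'m::finite"
  assumes f: "smooth_map f"
begin

lemma C1_Kt: "C1_fun (\<lambda>x. Kt f x p q j)"
  unfolding Kt_def by (intro C1_intros f)

lemma C1_Vfield: "C1_fun (Vfield f lam i)"
  unfolding Vfield_def[abs_def] by (intro C1_intros C1_Kt C1_Qtot f)

lemma pd_gradf_Bm:
  "pd s (\<lambda>y. gradf f a y $ p) x = (\<Sigma> c. Ui f x $ c $ a * Aop f c x $ p $ s) - (\<Sigma> r. Bm f s x $ p $ r * gradf f a x $ r)"
proof -
  have "(\<Sigma> r. Bm f s x $ p $ r * gradf f a x $ r) = (\<Sigma> r c. gradf f c x $ p * (f2 f c s r x * gradf f a x $ r))"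
    by (simp add: Bm_def sum_distrib_right mult.assoc f2_commute[OF f, of _ s])
  also have "\<dots> = (\<Sigma> c r. gradf f c x $ p * (f2 f c s r x * gradf f a x $ r))" by (rule sum.swap)
  finally show ?thesis by (simp add: pd_gradf[OF f] sum_subtractf shape_grad_def sum_distrib_left)
qed

lemma pd_Kt:
  "pd s (\<lambda>y. Kt f y p q j) x
    = (\<Sigma> a. (\<Sigma> c. Ui f x $ c $ a * Aop f c x $ p $ s) * Aop f a x $ q $ j
         + gradf f a x $ p * (DA f a s x $ q $ j + (\<Sigma> c. shape_grad f a c x s * Aop f c x $ q $ j)))
      - (\<Sigma> r. Bm f s x $ p $ r * Kt f x r q j) - (\<Sigma> r. Bm f s x $ q $ r * Kt f x p r j) + (\<Sigma> r. Kt f x p q r * Bm f s x $ r $ j)"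
proof -
  have 1: "(\<Sigma> a r. Bm f s x $ p $ r * gradf f a x $ r * Aop f a x $ q $ j) = (\<Sigma> r. Bm f s x $ p $ r * Kt f x r q j)"
    unfolding Kt_def sum_distrib_left by (subst sum.swap) (simp add: mult_ac)
  have 2: "(\<Sigma> a r. gradf f a x $ p * (Bm f s x $ q $ r * Aop f a x $ r $ j)) = (\<Sigma> r. Bm f s x $ q $ r * Kt f x p r j)"
    unfolding Kt_def sum_distrib_left by (subst sum.swap) (simp add: mult_ac)
  have 3: "(\<Sigma> a r. gradf f a x $ p * (Aop f a x $ q $ r * Bm f s x $ r $ j)) = (\<Sigma> r. Kt f x p q r * Bm f s x $ r $ j)"
    unfolding Kt_def sum_distrib_right by (subst sum.swap) (simp add: mult_ac)
  have "pd s (\<lambda>y. Kt f y p q j) x = (\<Sigma> a. ((\<Sigma> c. Ui f x $ c $ a * Aop f c x $ p $ s) - (\<Sigma> r. Bm f s x $ p $ r * gradf f a x $ r)) * Aop f a x $ q $ j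
     + gradf f a x $ p * (DA f a s x $ q $ j + (\<Sigma> c. shape_grad f a c x s * Aop f c x $ q $ j)
       + (\<Sigma> r. Aop f a x $ q $ r * Bm f s x $ r $ j) - (\<Sigma> r. Bm f s x $ q $ r * Aop f a x $ r $ j)))"
    unfolding Kt_def
    by (subst pd_sum, intro C1_fun_differentiable C1_intros f)
       (simp add: pd_mult C1_fun_differentiable C1_intros f pd_gradf_Bm pd_Aop[OF f])
  also have "\<dots> = (\<Sigma> a. (\<Sigma> c. Ui f x $ c $ a * Aop f c x $ p $ s) * Aop f a x $ q $ j
         + gradf f a x $ p * (DA f a s x $ q $ j + (\<Sigma> c. shape_grad f a c x s * Aop f c x $ q $ j)))
      - (\<Sigma> a r. Bm f s x $ p $ r * gradf f a x $ r * Aop f a x $ q $ j)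
      - (\<Sigma> a r. gradf f a x $ p * (Bm f s x $ q $ r * Aop f a x $ r $ j))
      + (\<Sigma> a r. gradf f a x $ p * (Aop f a x $ q $ r * Bm f s x $ r $ j))"
    by (simp add: sum.distrib sum_subtractf algebra_simps sum_distrib_left sum_distrib_right)
  finally show ?thesis unfolding 1 2 3 .
qed

text \<open>Third derivatives disappear twice: \<open>N\<close> is divergence-free, and the
  \<open>DA\<close> term, symmetric in \<open>i\<close> and \<open>j\<close> by Codazzi, meets the
  antisymmetric \<open>Qtot\<close>. The term with \<open>shape_grad f c c x i\<close> is the
  Christoffel trace left over because the divergence is Euclidean.\<close>

lemma div_Vfield:
  "(\<Sigma> i. pd i (Vfield f lam i) x) = (\<Sigma> i j p q. Qtot f lam x i j p q *
     ((\<Sigma> a c. Ui f x $ c $ a * Aop f c x $ p $ i * Aop f a x $ q $ j)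
      + (\<Sigma> a c. gradf f a x $ p * (shape_grad f a c x i * Aop f c x $ q $ j - shape_grad f c c x i * Aop f a x $ q $ j))))"
proof -
  obtain N where N: "\<And>s. cov4 f s x (Qtot f lam) (N s)" and N0: "\<And>j k l. (\<Sigma> i. N i i j k l) = 0"
    using cov4_Qtot[OF f] by blast
  let ?Q = "Qtot f lam x"
  let ?U = "\<lambda>i p q j. \<Sigma> a c. Ui f x $ c $ a * Aop f c x $ p $ i * Aop f a x $ q $ j"
  let ?D = "\<lambda>i p q j. \<Sigma> a. gradf f a x $ p * DA f a i x $ q $ j"
  let ?W = "\<lambda>i p q j. \<Sigma> a c. gradf f a x $ p * (shape_grad f a c x i * Aop f c x $ q $ j)"
  let ?w = "\<lambda>r. \<Sigma> c. shape_grad f c c x r"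
  let ?M = "\<lambda>i p q j. ?U i p q j + ?D i p q j + ?W i p q j"
  have dQ: "(\<lambda>y. Qtot f lam y i j p q) differentiable (at x)" for i j p q
    by (intro C1_fun_differentiable C1_Qtot f)
  have dK: "(\<lambda>y. Kt f y p q j) differentiable (at x)" for p q j
    by (intro C1_fun_differentiable C1_Kt f)
  have pK: "pd s (\<lambda>y. Kt f y p q j) x = ?M s p q j
      - (\<Sigma> r. Bm f s x $ p $ r * Kt f x r q j) - (\<Sigma> r. Bm f s x $ q $ r * Kt f x p r j) + (\<Sigma> r. Kt f x p q r * Bm f s x $ r $ j)" for s p q j
    unfolding pd_Kt by (simp add: sum.distrib distrib_left sum_distrib_left sum_distrib_right)
  have "pd i (Vfield f lam i) x = (\<Sigma> j p q. N i i j p q * Kt f x p q j)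
      + (\<Sigma> j p q. ?Q i j p q * ?M i p q j) - (\<Sigma> r. Bm f i x $ i $ r * Vfield f lam r x)" for i
  proof -
    have "pd i (Vfield f lam i) x = (\<Sigma> j p q. pd i (\<lambda>y. Qtot f lam y i j p q) x * Kt f x p q j + ?Q i j p q * pd i (\<lambda>y. Kt f y p q j) x)"
      unfolding Vfield_def[abs_def]
      by (simp add: pd_sum pd_mult differentiable_sum_fun dQ dK)
    also have "\<dots> = (\<Sigma> j p q. N i i j p q * Kt f x p q j)
      + (\<Sigma> j p q. ?Q i j p q * ?M i p q j) - (\<Sigma> r. Bm f i x $ i $ r * Vfield f lam r x)"
      unfolding Vfield_def cov4D(2)[OF N] pK by (rule contraction_Leibniz)
    finally show ?thesis .
  qed
  then have "(\<Sigma> i. pd i (Vfield f lam i) x)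
     = (\<Sigma> i j p q. N i i j p q * Kt f x p q j)
      + (\<Sigma> i j p q. ?Q i j p q * ?M i p q j)
      - (\<Sigma> i r. Bm f i x $ i $ r * Vfield f lam r x)"
    by (simp only: sum.distrib sum_subtractf)
  also have "(\<Sigma> i j p q. N i i j p q * Kt f x p q j) = 0"
    by (subst sum4_first_last) (simp add: N0 flip: sum_distrib_right)
  also have "(\<Sigma> i r. Bm f i x $ i $ r * Vfield f lam r x) = (\<Sigma> r. ?w r * Vfield f lam r x)"
  proof -
    have "(\<Sigma> i. Bm f i x $ i $ r) = ?w r" for r
      unfolding Bm_def vec_lambda_beta shape_grad_def by (subst sum.swap) (simp add: mult.commute)
    then show ?thesis by (subst sum.swap) (simp flip: sum_distrib_right)
  qed
  also have "\<dots> = (\<Sigma> i j p q. ?Q i j p q * (?w i * Kt f x p q j))"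
    by (simp add: Vfield_def sum_distrib_left mult_ac)
  also have "(\<Sigma> i j p q. ?Q i j p q * ?M i p q j)
     = (\<Sigma> i j p q. ?Q i j p q * (?U i p q j + ?W i p q j))
      + (\<Sigma> i j p q. ?Q i j p q * ?D i p q j)"
    by (simp only: distrib_left sum.distrib)
  also have "(\<Sigma> i j p q. ?Q i j p q * ?D i p q j) = 0"
  proof (rule sum_antisym_eq_0)
    fix i j
    have D: "?D j p q i = ?D i p q j" for p q
      by (rule sum.cong[OF refl], subst DA_sym[OF f]) (rule refl)
    have Q: "?Q j i p q = - ?Q i j p q" for p q by (rule Qtot_antisym12[OF f])
    show "(\<Sigma> p q. ?Q j i p q * ?D j p q i) = - (\<Sigma> p q. ?Q i j p q * ?D i p q j)"
      by (simp only: Q D mult_minus_left sum_negf)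
  qed
  finally have *: "(\<Sigma> i. pd i (Vfield f lam i) x) =
      0 + ((\<Sigma> i j p q. ?Q i j p q * (?U i p q j + ?W i p q j)) + 0)
      - (\<Sigma> i j p q. ?Q i j p q * (?w i * Kt f x p q j))" .
  have wK: "?w i * Kt f x p q j
      = (\<Sigma> a c. gradf f a x $ p * (shape_grad f c c x i * Aop f a x $ q $ j))" for i p q j
    unfolding Kt_def sum_product by (subst sum.swap) (simp add: mult_ac)
  show ?thesis
    unfolding * wK
    by (simp add: right_diff_distrib sum_subtractf distrib_left sum.distrib sum_distrib_left mult_ac)
qed

end


section \<open>From mixed components to the curvature tensor and its traces\<close>

lemma sum4_product:
  fixes F G :: "_ \<Rightarrow> _ \<Rightarrow> real"
  shows "(\<Sum>a\<in>I. \<Sum>b\<in>J. \<Sum>c\<in>K. \<Sum>d\<in>L. F a c * G b d) = (\<Sum>a\<in>I. \<Sum>c\<in>K. F a c) * (\<Sum>b\<in>J. \<Sum>d\<in>L. G b d)"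
  unfolding sum_product ..

lemma sum4_product':
  fixes F G :: "_ \<Rightarrow> _ \<Rightarrow> real"
  shows "(\<Sum>a\<in>I. \<Sum>b\<in>J. \<Sum>c\<in>K. \<Sum>d\<in>L. F a d * G b c) = (\<Sum>a\<in>I. \<Sum>d\<in>L. F a d) * (\<Sum>b\<in>J. \<Sum>c\<in>K. G b c)"
  unfolding sum4_product[symmetric]
  by (rule sum.cong[OF refl], rule sum.cong[OF refl], rule sum.swap)

lemma sum4_product_diff:
  fixes F G F' G' :: "_ \<Rightarrow> _ \<Rightarrow> real"
  shows "(\<Sum>a\<in>I. \<Sum>b\<in>J. \<Sum>c\<in>K. \<Sum>d\<in>K. u * (F a c * G b d - F' a d * G' b c))
    = u * ((\<Sum>a\<in>I. \<Sum>c\<in>K. F a c) * (\<Sum>b\<in>J. \<Sum>d\<in>K. G b d) - (\<Sum>a\<in>I. \<Sum>d\<in>K. F' a d) * (\<Sum>b\<in>J. \<Sum>c\<in>K. G' b c))"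
proof -
  have "u * ((\<Sum>a\<in>I. \<Sum>c\<in>K. F a c) * (\<Sum>b\<in>J. \<Sum>d\<in>K. G b d) - (\<Sum>a\<in>I. \<Sum>d\<in>K. F' a d) * (\<Sum>b\<in>J. \<Sum>c\<in>K. G' b c))
    = u * ((\<Sum>a\<in>I. \<Sum>b\<in>J. \<Sum>c\<in>K. \<Sum>d\<in>K. F a c * G b d) - (\<Sum>a\<in>I. \<Sum>b\<in>J. \<Sum>c\<in>K. \<Sum>d\<in>K. F' a d * G' b c))"
    by (simp only: sum4_product sum4_product')
  then show ?thesis by (simp only: sum_subtractf[symmetric] sum_distrib_left)
qed

lemma sum2_sum2_swap:
  fixes F :: "_ \<Rightarrow> _ \<Rightarrow> _ \<Rightarrow> _ \<Rightarrow> real"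
  shows "(\<Sum>i\<in>I. \<Sum>k\<in>K. \<Sum>a\<in>A. \<Sum>b\<in>B. F i k a b) = (\<Sum>a\<in>A. \<Sum>b\<in>B. \<Sum>i\<in>I. \<Sum>k\<in>K. F i k a b)"
proof -
  have "(\<Sum>i\<in>I. \<Sum>k\<in>K. \<Sum>a\<in>A. \<Sum>b\<in>B. F i k a b) = (\<Sum>k\<in>K. \<Sum>a\<in>A. \<Sum>b\<in>B. \<Sum>i\<in>I. F i k a b)"
    by (rule sum4_first_last)
  also have "\<dots> = (\<Sum>a\<in>A. \<Sum>b\<in>B. \<Sum>i\<in>I. \<Sum>k\<in>K. F i k a b)"
    by (rule sum4_first_last)
  finally show ?thesis .
qed

lemma contract_gi_kl:
  fixes \<gamma> :: "'n::finite \<Rightarrow> 'n \<Rightarrow> real"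
  shows "(\<Sigma> i j k l. (\<Sigma> p q. Q i j p q * \<gamma> p k * \<gamma> q l) * R i j k l)
     = (\<Sigma> i j p q. Q i j p q * (\<Sigma> k l. \<gamma> p k * \<gamma> q l * R i j k l))"
proof (rule sum.cong[OF refl], rule sum.cong[OF refl])
  fix i j
  have "(\<Sigma> k l p q. Q i j p q * \<gamma> p k * \<gamma> q l * R i j k l)
      = (\<Sigma> p q k l. Q i j p q * \<gamma> p k * \<gamma> q l * R i j k l)"
    by (rule sum2_sum2_swap)
  then show "(\<Sigma> k l. (\<Sigma> p q. Q i j p q * \<gamma> p k * \<gamma> q l) * R i j k l)
     = (\<Sigma> p q. Q i j p q * (\<Sigma> k l. \<gamma> p k * \<gamma> q l * R i j k l))"
    by (simp add: sum_distrib_left sum_distrib_right mult_ac)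
qed

text \<open>By \<open>gi_Ric\<close> this is the Ricci tensor with its first index raised.\<close>

definition Smix :: "(real^'n::finite \<Rightarrow> real^'m::finite) \<Rightarrow> real^'n \<Rightarrow> 'n \<Rightarrow> 'n \<Rightarrow> real" where
  "Smix f x i j = (\<Sigma> a b. Ui f x $ a $ b * Sm (Aop f a x) (Aop f b x) i j)"

context
  fixes f :: "real^'n::finite \<Rightarrow> real^'m::finite"
  assumes f: "smooth_map f"
begin

lemma Aop_gi: "(\<Sigma> p. Aop f a x $ i $ p * gi f x $ p $ k) = (\<Sigma> r s. gi f x $ i $ r * gi f x $ k $ s * f2 f a r s x)"
proof -
  have "(\<Sigma> p. Aop f a x $ i $ p * gi f x $ p $ k) = (\<Sigma> p r. gi f x $ i $ r * gi f x $ k $ p * f2 f a r p x)"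
    unfolding Aop_nth sum_distrib_right by (simp add: gi_sym[of f x _ k] mult_ac)
  also have "\<dots> = (\<Sigma> r s. gi f x $ i $ r * gi f x $ k $ s * f2 f a r s x)" by (rule sum.swap)
  finally show ?thesis .
qed

lemma Rm_up_eq:
  "Rm_up f i j k l x = (\<Sigma> a b. Ui f x $ a $ b *
     ((\<Sigma> p. Aop f a x $ i $ p * gi f x $ p $ k) * (\<Sigma> q. Aop f b x $ j $ q * gi f x $ q $ l)
     - (\<Sigma> p. Aop f a x $ i $ p * gi f x $ p $ l) * (\<Sigma> q. Aop f b x $ j $ q * gi f x $ q $ k)))"
proof -
  let ?g = "gi f x"
  let ?F = "\<lambda>a b p q r s. Ui f x $ a $ b * ((?g $ i $ p * ?g $ k $ r * f2 f a p r x) * (?g $ j $ q * ?g $ l $ s * f2 f b q s x) - (?g $ i $ p * ?g $ l $ s * f2 f a p s x) * (?g $ j $ q * ?g $ k $ r * f2 f b q r x))"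
  have "Rm_up f i j k l x = (\<Sigma> p q r s a b. ?F a b p q r s)"
    unfolding Rm_up_def Rm_eq[OF f] sum_distrib_left by (simp add: algebra_simps)
  also have "\<dots> = (\<Sigma> p q a b r s. ?F a b p q r s)"
    by (rule sum.cong[OF refl], rule sum.cong[OF refl], rule sum2_sum2_swap)
  also have "\<dots> = (\<Sigma> a b p q r s. ?F a b p q r s)"
    by (rule sum2_sum2_swap)
  also have "\<dots> = (\<Sigma> a b. Ui f x $ a $ b *
     ((\<Sigma> p r. ?g $ i $ p * ?g $ k $ r * f2 f a p r x) * (\<Sigma> q s. ?g $ j $ q * ?g $ l $ s * f2 f b q s x)
     - (\<Sigma> p s. ?g $ i $ p * ?g $ l $ s * f2 f a p s x) * (\<Sigma> q r. ?g $ j $ q * ?g $ k $ r * f2 f b q r x)))"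
    unfolding sum4_product_diff ..
  finally show ?thesis unfolding Aop_gi .
qed

lemma gi_Ric: "(\<Sigma> j. gi f x $ m $ j * Ric f j l x) = Smix f x m l"
proof -
  let ?g = "gi f x"
  have tr: "(\<Sigma> i k. ?g $ i $ k * f2 f a i k x) = trace (Aop f a x)" for a
    by (simp add: trace_def Aop_nth f2_commute[OF f, of _ _ _ x])
  have Ric: "Ric f j l x = (\<Sigma> a b. Ui f x $ a $ b *
      (trace (Aop f a x) * f2 f b j l x - (\<Sigma> k. f2 f b j k x * Aop f a x $ k $ l)))" for j
  proof -
    have "Ric f j l x = (\<Sigma> i k a b. Ui f x $ a $ b *
      (?g $ i $ k * f2 f a i k x * f2 f b j l x - f2 f b j k x * (?g $ k $ i * f2 f a i l x)))"
      unfolding Ric_def Rm_eq[OF f] sum_distrib_left using gi_sym[of f x] by (simp add: algebra_simps)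
    also have "\<dots> = (\<Sigma> a b i k. Ui f x $ a $ b *
      (?g $ i $ k * f2 f a i k x * f2 f b j l x - f2 f b j k x * (?g $ k $ i * f2 f a i l x)))"
      by (rule sum2_sum2_swap)
    also have "\<dots> = (\<Sigma> a b. Ui f x $ a $ b *
      ((\<Sigma> i k. ?g $ i $ k * f2 f a i k x) * f2 f b j l x - (\<Sigma> i k. f2 f b j k x * (?g $ k $ i * f2 f a i l x))))"
      by (simp only: sum_distrib_left[symmetric] sum_distrib_right[symmetric] sum_subtractf)
    also have "\<dots> = (\<Sigma> a b. Ui f x $ a $ b *
      (trace (Aop f a x) * f2 f b j l x - (\<Sigma> k. f2 f b j k x * Aop f a x $ k $ l)))"
      unfolding tr Aop_nth sum_distrib_left by (subst sum.swap) (rule refl)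
    finally show ?thesis .
  qed
  have "(\<Sigma> j. ?g $ m $ j * Ric f j l x) = (\<Sigma> j a b. Ui f x $ a $ b *
      (trace (Aop f a x) * (?g $ m $ j * f2 f b j l x) - (\<Sigma> k. ?g $ m $ j * f2 f b j k x * Aop f a x $ k $ l)))"
    unfolding Ric sum_distrib_left by (simp add: right_diff_distrib sum_distrib_left mult_ac)
  also have "\<dots> = (\<Sigma> a j b. Ui f x $ a $ b *
      (trace (Aop f a x) * (?g $ m $ j * f2 f b j l x) - (\<Sigma> k. ?g $ m $ j * f2 f b j k x * Aop f a x $ k $ l)))" by (rule sum.swap)
  also have "\<dots> = (\<Sigma> a b j. Ui f x $ a $ b *
      (trace (Aop f a x) * (?g $ m $ j * f2 f b j l x) - (\<Sigma> k. ?g $ m $ j * f2 f b j k x * Aop f a x $ k $ l)))"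
    by (rule sum.cong[OF refl], rule sum.swap)
  also have "\<dots> = (\<Sigma> a b. Ui f x $ a $ b *
      (trace (Aop f a x) * Aop f b x $ m $ l - (\<Sigma> j k. ?g $ m $ j * f2 f b j k x * Aop f a x $ k $ l)))"
    by (simp only: sum_distrib_left[symmetric] sum_subtractf Aop_nth)
  also have "\<dots> = (\<Sigma> a b. Ui f x $ a $ b *
      (trace (Aop f a x) * Aop f b x $ m $ l - (\<Sigma> k. Aop f b x $ m $ k * Aop f a x $ k $ l)))"
  proof -
    have "(\<Sigma> j k. ?g $ m $ j * f2 f b j k x * Aop f a x $ k $ l)
       = (\<Sigma> k. Aop f b x $ m $ k * Aop f a x $ k $ l)" for a b
      by (subst sum.swap) (simp only: sum_distrib_right[symmetric] Aop_nth[symmetric])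
    then show ?thesis by (simp only:)
  qed
  \<comment> \<open>The product arose in the order \<open>Aop f b x\<close>,
    \<open>Aop f a x\<close>, opposite to the one in \<open>Sm\<close>; contraction with the
    symmetric \<open>Ui\<close> makes the two agree.\<close>
  also have "\<dots> = Smix f x m l"
    unfolding Smix_def Sm_def by (rule sum_Ui_cong_sym) simp
  finally show ?thesis .
qed

lemma Scal_eq: "Scal f x = (\<Sigma> p. Smix f x p p)"
proof -
  have "Scal f x = (\<Sigma> l j. gi f x $ l $ j * Ric f j l x)"
    unfolding Scal_def by (subst sum.swap) (use gi_sym[of f x] in simp)
  then show ?thesis by (simp add: gi_Ric)
qed

lemma Ric_up_eq: "Ric_up f j k x = (\<Sigma> p. Smix f x j p * gi f x $ p $ k)"
proof -
  have "Ric_up f j k x = (\<Sigma> b. (\<Sigma> a. gi f x $ j $ a * Ric f a b x) * gi f x $ b $ k)"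
    unfolding Ric_up_def sum_distrib_right by (subst sum.swap) (use gi_sym[of f x] in \<open>simp add: mult_ac\<close>)
  then show ?thesis by (simp add: gi_Ric)
qed

lemma Q2_eq:
  "Q2 f x i j k l = (\<Sigma> a b. Ui f x $ a $ b * (Aop f a x $ i $ k * Aop f b x $ j $ l - Aop f a x $ i $ l * Aop f b x $ j $ k))
     - kd i k * Smix f x j l + kd i l * Smix f x j k - Smix f x i k * kd j l + Smix f x i l * kd j k
     + (1/2) * Scal f x * (kd i k * kd j l - kd i l * kd j k)"
proof -
  have "Scal f x = (\<Sigma> a b. Ui f x $ a $ b * (\<Sigma> p. Sm (Aop f a x) (Aop f b x) p p))"
    unfolding Scal_eq Smix_def sum_distrib_left
    by (subst sum.swap) (rule sum.cong[OF refl], rule sum.swap)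
  then show ?thesis
    unfolding Q2_def Qm_def Em_def Smix_def
    by (simp add: algebra_simps sum.distrib sum_subtractf sum_distrib_left sum_distrib_right)
qed

text \<open>Under the double sum over \<open>p\<close> and \<open>q\<close> every product term of
  \<open>Qtot\<close> factorises. A delta turns into an entry of the inverse metric and
  \<open>Smix\<close> into the Ricci tensor with both indices raised.\<close>

lemma P_eq:
  "P1 f i j k l x + lam * P2 f i j k l x = (\<Sigma> p q. Qtot f lam x i j p q * gi f x $ p $ k * gi f x $ q $ l)"
proof -
  let ?F = "\<lambda>a b p q. Ui f x $ a $ b * (Aop f a x $ i $ p * Aop f b x $ j $ q - Aop f a x $ i $ q * Aop f b x $ j $ p)"
  let ?g = "gi f x"
  have kk: "(\<Sigma> p q. (X p * Y q) * ?g $ p $ k * ?g $ q $ l) = (\<Sigma> p. X p * ?g $ p $ k) * (\<Sigma> q. Y q * ?g $ q $ l)" for X Y :: "'n \<Rightarrow> real"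
    unfolding sum_product by (simp add: mult_ac)
  have kk': "(\<Sigma> p q. (X q * Y p) * ?g $ p $ k * ?g $ q $ l) = (\<Sigma> q. X q * ?g $ q $ l) * (\<Sigma> p. Y p * ?g $ p $ k)" for X Y :: "'n \<Rightarrow> real"
    unfolding sum_product by (subst sum.swap) (simp add: mult_ac)
  have AA: "(\<Sigma> p q. (\<Sigma> a b. ?F a b p q) * ?g $ p $ k * ?g $ q $ l)
     = Rm_up f i j k l x"
  proof -
    have "(\<Sigma> p q. (\<Sigma> a b. ?F a b p q) * ?g $ p $ k * ?g $ q $ l)
      = (\<Sigma> p q a b. Ui f x $ a $ b * ((Aop f a x $ i $ p * Aop f b x $ j $ q) * ?g $ p $ k * ?g $ q $ l
          - (Aop f a x $ i $ q * Aop f b x $ j $ p) * ?g $ p $ k * ?g $ q $ l))"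
      unfolding sum_distrib_right by (simp add: algebra_simps)
    also have "\<dots> = (\<Sigma> a b p q. Ui f x $ a $ b * ((Aop f a x $ i $ p * Aop f b x $ j $ q) * ?g $ p $ k * ?g $ q $ l
          - (Aop f a x $ i $ q * Aop f b x $ j $ p) * ?g $ p $ k * ?g $ q $ l))"
      by (rule sum2_sum2_swap)
    also have "\<dots> = Rm_up f i j k l x"
      unfolding sum_distrib_left[symmetric] sum_subtractf kk kk' Rm_up_eq ..
    finally show ?thesis .
  qed
  have "(\<Sigma> p q. Qtot f lam x i j p q * ?g $ p $ k * ?g $ q $ l)
     = (1/2) * ((\<Sigma> p q. (kd i p * kd j q) * ?g $ p $ k * ?g $ q $ l) - (\<Sigma> p q. (kd i q * kd j p) * ?g $ p $ k * ?g $ q $ l))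
      + lam * ((\<Sigma> p q. (\<Sigma> a b. ?F a b p q) * ?g $ p $ k * ?g $ q $ l)
        - (\<Sigma> p q. (kd i p * Smix f x j q) * ?g $ p $ k * ?g $ q $ l)
        + (\<Sigma> p q. (kd i q * Smix f x j p) * ?g $ p $ k * ?g $ q $ l)
        - (\<Sigma> p q. (Smix f x i p * kd j q) * ?g $ p $ k * ?g $ q $ l)
        + (\<Sigma> p q. (Smix f x i q * kd j p) * ?g $ p $ k * ?g $ q $ l)
        + (1/2) * Scal f x * ((\<Sigma> p q. (kd i p * kd j q) * ?g $ p $ k * ?g $ q $ l) - (\<Sigma> p q. (kd i q * kd j p) * ?g $ p $ k * ?g $ q $ l)))"
  proof -
    have "Qtot f lam x i j p q * ?g $ p $ k * ?g $ q $ l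
      = (1/2) * ((kd i p * kd j q) * ?g $ p $ k * ?g $ q $ l - (kd i q * kd j p) * ?g $ p $ k * ?g $ q $ l)
      + lam * ((\<Sigma> a b. ?F a b p q) * ?g $ p $ k * ?g $ q $ l
        - (kd i p * Smix f x j q) * ?g $ p $ k * ?g $ q $ l
        + (kd i q * Smix f x j p) * ?g $ p $ k * ?g $ q $ l
        - (Smix f x i p * kd j q) * ?g $ p $ k * ?g $ q $ l
        + (Smix f x i q * kd j p) * ?g $ p $ k * ?g $ q $ l
        + (1/2) * Scal f x * ((kd i p * kd j q) * ?g $ p $ k * ?g $ q $ l - (kd i q * kd j p) * ?g $ p $ k * ?g $ q $ l))" for p q
      unfolding Qtot_def Q2_eq by (simp only: distrib_right distrib_left left_diff_distrib right_diff_distrib mult.assoc)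
    then show ?thesis
      by (simp only: sum.distrib sum_subtractf sum_distrib_left[symmetric])
  qed
  also have "\<dots> = P1 f i j k l x + lam * P2 f i j k l x"
    unfolding kk kk' AA sum_kd P1_def P2_def Ric_up_eq by (simp add: algebra_simps)
  finally show ?thesis by simp
qed

end


section \<open>Contractions of \<open>P\<close> with the curvature and with \<open>T\<close>\<close>

lemma sum2_product_diff:
  fixes X Y X' Y' :: "_ \<Rightarrow> real"
  shows "(\<Sum>k\<in>K. \<Sum>l\<in>L. u * (X k * Y l - X' k * Y' l))
    = u * ((\<Sum>k\<in>K. X k) * (\<Sum>l\<in>L. Y l) - (\<Sum>k\<in>K. X' k) * (\<Sum>l\<in>L. Y' l))"
  by (unfold sum_product, simp only: sum_subtractf[symmetric] sum_distrib_left)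

lemma sum2_mult_diff:
  fixes X Y Y' :: "_ \<Rightarrow> real"
  shows "(\<Sum>k\<in>K. \<Sum>l\<in>L. X k * (w * Y l - Y' l * w'))
    = (\<Sum>k\<in>K. X k) * (w * (\<Sum>l\<in>L. Y l) - (\<Sum>l\<in>L. Y' l) * w')"
proof -
  have "w * (\<Sum>l\<in>L. Y l) - (\<Sum>l\<in>L. Y' l) * w' = (\<Sum>l\<in>L. w * Y l - Y' l * w')"
    by (simp only: sum_distrib_left sum_distrib_right sum_subtractf)
  then show ?thesis by (simp only: sum_product)
qed

context
  fixes f :: "real^'n::finite \<Rightarrow> real^'m::finite"
  assumes f: "smooth_map f"
begin

lemma P_antisym34: "P1 f i j l k x + lam * P2 f i j l k x = - (P1 f i j k l x + lam * P2 f i j k l x)"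
proof -
  have Q: "Qtot f lam x i j q p = - Qtot f lam x i j p q" for p q by (rule Qtot_antisym34[OF f])
  show ?thesis
    unfolding P_eq[OF f]
  proof (subst sum.swap, unfold sum_negf[symmetric], intro sum.cong refl)
    show "Qtot f lam x i j q p * gi f x $ q $ l * gi f x $ p $ k = - (Qtot f lam x i j p q * gi f x $ p $ k * gi f x $ q $ l)" for p q
      unfolding Q[of q p] by simp
  qed
qed

lemma Aop_nth': "(\<Sigma> l. gi f x $ q $ l * f2 f a j l x) = Aop f a x $ q $ j"
  by (simp add: Aop_nth f2_commute[OF f, of a j])

lemma flux_eq_Vfield:
  "(\<Sigma> j k l. (P1 f i j k l x + lam * P2 f i j k l x) * pd l (\<lambda>y. gm f y $ j $ k) x) = Vfield f lam i x"
proof -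
  let ?P = "\<lambda>j k l. P1 f i j k l x + lam * P2 f i j k l x"
  have 0: "(\<Sigma> k l. ?P j k l * (\<Sigma> a. f1 f a j x * f2 f a k l x)) = 0" for j
  proof (rule sum_antisym_eq_0)
    show "?P j l k * (\<Sigma> a. f1 f a j x * f2 f a l k x) = - (?P j k l * (\<Sigma> a. f1 f a j x * f2 f a k l x))" for k l
      unfolding P_antisym34[of i j l k] f2_commute[OF f, of _ l k] by (rule mult_minus_left)
  qed
  have 1: "(\<Sigma> k l. ?P j k l * (\<Sigma> a. f1 f a k x * f2 f a j l x)) = (\<Sigma> p q. Qtot f lam x i j p q * Kt f x p q j)" for j
  proof -
    have K: "(\<Sigma> k l. gi f x $ p $ k * gi f x $ q $ l * (\<Sigma> a. f1 f a k x * f2 f a j l x)) = Kt f x p q j" for p q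
    proof -
      have "(\<Sigma> k l. gi f x $ p $ k * gi f x $ q $ l * (\<Sigma> a. f1 f a k x * f2 f a j l x))
        = (\<Sigma> k l a. (gi f x $ p $ k * f1 f a k x) * (gi f x $ q $ l * f2 f a j l x))"
        by (simp add: sum_distrib_left mult_ac)
      also have "\<dots> = (\<Sigma> a k l. (gi f x $ p $ k * f1 f a k x) * (gi f x $ q $ l * f2 f a j l x))"
        by (rule sum3_rotate)
      also have "\<dots> = Kt f x p q j"
        unfolding sum_product[symmetric] Aop_nth' gradf_nth[symmetric] Kt_def ..
      finally show ?thesis .
    qed
    have "(\<Sigma> k l. ?P j k l * (\<Sigma> a. f1 f a k x * f2 f a j l x))
      = (\<Sigma> k l p q. Qtot f lam x i j p q * (gi f x $ p $ k * gi f x $ q $ l * (\<Sigma> a. f1 f a k x * f2 f a j l x)))"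
      unfolding P_eq[OF f] sum_distrib_right by (simp only: mult.assoc)
    also have "\<dots> = (\<Sigma> p q k l. Qtot f lam x i j p q * (gi f x $ p $ k * gi f x $ q $ l * (\<Sigma> a. f1 f a k x * f2 f a j l x)))"
      by (rule sum2_sum2_swap)
    also have "\<dots> = (\<Sigma> p q. Qtot f lam x i j p q * Kt f x p q j)"
      by (simp only: sum_distrib_left[symmetric] K)
    finally show ?thesis .
  qed
  have "(\<Sigma> j k l. ?P j k l * pd l (\<lambda>y. gm f y $ j $ k) x)
    = (\<Sigma> j. (\<Sigma> k l. ?P j k l * (\<Sigma> a. f1 f a k x * f2 f a j l x))
        + (\<Sigma> k l. ?P j k l * (\<Sigma> a. f1 f a j x * f2 f a k l x)))"
    unfolding pd_gm[OF f] sum.distrib distrib_left by (simp only: mult.commute[of "f2 f _ _ _ x"] sum.distrib)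
  then show ?thesis by (simp only: 0 1 add_0_right Vfield_def)
qed

lemma sum_P_contract:
  "(\<Sigma> i j k l. (P1 f i j k l x + lam * P2 f i j k l x) * R i j k l)
    = (\<Sigma> i j p q. Qtot f lam x i j p q * (\<Sigma> k l. gi f x $ p $ k * gi f x $ q $ l * R i j k l))"
  unfolding P_eq[OF f] by (rule contract_gi_kl)

lemma gi_gi_Rm:
  "(\<Sigma> k l. gi f x $ p $ k * gi f x $ q $ l * Rm f i j k l x)
    = (\<Sigma> a c. Ui f x $ c $ a * Aop f c x $ p $ i * Aop f a x $ q $ j)
      - (\<Sigma> a c. Ui f x $ c $ a * Aop f c x $ q $ i * Aop f a x $ p $ j)"
proof -
  let ?g = "gi f x"
  have "(\<Sigma> k l. ?g $ p $ k * ?g $ q $ l * Rm f i j k l x)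
    = (\<Sigma> k l a c. Ui f x $ a $ c *
        ((?g $ p $ k * f2 f a i k x) * (?g $ q $ l * f2 f c j l x) - (?g $ p $ k * f2 f c j k x) * (?g $ q $ l * f2 f a i l x)))"
    unfolding Rm_eq[OF f] sum_distrib_left by (simp add: algebra_simps)
  also have "\<dots> = (\<Sigma> a c k l. Ui f x $ a $ c *
        ((?g $ p $ k * f2 f a i k x) * (?g $ q $ l * f2 f c j l x) - (?g $ p $ k * f2 f c j k x) * (?g $ q $ l * f2 f a i l x)))"
    by (rule sum2_sum2_swap)
  also have "\<dots> = (\<Sigma> a c. Ui f x $ a $ c * (Aop f a x $ p $ i * Aop f c x $ q $ j - Aop f c x $ p $ j * Aop f a x $ q $ i))"
    by (simp only: sum2_product_diff Aop_nth')
  also have "\<dots> = (\<Sigma> a c. Ui f x $ c $ a * (Aop f c x $ p $ i * Aop f a x $ q $ j - Aop f a x $ p $ j * Aop f c x $ q $ i))"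
    by (rule sum.swap)
  finally show ?thesis by (simp add: right_diff_distrib sum_subtractf mult_ac)
qed

text \<open>The two products of the Gauss equation differ by an exchange of \<open>p\<close> and
  \<open>q\<close>, under which \<open>Qtot\<close> changes sign. They contribute equally, whence
  the factor 2.\<close>

lemma sum_P_Rm:
  "(\<Sigma> i j k l. (P1 f i j k l x + lam * P2 f i j k l x) * Rm f i j k l x)
    = 2 * (\<Sigma> i j p q. Qtot f lam x i j p q *
        (\<Sigma> a c. Ui f x $ c $ a * Aop f c x $ p $ i * Aop f a x $ q $ j))"
proof -
  let ?Z = "\<lambda>i j p q. \<Sigma> a c. Ui f x $ c $ a * Aop f c x $ p $ i * Aop f a x $ q $ j"
  have "(\<Sigma> p q. Qtot f lam x i j p q * ?Z i j q p) = - (\<Sigma> p q. Qtot f lam x i j p q * ?Z i j p q)" for i j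
  proof -
    have "(\<Sigma> p q. Qtot f lam x i j p q * ?Z i j q p) = (\<Sigma> q p. Qtot f lam x i j p q * ?Z i j q p)"
      by (rule sum.swap)
    also have "\<dots> = (\<Sigma> q p. - (Qtot f lam x i j q p * ?Z i j q p))"
    proof (intro sum.cong refl)
      show "Qtot f lam x i j p q * ?Z i j q p = - (Qtot f lam x i j q p * ?Z i j q p)" for p q
        unfolding Qtot_antisym34[OF f, of lam x i j p q] by (rule mult_minus_left)
    qed
    finally show ?thesis by (simp only: sum_negf)
  qed
  then show ?thesis
    unfolding sum_P_contract gi_gi_Rm right_diff_distrib sum_subtractf by (simp only: sum_negf)
qed

lemma sum_P1_Rm: "(\<Sigma> i j k l. P1 f i j k l x * Rm f i j k l x) = Scal f x"
proof -
  let ?g = "gi f x"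
  have anti: "Rm f i j l k x = - Rm f i j k l x" for i j k l
    unfolding Rm_eq[OF f] by (simp add: algebra_simps flip: sum_negf)
  have "Scal f x = (\<Sigma> j l i k. ?g $ i $ k * ?g $ j $ l * Rm f i j k l x)"
    unfolding Scal_def Ric_def sum_distrib_left by (simp add: mult_ac)
  also have "\<dots> = (\<Sigma> j i l k. ?g $ i $ k * ?g $ j $ l * Rm f i j k l x)"
    by (rule sum.cong[OF refl], rule sum.swap)
  also have "\<dots> = (\<Sigma> j i k l. ?g $ i $ k * ?g $ j $ l * Rm f i j k l x)"
    by (rule sum.cong[OF refl], rule sum.cong[OF refl], rule sum.swap)
  also have "\<dots> = (\<Sigma> i j k l. ?g $ i $ k * ?g $ j $ l * Rm f i j k l x)" by (rule sum.swap)
  finally have S: "Scal f x = \<dots>" .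
  have "(\<Sigma> k l. ?g $ i $ l * ?g $ j $ k * Rm f i j k l x) = - (\<Sigma> k l. ?g $ i $ k * ?g $ j $ l * Rm f i j k l x)" for i j
  proof -
    have "(\<Sigma> k l. ?g $ i $ l * ?g $ j $ k * Rm f i j k l x) = (\<Sigma> l k. ?g $ i $ l * ?g $ j $ k * Rm f i j k l x)"
      by (rule sum.swap)
    also have "\<dots> = (\<Sigma> l k. - (?g $ i $ l * ?g $ j $ k * Rm f i j l k x))"
    proof (intro sum.cong refl)
      show "?g $ i $ l * ?g $ j $ k * Rm f i j k l x = - (?g $ i $ l * ?g $ j $ k * Rm f i j l k x)" for k l
        unfolding anti[of i j l k] by simp
    qed
    finally show ?thesis by (simp only: sum_negf)
  qed
  then have "(\<Sigma> i j k l. ?g $ i $ l * ?g $ j $ k * Rm f i j k l x) = - Scal f x"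
    unfolding S by (simp only: sum_negf)
  moreover have "(\<Sigma> i j k l. P1 f i j k l x * Rm f i j k l x)
    = (1/2) * ((\<Sigma> i j k l. ?g $ i $ k * ?g $ j $ l * Rm f i j k l x)
       - (\<Sigma> i j k l. ?g $ i $ l * ?g $ j $ k * Rm f i j k l x))"
    by (simp only: sum_subtractf[symmetric] left_diff_distrib sum_distrib_left P1_def mult.assoc)
  ultimately show ?thesis using S by simp
qed

text \<open>Contracting \<open>Ui\<close> with \<open>f1\<close> gives a gradient, so
  \<open>T\<close> is a combination of connection forms of the kind found in
  \<open>div_Vfield\<close>.\<close>

lemma Tt_eq:
  "Tt f i j k l x = (\<Sigma> a c. f1 f a k x * (shape_grad f c c x j * f2 f a i l x - f2 f c i l x * shape_grad f a c x j))"
proof -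
  let ?F = "\<lambda>a c. f1 f a k x * (shape_grad f c c x j * f2 f a i l x - f2 f c i l x * shape_grad f a c x j)"
  have "Tt f i j k l x = (\<Sigma> c b s a. (Ui f x $ c $ b * f1 f b s x) * (f1 f a k x *
       (f2 f c j s x * f2 f a i l x - f2 f c i l x * f2 f a j s x)))"
    unfolding Tt_def by (subst sum.swap) (use Ui_sym[of f x] in \<open>simp add: mult.assoc\<close>)
  also have "\<dots> = (\<Sigma> c s b a. (Ui f x $ c $ b * f1 f b s x) * (f1 f a k x *
       (f2 f c j s x * f2 f a i l x - f2 f c i l x * f2 f a j s x)))"
    by (rule sum.cong[OF refl], rule sum.swap)
  also have "\<dots> = (\<Sigma> c s a. f1 f a k x * ((f2 f c j s x * gradf f c x $ s) * f2 f a i l x - f2 f c i l x * (f2 f a j s x * gradf f c x $ s)))"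
    by (simp only: sum_product[symmetric] gradf_Ui[symmetric]) (simp add: sum_distrib_left algebra_simps)
  also have "\<dots> = (\<Sigma> c a s. f1 f a k x * ((f2 f c j s x * gradf f c x $ s) * f2 f a i l x - f2 f c i l x * (f2 f a j s x * gradf f c x $ s)))"
    by (rule sum.cong[OF refl], rule sum.swap)
  also have "\<dots> = (\<Sigma> c a. ?F a c)"
    by (simp only: sum_distrib_left[symmetric] sum_distrib_right[symmetric] sum_subtractf shape_grad_def)
  also have "\<dots> = (\<Sigma> a c. ?F a c)"
    by (rule sum.swap)
  finally show ?thesis .
qed

lemma gi_gi_Tt:
  "(\<Sigma> k l. gi f x $ p $ k * gi f x $ q $ l * Tt f i j k l x)
   = (\<Sigma> a c. gradf f a x $ p * (shape_grad f c c x j * Aop f a x $ q $ i - Aop f c x $ q $ i * shape_grad f a c x j))"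
proof -
  let ?g = "gi f x"
  have "(\<Sigma> k l. ?g $ p $ k * ?g $ q $ l * Tt f i j k l x)
    = (\<Sigma> k l a c. (?g $ p $ k * f1 f a k x) * (shape_grad f c c x j * (?g $ q $ l * f2 f a i l x) - (?g $ q $ l * f2 f c i l x) * shape_grad f a c x j))"
    unfolding Tt_eq sum_distrib_left by (simp add: algebra_simps)
  also have "\<dots> = (\<Sigma> a c k l. (?g $ p $ k * f1 f a k x) * (shape_grad f c c x j * (?g $ q $ l * f2 f a i l x) - (?g $ q $ l * f2 f c i l x) * shape_grad f a c x j))"
    by (rule sum2_sum2_swap)
  also have "\<dots> = (\<Sigma> a c. gradf f a x $ p * (shape_grad f c c x j * Aop f a x $ q $ i - Aop f c x $ q $ i * shape_grad f a c x j))"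
    by (simp only: sum2_mult_diff Aop_nth' gradf_nth[symmetric])
  finally show ?thesis .
qed

text \<open>In \<open>T\<close> the connection form carries the index \<open>j\<close>, in
  \<open>div_Vfield\<close> the index \<open>i\<close>. Exchanging them by the antisymmetry of
  \<open>Qtot\<close> matches the two expressions, signs included.\<close>

lemma sum_P_Tt:
  "(\<Sigma> i j k l. (P1 f i j k l x + lam * P2 f i j k l x) * Tt f i j k l x)
    = (\<Sigma> i j p q. Qtot f lam x i j p q *
      (\<Sigma> a c. gradf f a x $ p * (shape_grad f a c x i * Aop f c x $ q $ j - shape_grad f c c x i * Aop f a x $ q $ j)))"
proof -
  let ?X = "\<lambda>i j p q. \<Sigma> a c. gradf f a x $ p * (shape_grad f c c x j * Aop f a x $ q $ i - Aop f c x $ q $ i * shape_grad f a c x j)"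
  have X: "- ?X j i p q = (\<Sigma> a c. gradf f a x $ p * (shape_grad f a c x i * Aop f c x $ q $ j - shape_grad f c c x i * Aop f a x $ q $ j))" for i j p q
    by (simp add: algebra_simps flip: sum_negf)
  have "(\<Sigma> i j p q. Qtot f lam x i j p q * ?X i j p q)
     = (\<Sigma> j i p q. Qtot f lam x i j p q * ?X i j p q)" by (rule sum.swap)
  also have "\<dots> = (\<Sigma> j i p q. Qtot f lam x j i p q * - ?X i j p q)"
  proof (intro sum.cong refl)
    show "Qtot f lam x i j p q * ?X i j p q = Qtot f lam x j i p q * - ?X i j p q" for i j p q
      unfolding Qtot_antisym12[OF f, of lam x j i] by (rule minus_mult_minus[symmetric])
  qed
  finally show ?thesis
    unfolding sum_P_contract gi_gi_Tt by (simp only: X)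
qed

end


section \<open>The normal curvature scalar and the divergence identity\<close>

context
  fixes f :: "real^'n::finite \<Rightarrow> real^'m::finite"
  assumes f: "smooth_map f"
begin

lemma shape_grad_dot:
  "(\<Sigma> j. v $ j * (\<Sigma> p. f2 f c j p x * w $ p)) = (\<Sigma> j. w $ j * (\<Sigma> p. f2 f c j p x * v $ p))"
proof -
  have "(\<Sigma> j. v $ j * (\<Sigma> p. f2 f c j p x * w $ p)) = (\<Sigma> j p. v $ j * f2 f c j p x * w $ p)"
    by (simp add: sum_distrib_left mult.assoc)
  also have "\<dots> = (\<Sigma> p j. v $ j * f2 f c j p x * w $ p)" by (rule sum.swap)
  also have "\<dots> = (\<Sigma> j. w $ j * (\<Sigma> p. f2 f c j p x * v $ p))"
    by (simp add: sum_distrib_left mult_ac f2_commute[OF f])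
  finally show ?thesis .
qed

lemma ginner_Aop: "ginner f x (Aop f c x *v z) w = (\<Sigma> p. z $ p * (\<Sigma> k. f2 f c p k x * w $ k))"
proof -
  have "transpose (Aop f c x) ** gm f x = (\<chi> i k. f2 f c i k x)"
  proof -
    have "gm f x ** Aop f c x = (\<chi> k i. f2 f c k i x)"
      by (simp add: Aop_def matrix_mul_assoc gm_gi)
    from arg_cong[OF this, of transpose] show ?thesis
      by (simp add: matrix_transpose_mul transpose_gm) (simp add: transpose_def f2_commute[OF f])
  qed
  moreover have "ginner f x (Aop f c x *v z) w = z \<bullet> ((transpose (Aop f c x) ** gm f x) *v w)"
    unfolding ginner_def matrix_vector_mul_assoc[symmetric] by (metis dot_lmul_matrix vector_transpose_matrix)
  ultimately show ?thesis
    by (simp add: inner_vec_def matrix_vector_mult_def)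
qed

lemma Rperp_eq:
  "Rperp f x = (\<Sigma> a c. (\<Sigma> j. (Aop f a x *v gradf f a x) $ j * shape_grad f c c x j)
      - (\<Sigma> j. (Aop f c x *v gradf f a x) $ j * shape_grad f a c x j))"
proof -
  have "ginner f x (Rperp_op f a c x *v gradf f a x) (gradf f c x)
     = ginner f x (Aop f c x *v (Aop f a x *v gradf f a x)) (gradf f c x) - ginner f x (Aop f a x *v (Aop f c x *v gradf f a x)) (gradf f c x)" for a c
    by (simp add: Rperp_op_def matrix_vector_mult_diff_rdistrib matrix_vector_mul_assoc ginner_def inner_diff_left)
  then show ?thesis by (simp add: Rperp_def ginner_Aop shape_grad_def)
qed

text \<open>One half of \<open>P1\<close> gives \<open>Rperp\<close> outright. The other yields
  trace of \<open>A^a\<close> times \<open>h^c(grad f^a, grad f^c)\<close> minus the same expression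
  with \<open>a\<close> and \<open>c\<close> exchanged, which sums to 0.\<close>

lemma sum_P1_Tt: "2 * (\<Sigma> i j k l. P1 f i j k l x * Tt f i j k l x) = Rperp f x"
proof -
  let ?Y = "\<lambda>a c i j. gradf f a x $ j * (shape_grad f c c x j * Aop f a x $ i $ i - Aop f c x $ i $ i * shape_grad f a c x j)"
  let ?X = "\<lambda>i j p q. \<Sigma> a c. gradf f a x $ p * (shape_grad f c c x j * Aop f a x $ q $ i - Aop f c x $ q $ i * shape_grad f a c x j)"
  have "(\<Sigma> i j k l. P1 f i j k l x * Tt f i j k l x)
     = (\<Sigma> i j p q. ((1/2) * (kd i p * kd j q - kd i q * kd j p)) * ?X i j p q)"
    using sum_P_contract[OF f, of x 0 "\<lambda>i j k l. Tt f i j k l x"] by (simp add: Qtot_def gi_gi_Tt[OF f])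
  also have "\<dots> = (\<Sigma> i j. (1/2) * (?X i j i j - ?X i j j i))"
  proof -
    have "(\<Sigma> p q. ((1/2) * (kd i p * kd j q - kd i q * kd j p)) * X p q) = (1/2) * (X i j - X j i)"
      for i j :: 'n and X :: "'n \<Rightarrow> 'n \<Rightarrow> real"
    proof -
      have "(\<Sigma> p q. kd i p * (kd j q * X p q)) = X i j" "(\<Sigma> p q. kd j p * (kd i q * X p q)) = X j i"
        by (simp_all only: sum_distrib_left[symmetric] sum_kd)
      moreover have "(\<Sigma> p q. ((1/2) * (kd i p * kd j q - kd i q * kd j p)) * X p q)
         = (1/2) * ((\<Sigma> p q. kd i p * (kd j q * X p q)) - (\<Sigma> p q. kd j p * (kd i q * X p q)))"
        unfolding sum_subtractf[symmetric] sum_distrib_left by (simp add: algebra_simps)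
      ultimately show ?thesis by simp
    qed
    then show ?thesis by (simp only:)
  qed
  also have "\<dots> = (1/2) * ((\<Sigma> i j. ?X i j i j) - (\<Sigma> i j. ?X i j j i))"
    by (simp only: sum_distrib_left[symmetric] sum_subtractf)
  also have "(\<Sigma> i j. ?X i j i j) = Rperp f x"
  proof -
    have "(\<Sigma> i j. ?X i j i j) = (\<Sigma> a c i j. gradf f a x $ i * (shape_grad f c c x j * Aop f a x $ j $ i - Aop f c x $ j $ i * shape_grad f a c x j))"
      by (rule sum2_sum2_swap)
    also have "\<dots> = (\<Sigma> a c j i. gradf f a x $ i * (shape_grad f c c x j * Aop f a x $ j $ i - Aop f c x $ j $ i * shape_grad f a c x j))"
      by (rule sum.cong[OF refl], rule sum.cong[OF refl], rule sum.swap)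
    also have "\<dots> = Rperp f x"
      unfolding Rperp_eq matrix_vector_mult_def vec_lambda_beta sum_subtractf[symmetric] sum_distrib_right
      by (simp add: sum_subtractf algebra_simps)
    finally show ?thesis .
  qed
  also have "(\<Sigma> i j. ?X i j j i) = 0"
  proof -
    define b where "b a c = (\<Sigma> j. gradf f a x $ j * shape_grad f c c x j)" for a c
    define d where "d a c = (\<Sigma> j. gradf f a x $ j * shape_grad f a c x j)" for a c
    have bd: "b a c = d c a" for a c
      unfolding b_def d_def shape_grad_def by (rule shape_grad_dot)
    have "(\<Sigma> i j. ?X i j j i) = (\<Sigma> a c i j. ?Y a c i j)"
      by (rule sum2_sum2_swap)
    also have "\<dots> = (\<Sigma> a c. trace (Aop f a x) * b a c - trace (Aop f c x) * d a c)"
    proof (intro sum.cong refl)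
      fix a c
      have "(\<Sigma> i j. ?Y a c i j)
        = (\<Sigma> i j. Aop f a x $ i $ i * (gradf f a x $ j * shape_grad f c c x j)) - (\<Sigma> i j. Aop f c x $ i $ i * (gradf f a x $ j * shape_grad f a c x j))"
        by (simp add: algebra_simps sum_subtractf)
      then show "(\<Sigma> i j. ?Y a c i j)
        = trace (Aop f a x) * b a c - trace (Aop f c x) * d a c"
        by (simp only: sum_product[symmetric] trace_def b_def d_def)
    qed
    also have "\<dots> = (\<Sigma> a c. trace (Aop f a x) * d c a) - (\<Sigma> a c. trace (Aop f c x) * d a c)"
      by (simp only: bd sum_subtractf)
    also have "(\<Sigma> a c. trace (Aop f a x) * d c a) = (\<Sigma> a c. trace (Aop f c x) * d a c)"
      by (rule sum.swap)
    finally show ?thesis by simp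
  qed
  finally show ?thesis by simp
qed

theorem div_Vfield_eq:
  "(\<Sigma> i. pd i (Vfield f lam i) x) = (1/2) * (Scal f x + lam * L2 f x + Rperp f x + lam * L2perp f x)"
proof -
  have split: "(\<Sigma> i j k l. (P1 f i j k l x + lam * P2 f i j k l x) * R i j k l)
     = (\<Sigma> i j k l. P1 f i j k l x * R i j k l)
      + lam * (\<Sigma> i j k l. P2 f i j k l x * R i j k l)" for R
    by (simp only: distrib_right sum.distrib sum_distrib_left mult.assoc)
  have "(\<Sigma> i. pd i (Vfield f lam i) x)
      = (1/2) * (\<Sigma> i j k l. (P1 f i j k l x + lam * P2 f i j k l x) * Rm f i j k l x)
       + (\<Sigma> i j k l. (P1 f i j k l x + lam * P2 f i j k l x) * Tt f i j k l x)"
    unfolding div_Vfield[OF f] sum_P_Rm[OF f] sum_P_Tt[OF f] distrib_left sum.distrib by simp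
  then show ?thesis
    unfolding split sum_P1_Rm[OF f] sum_P1_Tt[symmetric] L2_def L2perp_def by (simp add: algebra_simps)
qed

end

subsection \<open>Flat normal bundle\<close>

text \<open>For a flat normal bundle the shape operators commute, so every polynomial in them is again
  self-adjoint and commutes with all of them.\<close>
definition commuting_selfadjoint :: "real^'n^'n \<Rightarrow> (real^'n^'n) set \<Rightarrow> (real^'n::finite^'n) \<Rightarrow> bool" where
  "commuting_selfadjoint g \<A> X \<longleftrightarrow> transpose X ** g = g ** X \<and> (\<forall>A\<in>\<A>. X ** A = A ** X)"

lemma matrix_scaleR_mult:
  fixes A :: "real^'b::finite^'a::finite"
  shows "(c *\<^sub>R A) ** B = c *\<^sub>R (A ** B)" "A ** (c *\<^sub>R B) = c *\<^sub>R (A ** B)"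
  by (simp_all add: vec_eq_iff matrix_matrix_mult_def sum_distrib_left mult_ac)

lemma
  fixes A :: "real^'b::finite^'a::finite"
  shows transpose_add: "transpose (A + B) = transpose A + transpose B"
    and transpose_scaleR: "transpose (c *\<^sub>R A) = c *\<^sub>R transpose A"
  by (simp_all add: vec_eq_iff transpose_def)

lemma commuting_selfadjoint_intros:
  assumes "commuting_selfadjoint g \<A> X"
  shows "commuting_selfadjoint g \<A> Y \<Longrightarrow> commuting_selfadjoint g \<A> (X + Y)"
    and "commuting_selfadjoint g \<A> (c *\<^sub>R X)"
    and "commuting_selfadjoint g \<A> Y \<Longrightarrow> Y \<in> \<A> \<Longrightarrow> commuting_selfadjoint g \<A> (X ** Y)"
proof -
  show "commuting_selfadjoint g \<A> Y \<Longrightarrow> commuting_selfadjoint g \<A> (X + Y)"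
    using assms by (simp add: commuting_selfadjoint_def matrix_add_ldistrib matrix_add_rdistrib' transpose_add)
  show "commuting_selfadjoint g \<A> (c *\<^sub>R X)"
    using assms by (simp add: commuting_selfadjoint_def matrix_scaleR_mult transpose_scaleR)
  assume Y: "commuting_selfadjoint g \<A> Y" "Y \<in> \<A>"
  then have XY: "X ** Y = Y ** X" using assms by (auto simp: commuting_selfadjoint_def)
  have "transpose (X ** Y) ** g = transpose Y ** (transpose X ** g)"
    by (simp add: matrix_transpose_mul matrix_mul_assoc)
  also have "\<dots> = transpose Y ** g ** X" using assms by (simp add: commuting_selfadjoint_def matrix_mul_assoc)
  also have "\<dots> = g ** (X ** Y)" using Y by (simp add: commuting_selfadjoint_def matrix_mul_assoc XY)
  finally have 1: "transpose (X ** Y) ** g = g ** (X ** Y)" .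
  have "X ** Y ** A = A ** (X ** Y)" if "A \<in> \<A>" for A
    using assms Y that unfolding commuting_selfadjoint_def by (metis matrix_mul_assoc)
  with 1 show "commuting_selfadjoint g \<A> (X ** Y)" by (simp add: commuting_selfadjoint_def)
qed

lemma commuting_selfadjoint_sum:
  assumes "\<And>a. a \<in> I \<Longrightarrow> commuting_selfadjoint g \<A> (X a)"
  shows "commuting_selfadjoint g \<A> (\<Sum>a\<in>I. X a)"
  using assms
proof (induction I rule: infinite_finite_induct)
  case (insert b I)
  then show ?case by (simp add: commuting_selfadjoint_intros)
qed (simp_all add: commuting_selfadjoint_def vec_eq_iff matrix_matrix_mult_def transpose_def)

lemma commuting_selfadjoint_mat: "commuting_selfadjoint g \<A> (mat 1)"
  by (simp add: commuting_selfadjoint_def)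

text \<open>The contraction turns out to be a polynomial in the commuting matrices \<open>A\<close>,
  \<open>B\<close>, \<open>C\<close>, with traces among its scalar coefficients, so it inherits both
  properties.\<close>

lemma Qm_contract_commuting_selfadjoint:
  assumes "A \<in> \<A>" "B \<in> \<A>" "C \<in> \<A>"
    and sa: "\<And>X. X \<in> \<A> \<Longrightarrow> commuting_selfadjoint g \<A> X"
  shows "commuting_selfadjoint g \<A> (\<chi> j p. \<Sigma> i q. Qm A B i j p q * C $ q $ i)"
proof -
  define S where "S = trace A *\<^sub>R B + (-1) *\<^sub>R (A ** B)"
  have S: "Sm A B i j = S $ i $ j" for i j
    by (simp add: S_def Sm_def matrix_matrix_mult_def)
  \<comment> \<open>The eight terms of \<open>Qm\<close>, each contracted with \<open>C\<close>. The
    two equal summands arise as \<open>S ** C\<close> and as \<open>C ** S\<close>.\<close>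
  define X where "X = (B ** C) ** A + (-1) *\<^sub>R (S ** C) + (-1) *\<^sub>R (S ** C) + (trace S / 2) *\<^sub>R C
     + (- trace (A ** C)) *\<^sub>R B + trace C *\<^sub>R S + (trace (S ** C) - trace S / 2 * trace C) *\<^sub>R mat 1"
  have saS: "commuting_selfadjoint g \<A> S"
    unfolding S_def by (intro commuting_selfadjoint_intros sa assms)
  then have SC: "C ** S = S ** C" using \<open>C \<in> \<A>\<close> by (simp add: commuting_selfadjoint_def)
  have "(\<Sigma> i q. Qm A B i j p q * C $ q $ i) = X $ j $ p" for j p
  proof -
    have 1: "(\<Sigma> i q. A $ i $ p * (B $ j $ q * C $ q $ i)) = ((B ** C) ** A) $ j $ p"
      by (simp only: sum_distrib_left[symmetric]) (simp add: matrix_matrix_mult_def mult.commute)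
    have 2: "(\<Sigma> i q. kd i p * (S $ j $ q * C $ q $ i)) = (S ** C) $ j $ p"
      by (simp only: sum_distrib_left[symmetric] sum_kd) (simp add: matrix_matrix_mult_def)
    have 3: "(\<Sigma> i q. S $ i $ p * (kd j q * C $ q $ i)) = (S ** C) $ j $ p"
      unfolding SC[symmetric] by (simp only: sum_distrib_left[symmetric] sum_kd) (simp add: matrix_matrix_mult_def mult.commute)
    have 4: "(\<Sigma> i q. kd i p * (kd j q * C $ q $ i)) = C $ j $ p"
      by (simp only: sum_distrib_left[symmetric] sum_kd)
    have 5: "(\<Sigma> i q. Y $ i $ q * C $ q $ i) = trace (Y ** C)" for Y
      by (simp add: trace_def matrix_matrix_mult_def)
    have 6: "(\<Sigma> i q. kd i q * C $ q $ i) = trace C"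
      by (simp only: sum_kd trace_def)
    have "Qm A B i j p q * C $ q $ i = A $ i $ p * (B $ j $ q * C $ q $ i) - kd i p * (S $ j $ q * C $ q $ i)
       - S $ i $ p * (kd j q * C $ q $ i) + trace S / 2 * (kd i p * (kd j q * C $ q $ i))
       - A $ i $ q * C $ q $ i * B $ j $ p + kd i q * C $ q $ i * S $ j $ p
       + S $ i $ q * C $ q $ i * kd j p - trace S / 2 * (kd i q * C $ q $ i * kd j p)" for i q
      unfolding Qm_def Em_def S trace_def[symmetric] by (simp add: algebra_simps)
    then have "(\<Sigma> i q. Qm A B i j p q * C $ q $ i)
      = (\<Sigma> i q. A $ i $ p * (B $ j $ q * C $ q $ i)) - (\<Sigma> i q. kd i p * (S $ j $ q * C $ q $ i))
       - (\<Sigma> i q. S $ i $ p * (kd j q * C $ q $ i)) + trace S / 2 * (\<Sigma> i q. kd i p * (kd j q * C $ q $ i))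
       - (\<Sigma> i q. A $ i $ q * C $ q $ i) * B $ j $ p + (\<Sigma> i q. kd i q * C $ q $ i) * S $ j $ p
       + (\<Sigma> i q. S $ i $ q * C $ q $ i) * kd j p - trace S / 2 * ((\<Sigma> i q. kd i q * C $ q $ i) * kd j p)"
      by (simp only: sum_distrib_left sum_distrib_right sum_subtractf sum.distrib)
    then show ?thesis
      unfolding 1 2 3 4 5 6 X_def by (simp add: mat_def algebra_simps)
  qed
  then have "(\<chi> j p. \<Sigma> i q. Qm A B i j p q * C $ q $ i) = X" by (simp add: vec_eq_iff)
  moreover have "commuting_selfadjoint g \<A> X"
    unfolding X_def by (intro commuting_selfadjoint_intros commuting_selfadjoint_mat sa saS assms)
  ultimately show ?thesis by simp
qed

text \<open>With \<open>M a\<close> the contraction of \<open>Q2\<close> against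
  \<open>Aop f a x\<close>, the sum becomes \<open><grad f^a, M a A^c grad f^c>\<close> minus
  \<open><grad f^a, M c A^a grad f^c>\<close>, in the induced inner product. The product
  \<open>M c A^a\<close> is self-adjoint, so the gradients in the second term may be exchanged;
  renaming \<open>a\<close> and \<open>c\<close> then turns it into the first.\<close>

lemma L2perp_flat:
  fixes f :: "real^'n::finite \<Rightarrow> real^'m::finite"
  assumes f: "smooth_map f" and flat: "flat_normal_bundle f"
  shows "L2perp f x = 0"
proof -
  let ?F = "\<lambda>a c i j p q. (Q2 f x i j p q * Aop f a x $ q $ i) * gradf f a x $ p * shape_grad f c c x j - (Q2 f x i j p q * Aop f c x $ q $ i) * gradf f a x $ p * shape_grad f a c x j"
  let ?g = "gm f x"
  define \<A> where "\<A> = range (\<lambda>a. Aop f a x)"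
  have comm: "Aop f a x ** Aop f c x = Aop f c x ** Aop f a x" for a c
    using flat by (simp add: flat_normal_bundle_def Rperp_op_def)
  have gA: "?g ** Aop f a x = (\<chi> k i. f2 f a k i x)" for a
    by (simp add: Aop_def matrix_mul_assoc gm_gi)
  have sym: "transpose (\<chi> k i. f2 f a k i x) = (\<chi> k i. f2 f a k i x)" for a
    by (simp add: transpose_def f2_commute[OF f] vec_eq_iff)
  have sa: "commuting_selfadjoint ?g \<A> X" if XA: "X \<in> \<A>" for X
  proof -
    obtain a where X: "X = Aop f a x" using XA by (auto simp: \<A>_def)
    have "transpose (Aop f a x) ** ?g = transpose (?g ** Aop f a x)"
      by (simp only: matrix_transpose_mul transpose_gm)
    also have "\<dots> = ?g ** Aop f a x" unfolding gA sym ..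
    finally have "transpose (Aop f a x) ** ?g = ?g ** Aop f a x" .
    then show ?thesis by (auto simp: commuting_selfadjoint_def X \<A>_def comm)
  qed
  define M where "M a = (\<chi> j p. \<Sigma> i q. Q2 f x i j p q * Aop f a x $ q $ i)" for a
  have M_eq: "M a = (\<Sigma> b d. Ui f x $ b $ d *\<^sub>R (\<chi> j p. \<Sigma> i q. Qm (Aop f b x) (Aop f d x) i j p q * Aop f a x $ q $ i))" for a
  proof -
    have "(\<Sigma> i q. Q2 f x i j p q * Aop f a x $ q $ i)
      = (\<Sigma> b d. Ui f x $ b $ d * (\<Sigma> i q. Qm (Aop f b x) (Aop f d x) i j p q * Aop f a x $ q $ i))" for j p
      unfolding Q2_def sum_distrib_right sum_distrib_left mult.assoc by (rule sum2_sum2_swap)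
    then show ?thesis by (simp add: M_def vec_eq_iff)
  qed
  have AA: "Aop f a x \<in> \<A>" for a by (simp add: \<A>_def)
  have M: "commuting_selfadjoint ?g \<A> (M a)" for a
    unfolding M_eq
    by (intro commuting_selfadjoint_sum commuting_selfadjoint_intros(2) Qm_contract_commuting_selfadjoint AA sa)
  have dot: "(\<Sigma> j p. M a $ j $ p * v $ p * (\<Sigma> r. f2 f c j r x * w $ r)) = v \<bullet> ((?g ** (M a ** Aop f c x)) *v w)" for a c v w
  proof -
    have "(\<Sigma> j p. M a $ j $ p * v $ p * (\<Sigma> r. f2 f c j r x * w $ r)) = (M a *v v) \<bullet> ((?g ** Aop f c x) *v w)"
      by (simp add: gA inner_vec_def matrix_vector_mult_def sum_distrib_right)
    also have "\<dots> = v \<bullet> ((transpose (M a) ** ?g ** Aop f c x) *v w)"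
      unfolding matrix_vector_mul_assoc[symmetric] by (metis dot_lmul_matrix vector_transpose_matrix)
    also have "transpose (M a) ** ?g = ?g ** M a" using M by (simp add: commuting_selfadjoint_def)
    finally show ?thesis by (simp add: matrix_mul_assoc)
  qed
  have MA: "transpose (?g ** (M a ** Aop f c x)) = ?g ** (M a ** Aop f c x)" for a c
  proof -
    have A: "Aop f c x \<in> \<A>" by (simp add: \<A>_def)
    have "commuting_selfadjoint ?g \<A> (M a ** Aop f c x)"
      by (rule commuting_selfadjoint_intros(3)[OF M sa[OF A] A])
    then show ?thesis by (simp add: commuting_selfadjoint_def matrix_transpose_mul transpose_gm)
  qed
  have dot_sym: "v \<bullet> ((?g ** (M a ** Aop f c x)) *v w) = w \<bullet> ((?g ** (M a ** Aop f c x)) *v v)" for a c v w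
    by (metis MA dot_lmul_matrix inner_commute vector_transpose_matrix)
  let ?X = "\<lambda>i j p q. \<Sigma> a c. gradf f a x $ p * (shape_grad f c c x j * Aop f a x $ q $ i - Aop f c x $ q $ i * shape_grad f a c x j)"
  have "(\<Sigma> i j k l. P2 f i j k l x * Tt f i j k l x)
    = (\<Sigma> i j p q. Q2 f x i j p q * ?X i j p q)"
  proof -
    have c: "(\<Sigma> i j k l. (P1 f i j k l x + lam * P2 f i j k l x) * Tt f i j k l x)
      = (\<Sigma> i j p q. Qtot f lam x i j p q * ?X i j p q)" for lam
      using sum_P_contract[OF f, of x lam "\<lambda>i j k l. Tt f i j k l x"] by (simp only: gi_gi_Tt[OF f])
    \<comment> \<open>The difference of the identities for \<lambda> = 1 and \<lambda> = 0 isolates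
      the \<open>P2\<close> part.\<close>
    from c[of 1] c[of 0] show ?thesis
      by (simp add: Qtot_def distrib_right sum.distrib)
  qed
  also have "\<dots> = (\<Sigma> a c. gradf f a x \<bullet> ((?g ** (M a ** Aop f c x)) *v gradf f c x) - gradf f a x \<bullet> ((?g ** (M c ** Aop f a x)) *v gradf f c x))"
  proof -
    have "(\<Sigma> i j p q. Q2 f x i j p q * ?X i j p q)
      = (\<Sigma> i j a c p q. ?F a c i j p q)"
      unfolding sum_distrib_left
      by (rule sum.cong[OF refl], rule sum.cong[OF refl], subst sum2_sum2_swap) (simp add: algebra_simps)
    also have "\<dots> = (\<Sigma> a c i j p q. ?F a c i j p q)"
      by (rule sum2_sum2_swap)
    also have "\<dots> = (\<Sigma> a c j p i q. ?F a c i j p q)"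
      by (rule sum.cong[OF refl], rule sum.cong[OF refl], subst sum.swap, rule sum.cong[OF refl], rule sum.swap)
    also have "\<dots> = (\<Sigma> a c j p. M a $ j $ p * gradf f a x $ p * shape_grad f c c x j - M c $ j $ p * gradf f a x $ p * shape_grad f a c x j)"
      unfolding sum_subtractf sum_distrib_right[symmetric] M_def by simp
    finally show ?thesis
      by (simp only: sum_subtractf shape_grad_def dot)
  qed
  also have "\<dots> = (\<Sigma> a c. gradf f a x \<bullet> ((?g ** (M a ** Aop f c x)) *v gradf f c x))
       - (\<Sigma> a c. gradf f a x \<bullet> ((?g ** (M c ** Aop f a x)) *v gradf f c x))"
    by (simp only: sum_subtractf)
  also have "(\<Sigma> a c. gradf f a x \<bullet> ((?g ** (M c ** Aop f a x)) *v gradf f c x))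
     = (\<Sigma> c a. gradf f c x \<bullet> ((?g ** (M c ** Aop f a x)) *v gradf f a x))"
    by (subst sum.swap) (rule sum.cong[OF refl], rule sum.cong[OF refl], rule dot_sym)
  finally show ?thesis by (simp add: L2perp_def)
qed

lemma Rperp_flat: "flat_normal_bundle f \<Longrightarrow> Rperp f x = 0"
  by (simp add: flat_normal_bundle_def Rperp_def ginner_def)


subsection \<open>Decay at infinity and the mass\<close>

definition decays :: "real \<Rightarrow> ('a::real_normed_vector \<Rightarrow> real) \<Rightarrow> bool" where
  "decays q h \<longleftrightarrow> (\<exists>C R. \<forall>x. norm x \<ge> R \<longrightarrow> \<bar>h x\<bar> \<le> C * norm x powr (- q))"

lemma decaysI: "(\<And>x. norm x \<ge> R \<Longrightarrow> \<bar>h x\<bar> \<le> C * norm x powr (- q)) \<Longrightarrow> decays q h"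
  unfolding decays_def by blast

lemma decaysE:
  assumes "decays q h"
  obtains R C where "\<And>x. norm x \<ge> R \<Longrightarrow> \<bar>h x\<bar> \<le> C * norm x powr (- q)"
  using assms unfolding decays_def by blast

lemma decays_bounded: "(\<And>x. \<bar>h x\<bar> \<le> C) \<Longrightarrow> decays 0 h"
proof (rule decaysI[where R=1 and C=C])
  fix x :: 'a assume "\<And>x. \<bar>h x\<bar> \<le> C" "norm x \<ge> 1"
  then show "\<bar>h x\<bar> \<le> C * norm x powr (- 0)" by auto
qed

lemma decays_add:
  assumes "decays q h" "decays q k" shows "decays q (\<lambda>x. h x + k x)"
proof -
  obtain C R where 1: "\<And>x. norm x \<ge> R \<Longrightarrow> \<bar>h x\<bar> \<le> C * norm x powr (- q)" using decaysE[OF assms(1)] by blast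
  obtain C' R' where 2: "\<And>x. norm x \<ge> R' \<Longrightarrow> \<bar>k x\<bar> \<le> C' * norm x powr (- q)" using decaysE[OF assms(2)] by blast
  show ?thesis
  proof (rule decaysI[where R="max R R'" and C="C + C'"])
    fix x :: 'a assume "norm x \<ge> max R R'"
    then show "\<bar>h x + k x\<bar> \<le> (C + C') * norm x powr (- q)"
      using 1[of x] 2[of x] abs_triangle_ineq[of "h x" "k x"] by (simp add: distrib_right)
  qed
qed

lemma decays_mult:
  assumes "decays q h" "decays q' k" "q + q' = q''" shows "decays q'' (\<lambda>x. h x * k x)"
proof -
  obtain C R where 1: "\<And>x. norm x \<ge> R \<Longrightarrow> \<bar>h x\<bar> \<le> C * norm x powr (- q)" using decaysE[OF assms(1)] by blast
  obtain C' R' where 2: "\<And>x. norm x \<ge> R' \<Longrightarrow> \<bar>k x\<bar> \<le> C' * norm x powr (- q')" using decaysE[OF assms(2)] by blast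
  show ?thesis
  proof (rule decaysI[where R="max R R'" and C="C * C'"])
    fix x :: 'a assume x: "norm x \<ge> max R R'"
    have "\<bar>h x * k x\<bar> \<le> (C * norm x powr (- q)) * (C' * norm x powr (- q'))"
      unfolding abs_mult using 1[of x] 2[of x] x by (intro mult_mono) auto
    then show "\<bar>h x * k x\<bar> \<le> (C * C') * norm x powr (- q'')"
      by (simp add: mult_ac powr_add[symmetric] assms(3)[symmetric])
  qed
qed

lemma decays_const: "decays 0 (\<lambda>x. c)"
  by (rule decays_bounded[where C="\<bar>c\<bar>"]) simp

lemma decays_cmult: "decays q h \<Longrightarrow> decays q (\<lambda>x. c * h x)"
  by (rule decays_mult[OF decays_const]) auto

lemma decays_diff: "decays q h \<Longrightarrow> decays q k \<Longrightarrow> decays q (\<lambda>x. h x - k x)"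
  using decays_add[of q h "\<lambda>x. (-1) * k x"] decays_cmult[of q k "-1"] by simp

lemma decays_zero: "decays q (\<lambda>x. 0)"
  by (rule decaysI[where R=0 and C=0]) simp

lemma decays_sum: "(\<And>a. a \<in> A \<Longrightarrow> decays q (h a)) \<Longrightarrow> decays q (\<lambda>x. \<Sum>a\<in>A. h a x)"
  by (induction A rule: infinite_finite_induct) (auto intro: decays_zero decays_add)

lemma decays_mono:
  assumes "decays q h" "q' \<le> q" shows "decays q' h"
proof -
  obtain C R where 1: "\<And>x. norm x \<ge> R \<Longrightarrow> \<bar>h x\<bar> \<le> C * norm x powr (- q)" using decaysE[OF assms(1)] by blast
  show ?thesis
  proof (rule decaysI[where R="max R 1" and C="\<bar>C\<bar>"])
    fix x :: 'a assume x: "norm x \<ge> max R 1"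
    have "\<bar>h x\<bar> \<le> \<bar>C\<bar> * norm x powr (- q)"
      using 1[of x] x by (intro order_trans[OF _ mult_right_mono[OF abs_ge_self]]) auto
    also have "\<dots> \<le> \<bar>C\<bar> * norm x powr (- q')" using x assms(2) by (intro mult_left_mono powr_mono) auto
    finally show "\<bar>h x\<bar> \<le> \<bar>C\<bar> * norm x powr (- q')" .
  qed
qed

lemma decays_gi: "decays 0 (\<lambda>x. gi f x $ i $ j)"
  by (rule decays_bounded[OF gi_bound])

lemma decays_gi_mult: "decays q h \<Longrightarrow> decays q (\<lambda>x. gi f x $ i $ j * h x)"
  and decays_mult_gi: "decays q h \<Longrightarrow> decays q (\<lambda>x. h x * gi f x $ i $ j)"
  by (auto intro: decays_mult[OF decays_gi] decays_mult[OF _ decays_gi])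

lemma decays_Ui_mult: 
  assumes "decays q h" shows "decays q (\<lambda>x. Ui f x $ a $ b * h x)"
proof -
  have "\<bar>Ui f x $ a $ b\<bar> \<le> 1" for x
  proof -
    have "Ui f x $ a $ b = (Ui f x *v axis b 1) $ a" by (simp add: matrix_vector_mul_component inner_axis)
    also have "\<bar>\<dots>\<bar> \<le> norm (Ui f x *v axis b 1)" by (rule component_le_norm_cart)
    also have "\<dots> \<le> 1"
      using matrix_inv_one_plus_gram(3)[of "transpose (Df f x)" "axis b 1"] by (simp add: Ui_def Umat_eq)
    finally show ?thesis .
  qed
  from decays_mult[OF decays_bounded[OF this] assms] show ?thesis by simp
qed

context
  fixes f :: "real^'n::finite \<Rightarrow> real^'m::finite" and \<tau> :: real
  assumes f: "smooth_map f" and flat: "asymp_flat f \<tau>"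
begin

lemma decays_f1: "decays (\<tau> / 2) (\<lambda>x. f1 f a i x)" and decays_f2: "decays (\<tau> / 2 + 1) (\<lambda>x. f2 f a i j x)"
proof -
  obtain C R where CR: "\<And>x a i j k. norm x \<ge> R \<Longrightarrow>
      \<bar>f1 f a i x\<bar> + \<bar>f2 f a i j x\<bar> * norm x + \<bar>f3 f a i j k x\<bar> * (norm x)\<^sup>2 \<le> C * norm x powr (- (\<tau> / 2))"
    using flat unfolding asymp_flat_def minus_divide_left[symmetric] by blast
  have nn: "0 \<le> \<bar>f2 f a i j x\<bar> * norm x" "0 \<le> \<bar>f3 f a i j k x\<bar> * (norm x)\<^sup>2" for a i j k x by auto
  show "decays (\<tau> / 2) (\<lambda>x. f1 f a i x)"
  proof (rule decaysI)
    show "\<bar>f1 f a i x\<bar> \<le> C * norm x powr (- (\<tau> / 2))" if "norm x \<ge> R" for x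
      using CR[OF that, of a i i i] nn(1)[of a i i x] nn(2)[of a i i i x] by linarith
  qed
  show "decays (\<tau> / 2 + 1) (\<lambda>x. f2 f a i j x)"
  proof (rule decaysI)
    fix x :: "real^'n" assume x: "norm x \<ge> max R 1"
    then have x0: "norm x > 0" by auto
    have "\<bar>f2 f a i j x\<bar> * norm x \<le> C * norm x powr (- (\<tau> / 2))"
    proof -
      have "norm x \<ge> R" using x by simp
      from CR[OF this, of a i j i] nn(2)[of a i j i x] show ?thesis by linarith
    qed
    also have "\<dots> = (C * norm x powr (- (\<tau> / 2 + 1))) * norm x"
      using x0 powr_add[of "norm x" "- (\<tau> / 2 + 1)" 1] by simp
    finally show "\<bar>f2 f a i j x\<bar> \<le> C * norm x powr (- (\<tau> / 2 + 1))"
      using x0 by (rule mult_right_le_imp_le)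
  qed
qed

lemma decays_f2_f2: "decays (\<tau> + 2) (\<lambda>x. f2 f a i j x * f2 f b k l x)"
  by (rule decays_mult[OF decays_f2 decays_f2]) simp

lemma decays_Rm: "decays (\<tau> + 2) (\<lambda>x. Rm f i j k l x)"
  unfolding Rm_eq[OF f] by (intro decays_sum decays_Ui_mult decays_diff decays_f2_f2)

lemma decays_Rm_up: "decays (\<tau> + 2) (\<lambda>x. Rm_up f i j k l x)"
  unfolding Rm_up_def mult.assoc by (intro decays_sum decays_gi_mult decays_Rm)

lemma decays_Ric: "decays (\<tau> + 2) (\<lambda>x. Ric f j l x)"
  unfolding Ric_def by (intro decays_sum decays_gi_mult decays_Rm)

lemma decays_Ric_up: "decays (\<tau> + 2) (\<lambda>x. Ric_up f j l x)"
  unfolding Ric_up_def mult.assoc by (intro decays_sum decays_gi_mult decays_Ric)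

lemma decays_Scal: "decays (\<tau> + 2) (\<lambda>x. Scal f x)"
  unfolding Scal_def by (intro decays_sum decays_gi_mult decays_Ric)

lemma decays_P2: "decays (\<tau> + 2) (\<lambda>x. P2 f i j k l x)"
proof -
  have "decays (\<tau> + 2) (\<lambda>x. (1/2) * Scal f x * (gi f x $ i $ k * gi f x $ j $ l - gi f x $ i $ l * gi f x $ j $ k))"
    by (rule decays_mult[OF decays_cmult[OF decays_Scal] decays_diff[OF decays_gi_mult[OF decays_gi] decays_gi_mult[OF decays_gi]]]) simp
  then show ?thesis
    unfolding P2_def by (intro decays_add decays_diff decays_mult_gi decays_Rm_up decays_Ric_up)
qed

lemma decays_gradf: "decays (\<tau> / 2) (\<lambda>x. gradf f a x $ k)"
  unfolding gradf_nth by (intro decays_sum decays_gi_mult decays_f1)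

lemma decays_shape_grad: "decays (\<tau> + 1) (\<lambda>x. shape_grad f a b x j)"
  unfolding shape_grad_def by (intro decays_sum decays_mult[OF decays_f2 decays_gradf]) simp

text \<open>Every term is quadratic in the first and quadratic in the second derivatives: four
  factors of order \<open>\<tau> / 2\<close>, and one more power for each second derivative.\<close>

lemma decays_Rperp: "decays (2 * \<tau> + 2) (\<lambda>x. Rperp f x)"
proof -
  have "decays (\<tau> + 1) (\<lambda>x. (Aop f a x *v gradf f b x) $ j)" for a b j
    unfolding matrix_vector_mult_def vec_lambda_beta Aop_nth
    by (intro decays_sum decays_mult[OF decays_sum[OF decays_gi_mult[OF decays_f2]] decays_gradf]) simp
  from decays_mult[OF this decays_shape_grad] show ?thesis
    unfolding Rperp_eq[OF f] by (intro decays_sum decays_diff) simp_all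
qed

lemma decays_Tt: "decays (2 * \<tau> + 2) (\<lambda>x. Tt f i j k l x)"
proof -
  have s: "decays (3 * \<tau> / 2 + 2) (\<lambda>x. shape_grad f a b x j * f2 f c i l x)"
    "decays (3 * \<tau> / 2 + 2) (\<lambda>x. f2 f c i l x * shape_grad f a b x j)" for a b c i j l
    by (rule decays_mult[OF decays_shape_grad decays_f2] decays_mult[OF decays_f2 decays_shape_grad], simp)+
  show ?thesis
    unfolding Tt_eq[OF f] by (intro decays_sum decays_mult[OF decays_f1 decays_diff[OF s(1) s(2)]]) simp
qed

text \<open>The rate obtained is \<open>3 * \<tau> + 4\<close>. It is weakened to the rate of
  \<open>Rperp\<close> so that the sum of both is handled with one exponent.\<close>

lemma decays_L2perp:
  assumes "\<tau> \<ge> 0" shows "decays (2 * \<tau> + 2) (\<lambda>x. L2perp f x)"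
proof -
  have "decays (3 * \<tau> + 4) (\<lambda>x. L2perp f x)"
    unfolding L2perp_def by (intro decays_cmult decays_sum decays_mult[OF decays_P2 decays_Tt]) simp
  then show ?thesis by (rule decays_mono) (use assms in simp)
qed

lemma decays_P2_flux:
  "decays (2 * \<tau> + 3) (\<lambda>x. P2 f i j k l x * pd l (\<lambda>y. gm f y $ j $ k) x)"
proof (rule decays_mult[OF decays_P2])
  have "decays (\<tau> + 1) (\<lambda>x. f2 f a i j x * f1 f b k x)" "decays (\<tau> + 1) (\<lambda>x. f1 f b k x * f2 f a i j x)" for a b i j k
    by (rule decays_mult[OF decays_f2 decays_f1] decays_mult[OF decays_f1 decays_f2], simp)+
  then show "decays (\<tau> + 1) (\<lambda>x. pd l (\<lambda>y. gm f y $ j $ k) x)"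
    unfolding pd_gm[OF f] by (intro decays_sum decays_add)
qed simp

lemma P2_flux_tendsto_0:
  assumes "2 * \<tau> > real CARD('n) - 4"
  shows "((\<lambda>r. sphere_int r (\<lambda>x. \<Sigma> i j k l. P2 f i j k l x * pd l (\<lambda>y. gm f y $ j $ k) x * (x $ i / norm x))) \<longlongrightarrow> 0) at_top"
proof -
  let ?h = "\<lambda>x. \<Sigma> i j k l. P2 f i j k l x * pd l (\<lambda>y. gm f y $ j $ k) x * (x $ i / norm x)"
  have nu: "decays 0 (\<lambda>x. x $ i / norm x)" for i :: 'n
  proof (rule decays_bounded)
    show "\<bar>x $ i / norm x\<bar> \<le> 1" for x :: "real^'n"
      using component_le_norm_cart[of x i] by (cases "x = 0") (auto simp: divide_le_eq_1)
  qed
  have dec: "decays (2 * \<tau> + 3) ?h"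
    by (intro decays_sum decays_mult[OF decays_P2_flux nu]) simp
  obtain C R where CR: "\<And>x. norm x \<ge> R \<Longrightarrow> \<bar>?h x\<bar> \<le> C * norm x powr (- (2 * \<tau> + 3))"
    using decaysE[OF dec] by blast
  define K where "K = real CARD('n) * C * measure lborel (ball (0::real^'n) 1)"
  let ?e = "real CARD('n) - 1 - (2 * \<tau> + 3)"
  have "\<forall>\<^sub>F r in at_top. norm (sphere_int r ?h) \<le> K * r powr ?e"
    using eventually_ge_at_top[of "max R 1"]
  proof eventually_elim
    case (elim r)
    then have r: "r > 0" by auto
    have "\<bar>sphere_int r ?h\<bar> \<le> r ^ (CARD('n) - 1) * real CARD('n) * (C * r powr (- (2 * \<tau> + 3)) * measure lborel (ball (0::real^'n) 1))"
      by (rule sphere_int_bound[OF r]) (use CR elim in auto)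
    also have "\<dots> = K * (r powr (real CARD('n) - 1) * r powr (- (2 * \<tau> + 3)))"
      using r by (simp add: K_def powr_realpow[symmetric] of_nat_diff mult_ac)
    also have "\<dots> = K * r powr ?e" by (simp add: powr_add[symmetric])
    finally show ?case by simp
  qed
  moreover have "((\<lambda>r. K * r powr ?e) \<longlongrightarrow> 0) at_top"
    using assms by (intro tendsto_mult_right_zero tendsto_neg_powr filterlim_ident) simp
  ultimately show ?thesis by (rule Lim_null_comparison)
qed

end

section \<open>Fluxes as volume integrals, and the mass\<close>

lemma integrable_indicator_cball:
  fixes h :: "real^'n::finite \<Rightarrow> real"
  assumes "continuous_on UNIV h"
  shows "integrable lborel (\<lambda>x. indicator (cball 0 r) x * h x)"
proof -
  obtain C where C: "C \<ge> 0" "\<And>x. norm x \<le> r \<Longrightarrow> \<bar>h x\<bar> \<le> C"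
    using continuous_bounded_on_cball[OF assms] by blast
  show ?thesis
  proof (rule integrable_lborel_bounded_support)
    show "\<bar>indicator (cball 0 r) x * h x\<bar> \<le> C" for x using C by (auto simp: indicator_def)
    show "indicator (cball 0 r) x * h x = 0" if "norm x > r" for x using that by (auto simp: indicator_def)
  qed (intro borel_measurable_times borel_measurable_indicator borel_measurable_continuous_onI assms, auto)
qed

context
  fixes f :: "real^'n::finite \<Rightarrow> real^'m::finite"
  assumes f: "smooth_map f"
begin

lemma C1_Rm [C1_intros]: "C1_fun (\<lambda>x. Rm f i j k l x)"
  unfolding Rm_eq[OF f] by (intro C1_intros f)

lemma C1_Ric [C1_intros]: "C1_fun (\<lambda>x. Ric f j l x)"
  unfolding Ric_def by (intro C1_intros C1_Rm f)

lemma C1_Scal: "C1_fun (\<lambda>x. Scal f x)"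
  unfolding Scal_def by (intro C1_intros C1_Ric f)

lemma C1_P2: "C1_fun (\<lambda>x. P2 f i j k l x)"
  unfolding P2_def Rm_up_def Ric_up_def by (intro C1_intros C1_Rm C1_Ric C1_Scal f)

lemma C1_L2: "C1_fun (\<lambda>x. L2 f x)"
  unfolding L2_def by (intro C1_intros C1_P2 C1_Rm f)

lemma C1_shape_grad: "C1_fun (\<lambda>x. shape_grad f a b x j)"
  unfolding shape_grad_def by (intro C1_intros f)

lemma C1_Rperp: "C1_fun (\<lambda>x. Rperp f x)"
  unfolding Rperp_eq[OF f] matrix_vector_mult_def vec_lambda_beta by (intro C1_intros C1_shape_grad f)

lemma C1_L2perp: "C1_fun (\<lambda>x. L2perp f x)"
  unfolding L2perp_def Tt_eq[OF f] by (intro C1_intros C1_shape_grad C1_P2 f)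

lemma flux_divergence:
  assumes "r > 0"
  shows "sphere_int r (\<lambda>x. \<Sigma> i j k l. (P1 f i j k l x + lam * P2 f i j k l x) * pd l (\<lambda>y. gm f y $ j $ k) x * (x $ i / norm x))
    = (\<integral>x. indicator (cball 0 r) x * ((1/2) * (Scal f x + lam * L2 f x + Rperp f x + lam * L2perp f x)) \<partial>lborel)"
  using divergence_theorem_ball[of "Vfield f lam", OF C1_fun_differentiable[OF C1_Vfield[OF f]] C1_fun_continuous_pd[OF C1_Vfield[OF f]] assms]
  by (simp only: div_Vfield_eq[OF f] sum_distrib_right[symmetric] flux_eq_Vfield[OF f])

text \<open>The \<open>P2\<close> density times \<lambda> is the flux of the difference of the
  fields for \<lambda> and for 0. The splitting takes place in the volume integrals over the ball,
  where integrability is immediate from continuity.\<close>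

lemma flux_difference:
  assumes r: "r > 0"
  shows "egb_flux lam f r - adm_flux f r = 1 / ((real CARD('n) - 1) * omega CARD('n)) *
    (lam * sphere_int r (\<lambda>x. \<Sigma> i j k l. P2 f i j k l x * pd l (\<lambda>y. gm f y $ j $ k) x * (x $ i / norm x)))"
proof -
  let ?D = "\<lambda>lam x. (1/2) * (Scal f x + lam * L2 f x + Rperp f x + lam * L2perp f x)"
  let ?W = "\<lambda>i x. Vfield f lam i x - Vfield f 0 i x"
  let ?h = "\<lambda>x. \<Sigma> i j k l. P2 f i j k l x * pd l (\<lambda>y. gm f y $ j $ k) x * (x $ i / norm x)"
  have C1: "C1_fun (?W i)" for i by (intro C1_diff C1_Vfield f)
  have D: "continuous_on UNIV (?D l)" for l
    by (intro C1_fun_continuous C1_intros C1_Scal C1_L2 C1_Rperp C1_L2perp)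
  have W: "?W i x = (\<Sigma> j k l. lam * (P2 f i j k l x * pd l (\<lambda>y. gm f y $ j $ k) x))" for i x
    unfolding flux_eq_Vfield[OF f, symmetric] by (simp add: distrib_right sum.distrib mult.assoc)
  have "(\<Sigma> i. ?W i x * (x $ i / norm x)) = lam * ?h x" for x
    unfolding W by (simp only: sum_distrib_left sum_distrib_right mult.assoc)
  then have "sphere_int r (\<lambda>x. lam * ?h x) = sphere_int r (\<lambda>x. \<Sigma> i. ?W i x * (x $ i / norm x))"
    by (simp only:)
  also have "\<dots> = (\<integral>x. indicator (cball 0 r) x * (\<Sigma> i. pd i (?W i) x) \<partial>lborel)"
    by (rule divergence_theorem_ball[of ?W, OF C1_fun_differentiable[OF C1] C1_fun_continuous_pd[OF C1] r])
  also have "\<dots> = (\<integral>x. indicator (cball 0 r) x * ?D lam x - indicator (cball 0 r) x * ?D 0 x \<partial>lborel)"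
  proof -
    have "(\<Sigma> i. pd i (?W i) x) = ?D lam x - ?D 0 x" for x
      unfolding div_Vfield_eq[OF f, symmetric]
      by (simp add: pd_diff C1_fun_differentiable[OF C1_Vfield[OF f]] sum_subtractf)
    then show ?thesis by (simp only: right_diff_distrib)
  qed
  also have "\<dots> = (\<integral>x. indicator (cball 0 r) x * ?D lam x \<partial>lborel) - (\<integral>x. indicator (cball 0 r) x * ?D 0 x \<partial>lborel)"
    by (intro Bochner_Integration.integral_diff integrable_indicator_cball D)
  finally have *: "sphere_int r (\<lambda>x. lam * ?h x) = \<dots>" .
  have "sphere_int r (\<lambda>x. lam * ?h x) = lam * sphere_int r ?h"
    unfolding sphere_int_def by (simp only: set_integral_mult_right mult_ac)
  moreover have "adm_flux f = egb_flux 0 f"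
    by (simp add: fun_eq_iff adm_flux_def egb_flux_def)
  ultimately show ?thesis
    using * by (simp only: egb_flux_def flux_divergence[OF r] right_diff_distrib[symmetric])
qed

end

text \<open>The weight is bounded below: the Leibniz formula has n! terms, each at most 1 in
  absolute value for \<open>gi\<close>, so \<open>1 / G\<close> is at most n! in absolute
  value.\<close>

lemma integrable_of_integrable_volume:
  assumes h: "continuous_on UNIV h" and int: "integrable lborel (\<lambda>x. h x * sqrt (Gdet f x))"
  shows "integrable lborel h"
proof -
  define D where "D = real (card {p. p permutes (UNIV::'a set)})"
  have "\<bar>h x\<bar> \<le> sqrt D * \<bar>h x * sqrt (Gdet f x)\<bar>" for x
  proof -
    have "\<bar>det (gi f x)\<bar> \<le> (\<Sum>p | p permutes (UNIV::'a set). \<bar>of_int (sign p) * (\<Prod>i\<in>UNIV. gi f x $ i $ p i)\<bar>)"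
      unfolding det_def by (rule sum_abs)
    also have "\<dots> \<le> (\<Sum>p | p permutes (UNIV::'a set). 1)"
    proof (rule sum_mono)
      fix p :: "'a \<Rightarrow> 'a"
      have "(\<Prod>i\<in>UNIV. \<bar>gi f x $ i $ p i\<bar>) \<le> 1" by (rule prod_le_1) (simp add: gi_bound)
      then show "\<bar>of_int (sign p) * (\<Prod>i\<in>UNIV. gi f x $ i $ p i)\<bar> \<le> 1"
        by (simp add: abs_mult abs_prod sign_def)
    qed
    finally have "\<bar>inverse (Gdet f x)\<bar> \<le> D" by (simp add: inverse_Gdet D_def)
    then have "1 \<le> D * \<bar>Gdet f x\<bar>" using Gdet_nonzero[of f x] by (simp add: field_simps abs_inverse)
    then have "1 \<le> sqrt (D * \<bar>Gdet f x\<bar>)" by simp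
    \<comment> \<open>\<open>sqrt\<close> is an odd function on the reals, so
      \<open>\<bar>sqrt G\<bar> = sqrt \<bar>G\<bar>\<close> irrespective of the sign of
      \<open>G\<close>.\<close>
    also have "\<dots> = sqrt D * \<bar>sqrt (Gdet f x)\<bar>" by (simp add: real_sqrt_mult real_sqrt_abs2 flip: real_sqrt_abs')
    finally have "1 * \<bar>h x\<bar> \<le> sqrt D * \<bar>sqrt (Gdet f x)\<bar> * \<bar>h x\<bar>" by (rule mult_right_mono) simp
    then show ?thesis by (simp add: abs_mult mult_ac)
  qed
  then show ?thesis
    by (intro Bochner_Integration.integrable_bound[OF integrable_mult_right[OF integrable_abs[OF int], of "sqrt D"]])
       (auto intro!: borel_measurable_continuous_onI h AE_I2 order_trans[OF _ abs_ge_self])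
qed

theorem theorem6p1:
  fixes f :: "real^'n::finite \<Rightarrow> real^'m::finite" and lam \<tau> :: real
  assumes "CARD('n) \<ge> 4"
    and "smooth_map f"
    and "asymp_flat f \<tau>"
    and "\<tau> > (real CARD('n) - 2) / 2"
    and "integrable lborel (\<lambda>x. (Scal f x + lam * L2 f x) * sqrt (Gdet f x))"
  shows "\<exists>mass::real.
      (adm_flux f \<longlongrightarrow> mass) at_top
    \<and> (egb_flux lam f \<longlongrightarrow> mass) at_top
    \<and> integrable lborel (\<lambda>x. (Scal f x + lam * L2 f x + Rperp f x + lam * L2perp f x)
                                 / sqrt (Gdet f x) * sqrt (Gdet f x))
    \<and> mass = 1 / (2 * (real CARD('n) - 1) * omega CARD('n)) *
        (\<integral>x. (Scal f x + lam * L2 f x + Rperp f x + lam * L2perp f x)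
                / sqrt (Gdet f x) * sqrt (Gdet f x) \<partial>lborel)
    \<and> ((flat_normal_bundle f \<and> (\<forall>x. Scal f x + lam * L2 f x \<ge> 0)) \<longrightarrow> mass \<ge> 0)"
proof -
  note f = assms(2) and flat = assms(3)
  let ?S = "\<lambda>x. Scal f x + lam * L2 f x"
  let ?u = "\<lambda>x. Scal f x + lam * L2 f x + Rperp f x + lam * L2perp f x"
  define k where "k = 1 / ((real CARD('n) - 1) * omega CARD('n))"
  \<comment> \<open>The three inequalities serve the decay of \<open>L2perp\<close>, the
    integrability of the normal terms, and the vanishing of the \<open>P2\<close> flux, in this
    order.\<close>
  have \<tau>: "\<tau> > 0" "2 * \<tau> + 2 > real DIM(real^'n)" "2 * \<tau> > real CARD('n) - 4" using assms(1,4) by auto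
  have S: "integrable lborel ?S"
    by (rule integrable_of_integrable_volume[OF C1_fun_continuous assms(5)]) (intro C1_intros C1_Scal C1_L2 f)
  have dec: "decays (2 * \<tau> + 2) (\<lambda>x. Rperp f x + lam * L2perp f x)"
    using \<tau> by (intro decays_add decays_cmult decays_Rperp decays_L2perp f flat) auto
  obtain C R where CR: "\<And>x. norm x \<ge> R \<Longrightarrow> \<bar>Rperp f x + lam * L2perp f x\<bar> \<le> C * norm x powr (- (2 * \<tau> + 2))"
    using decaysE[OF dec] by blast
  have "integrable lborel (\<lambda>x. Rperp f x + lam * L2perp f x)"
    by (rule integrable_lborel_power_decay[OF C1_fun_continuous \<tau>(2) CR]) (intro C1_intros C1_Rperp C1_L2perp f)
  from Bochner_Integration.integrable_add[OF S this] have u: "integrable lborel ?u" by (simp add: add.assoc)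
  define mass where "mass = k * ((1/2) * (\<integral>x. ?u x \<partial>lborel))"
  have egb_eq: "egb_flux l f r = k * (\<integral>x. indicator (cball 0 r) x * ((1/2) * (Scal f x + l * L2 f x + Rperp f x + l * L2perp f x)) \<partial>lborel)"
    if "r > 0" for l r
    by (simp only: egb_flux_def k_def flux_divergence[OF f that])
  have egb: "(egb_flux lam f \<longlongrightarrow> mass) at_top"
  proof -
    have "((\<lambda>r. k * (\<integral>x. indicator (cball 0 r) x * ((1/2) * ?u x) \<partial>lborel)) \<longlongrightarrow> k * (\<integral>x. (1/2) * ?u x \<partial>lborel)) at_top"
      by (intro tendsto_mult tendsto_const integral_cball_tendsto integrable_mult_right u)
    then have "((\<lambda>r. k * (\<integral>x. indicator (cball 0 r) x * ((1/2) * ?u x) \<partial>lborel)) \<longlongrightarrow> mass) at_top"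
      unfolding mass_def using u by simp
    moreover have "\<forall>\<^sub>F r in at_top. k * (\<integral>x. indicator (cball 0 r) x * ((1/2) * ?u x) \<partial>lborel) = egb_flux lam f r"
      using eventually_gt_at_top[of 0] by eventually_elim (rule egb_eq[symmetric])
    ultimately show ?thesis by (rule Lim_transform_eventually)
  qed
  let ?p = "\<lambda>r. sphere_int r (\<lambda>x. \<Sigma> i j k l. P2 f i j k l x * pd l (\<lambda>y. gm f y $ j $ k) x * (x $ i / norm x))"
  \<comment> \<open>The ADM flux equals the EGB flux minus a term tending to 0, so it inherits the
    limit although \<open>Scal\<close> alone is not known to be integrable.\<close>
  have adm: "(adm_flux f \<longlongrightarrow> mass) at_top"
  proof -
    have "((\<lambda>r. egb_flux lam f r - k * (lam * ?p r)) \<longlongrightarrow> mass - k * (lam * 0)) at_top"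
      by (intro tendsto_diff tendsto_mult tendsto_const egb P2_flux_tendsto_0[OF f flat \<tau>(3)])
    then have "((\<lambda>r. egb_flux lam f r - k * (lam * ?p r)) \<longlongrightarrow> mass) at_top" by simp
    moreover have "\<forall>\<^sub>F r in at_top. egb_flux lam f r - k * (lam * ?p r) = adm_flux f r"
      using eventually_gt_at_top[of 0]
    proof eventually_elim
      case (elim r)
      from flux_difference[OF f this, of lam] show ?case by (simp add: k_def)
    qed
    ultimately show ?thesis by (rule Lim_transform_eventually)
  qed
  \<comment> \<open>The density of \<open>d\<mu>_M\<close> is \<open>sqrt G\<close>, which cancels
    the factor \<open>1 / sqrt G\<close>: the integral over \<open>M\<close> is a plain Lebesgue
    integral.\<close>
  have sq: "?u x / sqrt (Gdet f x) * sqrt (Gdet f x) = ?u x" for x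
    using Gdet_nonzero[of f x] by simp
  have "mass \<ge> 0" if "flat_normal_bundle f" "\<forall>x. ?S x \<ge> 0"
  proof -
    have "(\<integral>x. ?u x \<partial>lborel) \<ge> 0"
      using that by (intro integral_nonneg_AE AE_I2) (simp add: Rperp_flat L2perp_flat[OF f])
    moreover have "k \<ge> 0" using assms(1) by (simp add: k_def omega_def)
    ultimately show ?thesis by (simp add: mass_def)
  qed
  then show ?thesis
    using adm egb u unfolding sq by (intro exI[of _ mass]) (simp add: mass_def k_def)
qed

end
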